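(* Let $n\ge2$, $0\le a<b\le\infty$, and $f\in\mathcal S_r(\mathbb R^{n-1}\times\mathbb R^{n-1})$ with $f(\mathbf x,\mathbf y)=\mathbf f(\mathbf x,|\mathbf y|)$. Then for every real $k<n-1$, $$P_{(a,b)}I_1^kf=(2\pi)^{1-n}\,C\,I_1^{k+1-n}\,C_{(a,b)}f$$ and $$\mathbf P_{(a,b)}I_1^k\mathbf f=(2\pi)^{1-n}\,\mathcal C\,I_1^{k+1-n}\,\mathcal C_{(a,b)}\mathbf f.$$
   Context: $\mathcal S_r(\mathbb R^{n-1}\times\mathbb R^{n-1})$ is the set of Schwartz functions $f\in\mathcal S(\mathbb R^{2(n-1)})$ with $f(\mathbf x,\mathbf y)=f(\mathbf x,U\mathbf y)$ for all $(\mathbf x,\mathbf y)$ and all orthogonal transformations $U$ of $\mathbb R^{n-1}$. The cone transform is $Cf(\mathbf u,\mathbf v)=\int_{\mathbb R^{n-1}}f(\mathbf u+|\mathbf v|\mathbf y,\mathbf y)\,d\mathbf y$. For $\mathbf f$ on $\mathbb R^{n-1}\times[0,\infty)$, $$\mathcal C\mathbf f(\mathbf u,s)=\int_{S^{n-2}}\int_0^\infty\mathbf f(\mathbf u+zs\boldsymbol\theta,z)z^{n-2}\,dz\,dS(\boldsymbol\theta)\ (n\ge3),\qquad \mathcal C\mathbf f(u,s)=\int_0^\infty\big(\mathbf f(u+zs,z)+\mathbf f(u-zs,z)\big)dz\ (n=2),$$ so $Cf(\mathbf u,\mathbf v)=\mathcal C\mathbf f(\mathbf u,|\mathbf v|)$.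 The limited cone transforms are $C_{(a,b)}f(\mathbf u,\mathbf v)=\chi_{a<|\mathbf v|<b}(\mathbf v)\,Cf(\mathbf u,\mathbf v)$ and $\mathcal C_{(a,b)}\mathbf f(\mathbf u,s)=\chi_{a<s<b}(s)\,\mathcal C\mathbf f(\mathbf u,s)$, with $\chi$ the indicator function. $\mathcal F$ is the $2(n-1)$-dimensional Fourier transform and $\mathcal F_1$ the $(n-1)$-dimensional Fourier transform in the first variable (convention $\int e^{-ix\cdot\xi}g(x)\,dx$). The Riesz potential $I_1^k$ acts on the first $(n-1)$-dimensional variable: $\mathcal F_1(I_1^kg)(\boldsymbol\xi,\cdot)=|\boldsymbol\xi|^{-k}\mathcal F_1g(\boldsymbol\xi,\cdot)$. The projection operators are $$P_{(a,b)}f(\mathbf x,\mathbf y)=\mathcal F^{-1}\big(\chi_{a|\boldsymbol\xi|<|\boldsymbol\eta|<b|\boldsymbol\xi|}(\boldsymbol\eta)\,\mathcal Ff(\boldsymbol\xi,\boldsymbol\eta)\big)(\mathbf x,\mathbf y),$$ $$\mathbf P_{(a,b)}\mathbf f(\mathbf x,z)=z^{\frac{3-n}2}\,\mathbf H_{\frac{n-3}2}\,\mathcal F_1^{-1}\big(\chi_{a|\boldsymbol\xi|<\rho<b|\boldsymbol\xi|}(\rho)\,\rho^{\frac{3-n}2}\,\mathbf H_{\frac{n-3}2}\mathcal F_1\mathbf f(\boldsymbol\xi,\rho)\big)(\mathbf x,z),$$ where $\mathbf H_{\frac{n-3}2}$ acts on the second (scalar) variable by $\mathbf H_{\frac{n-3}2}g(\rho)=\int_0^\infty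 g(s)\,s^{\frac{n-1}2}J_{\frac{n-3}2}(s\rho)\,ds$ and $J_\nu$ is the Bessel function of the first kind of order $\nu$. *)

theory Defs
  imports "HOL-Analysis.Analysis"
begin

text \<open>
  Throughout, \<open>'m\<close> is the index type of the space \<open>R^(n-1)\<close>, i.e. \<open>CARD('m) = n - 1\<close>.
  Functions of two variables are functions on a product type; a function on
  \<open>R^(n-1) \<times> [0,\<infinity>)\<close> is represented by one on \<open>(real^'m) \<times> real\<close> whose values at negative
  second arguments are irrelevant.
\<close>

section \<open>Schwartz functions\<close>

primrec iter_partial :: "'a list \<Rightarrow> ('a::euclidean_space \<Rightarrow> complex) \<Rightarrow> 'a \<Rightarrow> complex" where
  "iter_partial [] f = f"
| "iter_partial (i # ds) f = (\<lambda>x. frechet_derivative (iter_partial ds f) (at x) i)"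

definition schwartz :: "('a::euclidean_space \<Rightarrow> complex) \<Rightarrow> bool" where
  "schwartz f \<longleftrightarrow> (\<forall>ds. set ds \<subseteq> Basis \<longrightarrow>
      (\<forall>x. iter_partial ds f differentiable (at x)) \<and>
      (\<forall>N::nat. bounded (range (\<lambda>x. norm x ^ N *\<^sub>R iter_partial ds f x))))"

definition schwartz_radial :: "((real^'m) \<times> (real^'m) \<Rightarrow> complex) set" where
  "schwartz_radial = {f. schwartz f \<and>
      (\<forall>U. orthogonal_transformation U \<longrightarrow> (\<forall>x y. f (x, y) = f (x, U y)))}"

section \<open>Fourier transform\<close>

definition fourier_L1 :: "('a::euclidean_space \<Rightarrow> complex) \<Rightarrow> 'a \<Rightarrow> complex" where
  "fourier_L1 g \<xi> = (LINT x|lborel. exp (- (\<i> * complex_of_real (x \<bullet> \<xi>))) * g x)"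

definition tempered_fun :: "('a::euclidean_space \<Rightarrow> complex) \<Rightarrow> bool" where
  "tempered_fun g \<longleftrightarrow> (\<exists>N::nat. integrable lborel (\<lambda>x. g x /\<^sub>R (1 + norm x) ^ N))"

text \<open>The function \<open>G\<close> represents the Fourier transform of \<open>g\<close> as a tempered distribution.\<close>

definition tempered_fourier ::
    "('a::euclidean_space \<Rightarrow> complex) \<Rightarrow> ('a \<Rightarrow> complex) \<Rightarrow> bool" where
  "tempered_fourier g G \<longleftrightarrow> tempered_fun g \<and> tempered_fun G \<and>
      (\<forall>\<phi>. schwartz \<phi> \<longrightarrow>
        (LINT x|lborel. g x * fourier_L1 \<phi> x) = (LINT \<xi>|lborel. G \<xi> * \<phi> \<xi>))"

text \<open>
  For \<open>0 < k < n - 1\<close> the Riesz potential of a Schwartz function is in general not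
  integrable (nor, for \<open>k \<ge> (n - 1) / 2\<close>, square integrable), so its Fourier transform has to be
  taken in the sense of tempered distributions. A representative \<open>G\<close> of that distribution
  is determined only almost everywhere; its value at a point is fixed as the limit of its
  averages over shrinking balls, which does not depend on the choice of \<open>G\<close> and
  equals \<open>G \<xi>\<close> wherever \<open>G\<close> is continuous.
\<close>

definition fourier :: "('a::euclidean_space \<Rightarrow> complex) \<Rightarrow> 'a \<Rightarrow> complex" where
  "fourier g \<xi> =
     (if integrable lborel g then fourier_L1 g \<xi>
      else (THE c. \<exists>G. tempered_fourier g G \<and>
        ((\<lambda>r. (LINT \<eta>:ball \<xi> r|lborel. G \<eta>) /\<^sub>R measure lborel (ball \<xi> r)) \<longlongrightarrow> c) (at_right 0)))"

definition inv_fourier :: "('a::euclidean_space \<Rightarrow> complex) \<Rightarrow> 'a \<Rightarrow> complex" where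
  "inv_fourier G x = (2 * pi) powi (- int DIM('a)) *\<^sub>R fourier G (- x)"

definition fourier1 :: "(('a::euclidean_space) \<times> 'b \<Rightarrow> complex) \<Rightarrow> 'a \<times> 'b \<Rightarrow> complex" where
  "fourier1 g = (\<lambda>(\<xi>, y). fourier (\<lambda>x. g (x, y)) \<xi>)"

definition inv_fourier1 :: "(('a::euclidean_space) \<times> 'b \<Rightarrow> complex) \<Rightarrow> 'a \<times> 'b \<Rightarrow> complex" where
  "inv_fourier1 G = (\<lambda>(x, y). inv_fourier (\<lambda>\<xi>. G (\<xi>, y)) x)"

definition riesz1 ::
    "real \<Rightarrow> (('a::euclidean_space) \<times> 'b \<Rightarrow> complex) \<Rightarrow> 'a \<times> 'b \<Rightarrow> complex" where
  "riesz1 k g = inv_fourier1 (\<lambda>(\<xi>, y). norm \<xi> powr (- k) *\<^sub>R fourier1 g (\<xi>, y))"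

section \<open>Cone transforms\<close>

definition cone_transform :: "((real^'m) \<times> (real^'m) \<Rightarrow> complex) \<Rightarrow> (real^'m) \<times> (real^'m) \<Rightarrow> complex" where
  "cone_transform f = (\<lambda>(u, v). LINT y|lborel. f (u + norm v *\<^sub>R y, y))"

text \<open>
  Surface measure of the unit sphere: the surface measure of a Borel set \<open>A\<close> is the dimension
  times the volume of the cone \<open>{r \<theta> | 0 < r < 1, \<theta> \<in> A}\<close>, i.e. the dimension times
  the push-forward of Lebesgue measure on the punctured unit ball under \<open>x \<mapsto> x / norm x\<close>.
\<close>

definition sphere_measure :: "'a::euclidean_space measure" where
  "sphere_measure = scale_measure (of_nat DIM('a))
     (distr (restrict_space lborel (ball 0 1 - {0})) (restrict_space borel (sphere 0 1))
        (\<lambda>x. x /\<^sub>R norm x))"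

text \<open>In the one-dimensional case \<open>vec 1\<close> is the unit vector of \<open>real^'m\<close>.\<close>

definition cone_rad :: "((real^'m) \<times> real \<Rightarrow> complex) \<Rightarrow> (real^'m) \<times> real \<Rightarrow> complex" where
  "cone_rad f = (\<lambda>(u, s).
     if CARD('m) = 1
     then LINT z:{0<..}|lborel. f (u + (z * s) *\<^sub>R vec 1, z) + f (u - (z * s) *\<^sub>R vec 1, z)
     else LINT \<theta>|sphere_measure. (LINT z:{0<..}|lborel.
            z ^ (CARD('m) - 1) *\<^sub>R f (u + (z * s) *\<^sub>R \<theta>, z)))"

definition cone_lim ::
    "real \<Rightarrow> ereal \<Rightarrow> ((real^'m) \<times> (real^'m) \<Rightarrow> complex) \<Rightarrow> (real^'m) \<times> (real^'m) \<Rightarrow> complex" where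
  "cone_lim a b f = (\<lambda>(u, v).
     indicator {v. a < norm v \<and> ereal (norm v) < b} v * cone_transform f (u, v))"

definition cone_rad_lim ::
    "real \<Rightarrow> ereal \<Rightarrow> ((real^'m) \<times> real \<Rightarrow> complex) \<Rightarrow> (real^'m) \<times> real \<Rightarrow> complex" where
  "cone_rad_lim a b f = (\<lambda>(u, s).
     indicator {s. a < s \<and> ereal s < b} s * cone_rad f (u, s))"

section \<open>Projection operators\<close>

definition proj ::
    "real \<Rightarrow> ereal \<Rightarrow> ((real^'m) \<times> (real^'m) \<Rightarrow> complex) \<Rightarrow> (real^'m) \<times> (real^'m) \<Rightarrow> complex" where
  "proj a b f = inv_fourier (\<lambda>(\<xi>, \<eta>).
     indicator {\<eta>. a * norm \<xi> < norm \<eta> \<and> ereal (norm \<eta>) < b * ereal (norm \<xi>)} \<eta> *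
     fourier f (\<xi>, \<eta>))"

text \<open>Bessel function of the first kind, for arguments \<open>x > 0\<close> only.\<close>

definition bessel_J :: "real \<Rightarrow> real \<Rightarrow> real" where
  "bessel_J \<nu> x =
     (x / 2) powr \<nu> * (\<Sum>j. (- 1) ^ j * rGamma (real j + \<nu> + 1) / fact j * (x / 2) ^ (2 * j))"

definition hankel :: "real \<Rightarrow> (real \<Rightarrow> complex) \<Rightarrow> real \<Rightarrow> complex" where
  "hankel \<nu> g \<rho> = (LINT s:{0<..}|lborel. (s powr (\<nu> + 1) * bessel_J \<nu> (s * \<rho>)) *\<^sub>R g s)"

text \<open>
  With \<open>\<nu> = (n - 3) / 2\<close> one has \<open>\<nu> + 1 = (n - 1) / 2\<close> and \<open>- \<nu> = (3 - n) / 2\<close>.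
  For \<open>z = 0\<close> the defining formula is in general an indeterminate product
  (\<open>z powr (- \<nu>)\<close> against the behaviour \<open>z powr \<nu>\<close> of the Bessel function), and
  the value is its limit as \<open>z\<close> tends to \<open>0\<close> from the right.
\<close>

definition proj_rad_formula ::
    "real \<Rightarrow> ereal \<Rightarrow> ((real^'m) \<times> real \<Rightarrow> complex) \<Rightarrow> (real^'m) \<times> real \<Rightarrow> complex" where
  "proj_rad_formula a b f = (\<lambda>(x, z).
     let \<nu> = (real CARD('m) - 2) / 2;
         G = inv_fourier1 (\<lambda>(\<xi>, \<rho>).
               indicator {\<rho>. a * norm \<xi> < \<rho> \<and> ereal \<rho> < b * ereal (norm \<xi>)} \<rho> *
               (\<rho> powr (- \<nu>) *\<^sub>R hankel \<nu> (\<lambda>s. fourier1 f (\<xi>, s)) \<rho>))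
     in z powr (- \<nu>) *\<^sub>R hankel \<nu> (\<lambda>\<rho>. G (x, \<rho>)) z)"

definition proj_rad ::
    "real \<Rightarrow> ereal \<Rightarrow> ((real^'m) \<times> real \<Rightarrow> complex) \<Rightarrow> (real^'m) \<times> real \<Rightarrow> complex" where
  "proj_rad a b f = (\<lambda>(x, z).
     if z = 0 then Lim (at_right 0) (\<lambda>t. proj_rad_formula a b f (x, t))
     else proj_rad_formula a b f (x, z))"

end

theory Submission
  imports "HOL-Probability.Probability" Defs
begin

text \<open>
  Both sides of the first identity are superpositions of plane waves in \<open>x\<close>. By Fubini, the Fourier
  transform of \<open>u \<mapsto> Cf(u, v)\<close> at \<open>\<xi>\<close> is \<open>\<F>f(\<xi>, -|v|\<xi>)\<close>, which for radial \<open>f\<close> equals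
  \<open>\<F>f(\<xi>, |\<xi>|v)\<close>. Applying \<open>C\<close> once more and substituting \<open>\<eta> = |\<xi>|w\<close> turns the condition
  \<open>a < |w| < b\<close> into \<open>a|\<xi>| < |\<eta>| < b|\<xi>|\<close> and produces the Jacobian \<open>|\<xi>|^(1-n)\<close>, while the
  phase \<open>|y| \<eta>\<cdot>\<xi>/|\<xi>|\<close> may be replaced by \<open>\<eta>\<cdot>y\<close> under the integral since \<open>\<F>f(\<xi>, \<cdot>)\<close> is radial.
  The second identity is the first one in polar coordinates: the Fourier transform of surface measure
  on the sphere is a Bessel function, so that \<open>H\<close> computes Fourier transforms of radial functions.
  As \<open>I_1^k f\<close> need not be integrable, its Fourier transform is identified as a tempered
  distribution, by testing against Gaussians.
\<close>

section \<open>Lebesgue measure under affine maps\<close>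

text \<open>The hypothesis \<open>k < n - 1\<close> makes \<open>norm \<xi> powr (- k)\<close>
  locally integrable, hence \<open>G\<close> integrable on the product space, so that Fubini applies
  in either order. On the cone side the symbol has the exponent \<open>n - 1 - k > 0\<close>, and no
  singularity arises. The obstacle is that the operators are composed pointwise, whereas
  \<open>fourier\<close> of a non-integrable function is a limit of ball averages of some
  distributional representative. Two facts settle this: a tempered function that annihilates all
  Schwartz functions has integral 0 over every ball, and the symbol of the Riesz potential is
  continuous off \<open>\<xi> = 0\<close>, where the averages return its values. At
  \<open>\<xi> = 0\<close> the cut-off of the projection vanishes. Only the Riesz potentials of
  \<open>f\<close> and \<open>f_rad\<close> are transformed in this sense; all other transforms are
  of integrable functions. As the surface measure is an image of Lebesgue measure on the ball and
  \<open>bessel_J\<close> a power series, polar coordinates are obtained by a scaling argument, and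
  the spherical Fourier transform by computing the moments of the sphere from those of a
  Gaussian.\<close>

lemma nn_integral_lborel_affine:
  fixes t :: "'a::euclidean_space"
  assumes [measurable]: "h \<in> borel_measurable borel" and "c \<noteq> 0"
  shows "(\<integral>\<^sup>+x. h x \<partial>lborel) = ennreal (\<bar>c\<bar> ^ DIM('a)) * (\<integral>\<^sup>+x. h (t + c *\<^sub>R x) \<partial>lborel)"
  by (subst lborel_affine[OF assms(2), of t])
     (simp add: nn_integral_density nn_integral_distr nn_integral_cmult ennreal_power)

lemma
  fixes t :: "'a::euclidean_space" and h :: "'a \<Rightarrow> 'b::{banach, second_countable_topology}"
  assumes c: "c \<noteq> 0"
  shows integrable_lborel_affine_iff:
      "integrable lborel (\<lambda>x. h (t + c *\<^sub>R x)) \<longleftrightarrow> integrable lborel h"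
    and integral_lborel_affine:
      "(LINT x|lborel. h x) = \<bar>c\<bar> ^ DIM('a) *\<^sub>R (LINT x|lborel. h (t + c *\<^sub>R x))"
proof -
  have one: "integrable lborel (\<lambda>x. h (t + c *\<^sub>R x))" if "integrable lborel h" "c \<noteq> 0"
    for h :: "'a \<Rightarrow> 'b" and c t
  proof -
    have [measurable]: "h \<in> borel_measurable borel" using that by auto
    have "integrable (density (distr lborel borel (\<lambda>x. t + c *\<^sub>R x)) (\<lambda>_. \<bar>c\<bar> ^ DIM('a))) h"
      using lborel_affine[OF that(2), of t] that(1) by simp
    then have "integrable lborel (\<lambda>x. \<bar>c\<bar> ^ DIM('a) *\<^sub>R h (t + c *\<^sub>R x))"
      by (simp add: integrable_density integrable_distr_eq)
    from integrable_scaleR_right[OF this, of "inverse (\<bar>c\<bar> ^ DIM('a))"] show ?thesis using that(2) by simp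
  qed
  show iff: "integrable lborel (\<lambda>x. h (t + c *\<^sub>R x)) \<longleftrightarrow> integrable lborel h"
  proof
    assume "integrable lborel (\<lambda>x. h (t + c *\<^sub>R x))"
    from one[OF this, of "inverse c" "- inverse c *\<^sub>R t"] c show "integrable lborel h"
      by (simp add: scaleR_diff_right)
  qed (use one c in auto)
  show "(LINT x|lborel. h x) = \<bar>c\<bar> ^ DIM('a) *\<^sub>R (LINT x|lborel. h (t + c *\<^sub>R x))"
  proof (cases "integrable lborel h")
    case True
    then have [measurable]: "h \<in> borel_measurable borel" by auto
    show ?thesis
      by (subst lborel_affine[OF c, of t]) (simp add: integral_density integral_distr)
  next
    case False
    \<comment> \<open>Both integrals are 0 by convention here, so the substitution rule holds for
      every \<open>h\<close>.\<close>
    then show ?thesis using iff by (simp add: not_integrable_integral_eq)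
  qed
qed

section \<open>Polar coordinates\<close>

lemma sets_sphere_measure:
  "sets (sphere_measure :: 'a::euclidean_space measure) = sets (restrict_space borel (sphere 0 1))"
  by (simp add: sphere_measure_def)

lemma space_sphere_measure [simp]:
  "space (sphere_measure :: 'a::euclidean_space measure) = sphere 0 1"
  using sets_eq_imp_space_eq[OF sets_sphere_measure] by (simp add: space_restrict_space)

lemma measurable_ident_sphere_measure:
  "(\<lambda>x. x) \<in> measurable (sphere_measure :: 'a::euclidean_space measure) borel"
  using measurable_restrict_space1[OF measurable_ident_sets[OF refl], of borel "sphere 0 1"]
  by (simp add: measurable_cong_sets[OF sets_sphere_measure refl])

lemma measurable_sphere_measureI:
  "f \<in> measurable borel N \<Longrightarrow> f \<in> measurable (sphere_measure :: 'a::euclidean_space measure) N"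
  using measurable_compose[OF measurable_ident_sphere_measure] by auto

lemma measurable_normalize:
  "(\<lambda>x::'a::euclidean_space. x /\<^sub>R norm x) \<in>
     measurable (restrict_space lborel (ball 0 1 - {0})) (restrict_space borel (sphere 0 1))"
proof (rule measurable_restrict_space2)
  show "(\<lambda>x::'a. x /\<^sub>R norm x) \<in> restrict_space lborel (ball 0 1 - {0}) \<rightarrow>\<^sub>M borel"
    by (rule measurable_restrict_space1) measurable
qed (auto simp: space_restrict_space)

lemma nn_integral_sphere_measure:
  fixes \<phi> :: "'a::euclidean_space \<Rightarrow> ennreal"
  assumes "\<phi> \<in> borel_measurable sphere_measure"
  shows "(\<integral>\<^sup>+\<theta>. \<phi> \<theta> \<partial>sphere_measure) =
     of_nat DIM('a) * (\<integral>\<^sup>+x. \<phi> (x /\<^sub>R norm x) * indicator (ball 0 1 - {0}) x \<partial>lborel)"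
proof -
  have m: "\<phi> \<in> borel_measurable (restrict_space borel (sphere 0 1))"
    using assms by (subst (asm) measurable_cong_sets[OF sets_sphere_measure refl])
  show ?thesis
    by (simp add: sphere_measure_def nn_integral_scale_measure nn_integral_distr m measurable_normalize
          nn_integral_restrict_space)
qed

lemma finite_measure_sphere: "finite_measure (sphere_measure :: 'a::euclidean_space measure)"
proof
  have "emeasure (sphere_measure :: 'a measure) (space sphere_measure)
      = (\<integral>\<^sup>+\<theta>. 1 \<partial>(sphere_measure :: 'a measure))"
    by simp
  also have "\<dots> \<le> of_nat DIM('a) * (\<integral>\<^sup>+x. indicator (ball 0 1) x \<partial>(lborel :: 'a measure))"
    by (subst nn_integral_sphere_measure) (auto intro!: mult_left_mono emeasure_mono)
  also have "\<dots> < \<infinity>"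
    using emeasure_lborel_ball_finite[of "0::'a" 1]
    by (auto simp: ennreal_mult_eq_top_iff less_top[symmetric])
  finally show "emeasure (sphere_measure :: 'a measure) (space sphere_measure) \<noteq> \<infinity>" by simp
qed

interpretation sphere_measure: finite_measure "sphere_measure :: 'a::euclidean_space measure"
  by (rule finite_measure_sphere)

text \<open>In \<open>nn_integral_polar\<close> this is the integral left over at a point
  \<open>y\<close> with \<open>r = norm y\<close>. The factor \<open>D\<close> comes from the
  normalisation of \<open>sphere_measure\<close>, and the value 1 shows that this normalisation is
  the right one.\<close>

lemma nn_integral_tail_power:
  fixes r :: real
  assumes r: "r > 0"  and D: "D > 0"
  shows "(\<integral>\<^sup>+s. ennreal (real D * r ^ D / s ^ Suc D) * indicator {r<..} s \<partial>lborel) = 1"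
proof -
  have "(\<integral>\<^sup>+s. ennreal (real D * r ^ D / s ^ Suc D) * indicator {r<..} s \<partial>lborel)
     = (\<integral>\<^sup>+s. ennreal (real D * r ^ D / s ^ Suc D) * indicator {r..} s \<partial>lborel)"
    by (rule nn_integral_cong_AE, rule AE_mp[OF AE_lborel_singleton[of r]])
       (auto split: split_indicator)
  also have "\<dots> = ennreal (0 - (- (r ^ D / r ^ D)))"
  proof (rule nn_integral_FTC_atLeast[where F="\<lambda>s. - (r ^ D / s ^ D)"])
    fix s assume s: "r \<le> s"
    show "((\<lambda>s. - (r ^ D / s ^ D)) has_real_derivative real D * r ^ D / s ^ Suc D) (at s)"
      using s r D by (auto intro!: derivative_eq_intros simp: field_simps) (metis Suc_pred power_Suc)
  next
    show "((\<lambda>s. - (r ^ D / s ^ D)) \<longlongrightarrow> 0) at_top"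
      using D by real_asymp
  qed (use r in auto)
  finally show ?thesis using r by simp
qed

text \<open>Insert the definition of the surface measure, substitute \<open>r = |x| s\<close> in the inner and
  \<open>y = s x\<close> in the outer integral, and integrate over \<open>s > |y|\<close>.\<close>

theorem nn_integral_polar:
  fixes h :: "'a::euclidean_space \<Rightarrow> ennreal"
  assumes [measurable]: "h \<in> borel_measurable borel"
  shows "(\<integral>\<^sup>+x. h x \<partial>lborel) =
    (\<integral>\<^sup>+\<theta>. (\<integral>\<^sup>+r. ennreal (r ^ (DIM('a) - 1)) * h (r *\<^sub>R \<theta>) * indicator {0<..} r \<partial>lborel) \<partial>sphere_measure)"
proof -
  let ?D = "DIM('a)"
  let ?I = "\<lambda>\<theta>. \<integral>\<^sup>+r. ennreal (r ^ (?D - 1)) * h (r *\<^sub>R \<theta>) * indicator {0<..} r \<partial>lborel"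
  let ?p = "\<lambda>s (y::'a). ennreal (norm y ^ ?D / s ^ Suc ?D)"
  let ?q = "\<lambda>s (x::'a). ennreal (norm x ^ ?D * s ^ (?D - 1)) * h (s *\<^sub>R x)"
  have [measurable]: "ball 0 s - {0::'a} \<in> sets borel" for s by auto
  have [measurable]: "Measurable.pred (borel \<Otimes>\<^sub>M borel) (\<lambda>x. (fst x :: real) \<in> {norm (snd x :: 'a)<..})"
    by simp
  have [measurable]: "Measurable.pred borel (\<lambda>y::'a. s \<in> {norm y<..})" for s :: real
    by simp
  have m: "?I \<in> borel_measurable sphere_measure"
    by (rule measurable_sphere_measureI) measurable
  have inner: "?I (x /\<^sub>R norm x)
     = (\<integral>\<^sup>+s. ?q s x * indicator {0<..} s \<partial>lborel)"
    if x: "x \<noteq> 0" for x :: 'a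
  proof -
    have "?I (x /\<^sub>R norm x)
      = ennreal (norm x) * (\<integral>\<^sup>+s. ennreal ((norm x * s) ^ (?D - 1)) * h (s *\<^sub>R x) * indicator {0<..} (norm x * s) \<partial>lborel)"
      using x by (subst nn_integral_real_affine[where c="norm x" and t=0]) (auto simp: field_simps)
    also have "\<dots> = (\<integral>\<^sup>+s. ennreal (norm x) * (ennreal ((norm x * s) ^ (?D - 1)) * h (s *\<^sub>R x) * indicator {0<..} (norm x * s)) \<partial>lborel)"
      by (rule nn_integral_cmult[symmetric]) measurable
    also have "\<dots> = (\<integral>\<^sup>+s. ?q s x * indicator {0<..} s \<partial>lborel)"
    proof (rule nn_integral_cong, clarsimp split: split_indicator simp: x zero_less_mult_iff)
      fix s :: real assume "0 < s"
      have "norm x ^ ?D = norm x * norm x ^ (?D - 1)"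
        by (metis DIM_positive power_eq_if neq0_conv)
      then show "ennreal (norm x) * (ennreal ((norm x * s) ^ (?D - Suc 0)) * h (s *\<^sub>R x)) =
         ennreal (norm x ^ ?D * s ^ (?D - Suc 0)) * h (s *\<^sub>R x)"
        using \<open>0 < s\<close> by (simp add: ennreal_mult'[symmetric] mult.assoc[symmetric] power_mult_distrib)
    qed
    finally show ?thesis .
  qed
  have scale: "(\<integral>\<^sup>+x. ?q s x * indicator (ball 0 1 - {0}) x \<partial>lborel)
    = (\<integral>\<^sup>+y. ?p s y * h y * indicator (ball 0 s - {0}) y \<partial>lborel)"
    if s: "s > 0" for s
  proof -
    have "(\<integral>\<^sup>+y. ?p s y * h y * indicator (ball 0 s - {0}) y \<partial>lborel)
      = ennreal (s ^ ?D) * (\<integral>\<^sup>+x. ?p s (s *\<^sub>R x) * h (s *\<^sub>R x) * indicator (ball 0 s - {0}) (s *\<^sub>R x) \<partial>lborel)"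
      using s by (subst nn_integral_lborel_affine[where c=s and t=0]) auto
    also have "\<dots> = (\<integral>\<^sup>+x. ennreal (s ^ ?D) * (?p s (s *\<^sub>R x) * h (s *\<^sub>R x) * indicator (ball 0 s - {0}) (s *\<^sub>R x)) \<partial>lborel)"
      by (rule nn_integral_cmult[symmetric]) measurable
    also have "\<dots> = (\<integral>\<^sup>+x. ?q s x * indicator (ball 0 1 - {0}) x \<partial>lborel)"
    proof (rule nn_integral_cong)
      fix x :: 'a
      have e: "s ^ ?D = s * s ^ (?D - 1)" "s ^ Suc ?D = s * s ^ ?D"
        by (metis DIM_positive power_eq_if neq0_conv) simp
      have "s ^ ?D * (norm (s *\<^sub>R x) ^ ?D / s ^ Suc ?D) = norm x ^ ?D * s ^ (?D - 1)"
        using s unfolding e(2) by (simp add: power_mult_distrib e(1))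
      then have "ennreal (s ^ ?D) * ?p s (s *\<^sub>R x) = ennreal (norm x ^ ?D * s ^ (?D - 1))"
        using s by (subst ennreal_mult'[symmetric]) auto
      moreover have "indicator (ball 0 s - {0}) (s *\<^sub>R x) = (indicator (ball 0 1 - {0}) x :: ennreal)"
        using s by (auto split: split_indicator simp: )
      ultimately show "ennreal (s ^ ?D) * (?p s (s *\<^sub>R x) * h (s *\<^sub>R x) * indicator (ball 0 s - {0}) (s *\<^sub>R x))
        = ?q s x * indicator (ball 0 1 - {0}) x"
        by (metis mult.assoc)
    qed
    finally show ?thesis by simp
  qed
  have "(\<integral>\<^sup>+\<theta>. ?I \<theta> \<partial>sphere_measure)
    = of_nat ?D * (\<integral>\<^sup>+x. ?I (x /\<^sub>R norm x) * indicator (ball 0 1 - {0}) x \<partial>lborel)"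
    by (rule nn_integral_sphere_measure[OF m])
  also have "\<dots> = of_nat ?D * (\<integral>\<^sup>+x. (\<integral>\<^sup>+s. ?q s x * indicator {0<..} s * indicator (ball 0 1 - {0}) x \<partial>lborel) \<partial>lborel)"
    using inner by (intro arg_cong2[where f="(*)"] refl nn_integral_cong)
      (auto split: split_indicator simp: nn_integral_multc)
  also have "\<dots> = of_nat ?D * (\<integral>\<^sup>+s. (\<integral>\<^sup>+x. ?q s x * indicator {0<..} s * indicator (ball 0 1 - {0}) x \<partial>lborel) \<partial>lborel)"
    by (subst lborel_pair.Fubini') (auto)
  also have "\<dots> = of_nat ?D * (\<integral>\<^sup>+s. (\<integral>\<^sup>+y. ?p s y * h y * indicator (ball 0 s - {0}) y * indicator {0<..} s \<partial>lborel) \<partial>lborel)"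
  proof (rule arg_cong2[where f="(*)"], rule refl, rule nn_integral_cong)
    fix s :: real
    show "(\<integral>\<^sup>+x. ?q s x * indicator {0<..} s * indicator (ball 0 1 - {0}) x \<partial>lborel)
      = (\<integral>\<^sup>+y. ?p s y * h y * indicator (ball 0 s - {0}) y * indicator {0<..} s \<partial>lborel)"
      using scale[of s] by (cases "s > 0") (simp_all del: power_Suc)
  qed
  \<comment> \<open>The two cut-offs merge into \<open>norm y < s\<close>, so that the integral over
    \<open>s\<close> becomes the tail integral above. The origin stays excluded because the tail is
    computed for a positive radius only.\<close>
  also have "\<dots> = of_nat ?D * (\<integral>\<^sup>+s. (\<integral>\<^sup>+y. h y * indicator (- {0}) y * (?p s y * indicator {norm y<..} s) \<partial>lborel) \<partial>lborel)"
  proof (rule arg_cong2[where f="(*)"], rule refl, rule nn_integral_cong, rule nn_integral_cong)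
    fix s :: real and y :: 'a
    have "0 < s" if "norm y < s" using that norm_ge_zero[of y] by linarith
    then show "?p s y * h y * indicator (ball 0 s - {0}) y * indicator {0<..} s
      = h y * indicator (- {0}) y * (?p s y * indicator {norm y<..} s)"
      by (auto split: split_indicator simp: mult_ac simp del: power_Suc)
  qed
  also have "\<dots> = (\<integral>\<^sup>+s. of_nat ?D * (\<integral>\<^sup>+y. h y * indicator (- {0}) y * (?p s y * indicator {norm y<..} s) \<partial>lborel) \<partial>lborel)"
    by (rule nn_integral_cmult[symmetric]) measurable
  also have "\<dots> = (\<integral>\<^sup>+s. (\<integral>\<^sup>+y. of_nat ?D * (h y * indicator (- {0}) y * (?p s y * indicator {norm y<..} s)) \<partial>lborel) \<partial>lborel)"
    by (rule nn_integral_cong, rule nn_integral_cmult[symmetric]) measurable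
  also have "\<dots> = (\<integral>\<^sup>+s. (\<integral>\<^sup>+y. h y * indicator (- {0}) y * (ennreal (?D * norm y ^ ?D / s ^ Suc ?D) * indicator {norm y<..} s) \<partial>lborel) \<partial>lborel)"
  proof (rule nn_integral_cong, rule nn_integral_cong)
    fix s :: real and y :: 'a
    have "of_nat ?D * ?p s y = ennreal (?D * norm y ^ ?D / s ^ Suc ?D)" if "norm y < s"
    proof -
      have "0 < s" using that norm_ge_zero[of y] by linarith
      then show ?thesis
        by (simp add: ennreal_of_nat_eq_real_of_nat ennreal_mult'[symmetric] del: power_Suc)
    qed
    then show "of_nat ?D * (h y * indicator (- {0}) y * (?p s y * indicator {norm y<..} s))
      = h y * indicator (- {0}) y * (ennreal (?D * norm y ^ ?D / s ^ Suc ?D) * indicator {norm y<..} s)"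
      by (cases "norm y < s") (simp_all del: power_Suc, metis mult.left_commute)
  qed
  also have "\<dots> = (\<integral>\<^sup>+y. (\<integral>\<^sup>+s. h y * indicator (- {0}) y * (ennreal (?D * norm y ^ ?D / s ^ Suc ?D) * indicator {norm y<..} s) \<partial>lborel) \<partial>lborel)"
    by (subst lborel_pair.Fubini') (auto)
  also have "\<dots> = (\<integral>\<^sup>+y. h y * indicator (- {0}) y \<partial>lborel)"
    by (rule nn_integral_cong)
       (auto simp: nn_integral_cmult nn_integral_tail_power simp del: power_Suc split: split_indicator)
  also have "\<dots> = (\<integral>\<^sup>+y. h y \<partial>lborel)"
    by (rule nn_integral_cong_AE, rule AE_mp[OF AE_lborel_singleton[of 0]]) (auto split: split_indicator)
  finally show ?thesis by simp
qed

section \<open>Polar coordinates as an identity of measures\<close>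

interpretation sphere_lborel: pair_sigma_finite "sphere_measure :: 'a::euclidean_space measure" "lborel :: real measure" ..

text \<open>In this form the polar formula passes to Bochner integrals by the general rules for
  densities and image measures.\<close>

lemma lborel_polar:
  "(lborel :: 'a::euclidean_space measure) =
     distr (density (sphere_measure \<Otimes>\<^sub>M lborel) (\<lambda>(\<theta>, r). ennreal (r ^ (DIM('a) - 1)) * indicator {0<..} r))
       borel (\<lambda>(\<theta>, r). r *\<^sub>R \<theta>)"
proof (rule measure_eqI)
  let ?w = "\<lambda>(\<theta>::'a, r). ennreal (r ^ (DIM('a) - 1)) * indicator {0<..} r"
  let ?M = "(sphere_measure :: 'a measure) \<Otimes>\<^sub>M (lborel :: real measure)"
  have m1: "(\<lambda>p. fst p) \<in> ?M \<rightarrow>\<^sub>M borel"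
    by (rule measurable_compose[OF measurable_fst measurable_ident_sphere_measure])
  have m: "(\<lambda>(\<theta>, r). r *\<^sub>R \<theta>) \<in> ?M \<rightarrow>\<^sub>M borel"
    using m1 unfolding case_prod_unfold by measurable
  have m2: "?w \<in> borel_measurable ?M"
    unfolding case_prod_unfold by measurable
  fix A :: "'a set" assume "A \<in> sets lborel"
  then have [measurable]: "A \<in> sets borel" by simp
  have mA: "(\<lambda>(\<theta>, r). indicator A (r *\<^sub>R \<theta>) :: ennreal) \<in> borel_measurable ?M"
    using measurable_compose[OF m, of "indicator A" borel] by (simp add: case_prod_unfold)
  have "emeasure lborel A = (\<integral>\<^sup>+x. indicator A x \<partial>lborel)" by simp
  also have "\<dots> = (\<integral>\<^sup>+\<theta>. (\<integral>\<^sup>+r. ennreal (r ^ (DIM('a) - 1)) * indicator A (r *\<^sub>R \<theta>) * indicator {0<..} r \<partial>lborel) \<partial>sphere_measure)"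
    by (rule nn_integral_polar) simp
  also have "\<dots> = (\<integral>\<^sup>+p. ?w p * (\<lambda>(\<theta>, r). indicator A (r *\<^sub>R \<theta>)) p \<partial>?M)"
    using m2 mA by (subst lborel.nn_integral_fst[symmetric]) (auto simp: mult_ac)
  also have "\<dots> = emeasure (distr (density ?M ?w)
       borel (\<lambda>(\<theta>, r). r *\<^sub>R \<theta>)) A"
    using m m2 mA
    by (subst nn_integral_indicator[symmetric], simp, subst nn_integral_distr)
       (auto simp: nn_integral_density case_prod_unfold intro!: nn_integral_cong)
  finally show "emeasure lborel A = emeasure (distr (density ?M ?w)
       borel (\<lambda>(\<theta>, r). r *\<^sub>R \<theta>)) A" .
qed simp

lemma
  fixes h :: "'a::euclidean_space \<Rightarrow> 'b::{banach, second_countable_topology}"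
  assumes h: "integrable lborel h"
  shows integrable_polar: "integrable (sphere_measure \<Otimes>\<^sub>M lborel)
      (\<lambda>(\<theta>, r). indicator {0<..} r *\<^sub>R r ^ (DIM('a) - 1) *\<^sub>R h (r *\<^sub>R \<theta>))" (is ?A)
    and integral_polar: "(LINT x|lborel. h x) =
      (LINT \<theta>|sphere_measure. (LINT r:{0<..}|lborel. r ^ (DIM('a) - 1) *\<^sub>R h (r *\<^sub>R \<theta>)))" (is ?B)
proof -
  let ?M = "(sphere_measure :: 'a measure) \<Otimes>\<^sub>M (lborel :: real measure)"
  let ?w = "\<lambda>(\<theta>::'a, r::real). indicator {0<..} r * r ^ (DIM('a) - 1)"
  have [measurable]: "h \<in> borel_measurable borel" using h by auto
  have m1: "(\<lambda>p. fst p) \<in> ?M \<rightarrow>\<^sub>M borel"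
    by (rule measurable_compose[OF measurable_fst measurable_ident_sphere_measure])
  have m: "(\<lambda>(\<theta>, r). r *\<^sub>R \<theta>) \<in> ?M \<rightarrow>\<^sub>M borel"
    using m1 unfolding case_prod_unfold by measurable
  have mw: "?w \<in> borel_measurable ?M" unfolding case_prod_unfold by measurable
  have mh: "(\<lambda>(\<theta>, r). h (r *\<^sub>R \<theta>)) \<in> borel_measurable ?M"
    using measurable_compose[OF m, of h borel] by (simp add: case_prod_unfold)
  have "(\<lambda>(\<theta>::'a, r::real). ennreal (r ^ (DIM('a) - 1)) * indicator {0<..} r) = (\<lambda>p. ennreal (?w p))"
    by (auto simp: fun_eq_iff split: split_indicator)
  note eq = lborel_polar[where 'a='a, unfolded this]
  have wn: "AE p in ?M. 0 \<le> ?w p" by (auto split: split_indicator)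
  have "integrable (distr (density ?M (\<lambda>p. ennreal (?w p))) borel (\<lambda>(\<theta>, r). r *\<^sub>R \<theta>)) h"
    using h by (subst eq[symmetric])
  then have "integrable (density ?M (\<lambda>p. ennreal (?w p))) (\<lambda>(\<theta>, r). h (r *\<^sub>R \<theta>))"
    using m by (subst (asm) integrable_distr_eq) (auto simp: case_prod_unfold)
  then show A: ?A
    using mw mh wn by (subst (asm) integrable_density) (auto simp: case_prod_unfold)
  have "(LINT x|lborel. h x) = (LINT p|?M. ?w p *\<^sub>R (\<lambda>(\<theta>, r). h (r *\<^sub>R \<theta>)) p)"
    using m mw mh wn by (subst eq, subst integral_distr) (auto simp: integral_density case_prod_unfold)
  also have "\<dots> = (LINT p|?M. (\<lambda>(\<theta>, r). indicator {0<..} r *\<^sub>R r ^ (DIM('a) - 1) *\<^sub>R h (r *\<^sub>R \<theta>)) p)"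
    by (simp add: case_prod_unfold)
  also have "\<dots> = (LINT \<theta>|sphere_measure. (LINT r:{0<..}|lborel. r ^ (DIM('a) - 1) *\<^sub>R h (r *\<^sub>R \<theta>)))"
    using sphere_lborel.integral_fst'[OF A[unfolded case_prod_unfold]]
    by (simp add: set_lebesgue_integral_def case_prod_unfold)
  finally show ?B .
qed

text \<open>In polar coordinates the radial integrand is \<open>r powr q / (1 + r) ^ N\<close> with
  \<open>q = p + DIM('a) - 1 > -1\<close>. It is at most \<open>r powr q\<close> near 0 and at most
  \<open>r powr - 2\<close> from 1 on, since \<open>N \<ge> q + 2\<close>. With
  \<open>p = - k\<close> this is where \<open>k < n - 1\<close> enters.\<close>

lemma integrable_powr_decay:
  fixes p :: real
  assumes "p > - real DIM('a)" and "real N \<ge> p + DIM('a) + 1"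
  shows "integrable lborel (\<lambda>x::'a::euclidean_space. norm x powr p / (1 + norm x) ^ N)"
proof -
  let ?D = "DIM('a)"
  define q where "q = p + real ?D - 1"
  define C where "C = (\<integral>\<^sup>+r. ennreal (r ^ (?D - 1)) * ennreal (r powr p / (1 + r) ^ N) * indicator {0<..} r \<partial>lborel)"
  have i1: "set_integrable lborel {0..1} (\<lambda>r. r powr q)"
  proof -
    have "(\<lambda>r. r powr q) absolutely_integrable_on {0..1}"
      using assms(1) by (intro nonnegative_absolutely_integrable_1 integrable_on_powr_from_0) (auto simp: q_def)
    then show ?thesis by (simp add: set_integrable_def integrable_completion)
  qed
  have i2: "set_integrable lborel {1..} (\<lambda>r::real. r powr - 2)"
  proof -
    have "(\<lambda>r::real. r powr - 2) integrable_on {1..}"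
      using has_integral_powr_to_inf[of "-2" 1] by (auto simp: integrable_on_def)
    then have "(\<lambda>r::real. r powr - 2) absolutely_integrable_on {1..}"
      by (intro nonnegative_absolutely_integrable_1) auto
    then show ?thesis by (simp add: set_integrable_def integrable_completion)
  qed
  have "C \<le> (\<integral>\<^sup>+r. ennreal (norm (indicator {0..1} r *\<^sub>R r powr q)) + ennreal (norm (indicator {1..} r *\<^sub>R r powr - 2)) \<partial>lborel)"
    unfolding C_def
  proof (rule nn_integral_mono)
    fix r :: real
    show "ennreal (r ^ (?D - 1)) * ennreal (r powr p / (1 + r) ^ N) * indicator {0<..} r
      \<le> ennreal (norm (indicator {0..1} r *\<^sub>R r powr q)) + ennreal (norm (indicator {1..} r *\<^sub>R r powr - 2))"
    proof (cases "0 < r")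
      case r: True
      have e: "r ^ (?D - 1) * (r powr p / (1 + r) ^ N) = r powr q / (1 + r) ^ N"
        using r by (simp add: q_def powr_realpow[symmetric] powr_add[symmetric] of_nat_diff algebra_simps)
      have 1: "r powr q / (1 + r) ^ N \<le> r powr q"
        using r one_le_power[of "1 + r" N] by (simp add: divide_le_eq mult_le_cancel_left1)
      have 2: "r powr q / (1 + r) ^ N \<le> r powr -2" if "1 \<le> r"
      proof -
        have "r powr q / (1 + r) ^ N \<le> r powr q / r ^ N"
          using r by (intro divide_left_mono power_mono) auto
        also have "\<dots> = r powr (q - N)" using r by (simp add: powr_diff powr_realpow)
        also have "\<dots> \<le> r powr -2"
          using that assms(2) by (intro powr_mono) (auto simp: q_def)
        finally show ?thesis .
      qed
      have "r powr q / (1 + r) ^ N \<le> norm (indicator {0..1} r *\<^sub>R r powr q) + norm (indicator {1..} r *\<^sub>R r powr - 2)"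
      proof (cases "r \<le> 1")
        case True
        then show ?thesis using 1 r by (intro add_increasing2) auto
      next
        case False
        then show ?thesis using 2 r by (intro add_increasing) auto
      qed
      then show ?thesis
        using r e by (simp add: ennreal_mult'[symmetric] ennreal_plus[symmetric] del: ennreal_plus)
    qed simp
  qed
  also have "\<dots> < \<infinity>"
    using i1 i2 unfolding set_integrable_def
    by (subst nn_integral_add) (auto simp: integrable_iff_bounded)
  finally have C: "C < \<infinity>" .
  have "(\<integral>\<^sup>+x. ennreal (norm (norm (x::'a) powr p / (1 + norm x) ^ N)) \<partial>lborel)
     = (\<integral>\<^sup>+\<theta>. C \<partial>(sphere_measure :: 'a measure))"
    unfolding C_def
    by (subst nn_integral_polar, simp, rule nn_integral_cong, rule nn_integral_cong)
       (auto split: split_indicator)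
  also have "\<dots> < \<infinity>"
    using C sphere_measure.emeasure_finite[of "space (sphere_measure :: 'a measure)"]
    by (auto simp: ennreal_mult_eq_top_iff less_top[symmetric])
  finally show ?thesis by (intro integrableI_bounded) auto
qed

lemma integrable_decay:
  assumes "N > DIM('a)"
  shows "integrable lborel (\<lambda>x::'a::euclidean_space. 1 / (1 + norm x) ^ N)"
proof -
  have "integrable lborel (\<lambda>x::'a. norm x powr 0 / (1 + norm x) ^ N)"
    using assms by (intro integrable_powr_decay) auto
  \<comment> \<open>Since \<open>0 powr 0\<close> is 0, the two integrands differ at the
    origin.\<close>
  then show ?thesis
    by (rule integrable_cong_AE_imp)
       (auto intro: AE_mp[OF AE_lborel_singleton[of 0]])
qed

section \<open>Gaussians\<close>

abbreviation wave :: "'a::real_inner \<Rightarrow> 'a \<Rightarrow> complex" where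
  "wave x \<xi> \<equiv> exp (- (\<i> * complex_of_real (x \<bullet> \<xi>)))"

text \<open>Lebesgue measure is the image of the product measure over \<open>Basis\<close>, so
  functions that factor over the coordinates integrate factor by factor.\<close>

lemma
  fixes g :: "'a::euclidean_space \<Rightarrow> real \<Rightarrow> complex"
  assumes g: "\<And>b. b \<in> Basis \<Longrightarrow> integrable lborel (g b)"
  shows integrable_prod_Basis: "integrable lborel (\<lambda>x::'a. \<Prod>b\<in>Basis. g b (x \<bullet> b))" (is ?A)
    and integral_prod_Basis: "(LINT x|lborel. (\<Prod>b\<in>Basis. g b ((x::'a) \<bullet> b))) = (\<Prod>b\<in>Basis. LINT t|lborel. g b t)" (is ?B)
proof -
  interpret product_sigma_finite "\<lambda>_::'a. lborel :: real measure" ..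
  have [measurable]: "b \<in> Basis \<Longrightarrow> g b \<in> borel_measurable borel" for b using g[of b] by auto
  have e: "(\<Prod>b\<in>Basis. g b ((\<Sum>b\<in>Basis. f b *\<^sub>R b) \<bullet> b)) = (\<Prod>b\<in>Basis. g b (f b))" for f :: "'a \<Rightarrow> real"
    by (intro prod.cong refl) (simp add: inner_sum_left inner_Basis if_distrib cong: if_cong)
  have m: "(\<lambda>f. \<Sum>b\<in>(Basis::'a set). f b *\<^sub>R b) \<in> (\<Pi>\<^sub>M b\<in>Basis. lborel) \<rightarrow>\<^sub>M (borel :: 'a measure)"
    by measurable
  show ?A
    using product_integrable_prod[of Basis g] g
    by (subst lborel_eq, subst integrable_distr_eq[OF m]) (auto simp: e)
  show ?B
    using product_integral_prod[of Basis g] g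
    by (subst lborel_eq, subst integral_distr[OF m]) (auto simp: e)
qed

definition gaussian :: "'a::euclidean_space \<Rightarrow> real" where
  "gaussian x = exp (- (norm x)\<^sup>2 / 2)"

lemma gaussian_prod: "gaussian (x::'a::euclidean_space) = (\<Prod>b\<in>Basis. gaussian (x \<bullet> b))"
proof -
  have "(norm x)\<^sup>2 = (\<Sum>b\<in>Basis. (x \<bullet> b)\<^sup>2)"
    unfolding power2_norm_eq_inner by (subst euclidean_inner) (simp add: power2_eq_square)
  then show ?thesis
    by (simp add: gaussian_def exp_sum[symmetric] sum_negf sum_divide_distrib)
qed

lemma continuous_gaussian [continuous_intros]: "continuous_on A gaussian"
  unfolding gaussian_def by (intro continuous_intros) auto

lemma borel_measurable_gaussian [measurable]: "gaussian \<in> borel_measurable borel"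
  by (intro borel_measurable_continuous_onI continuous_intros)

lemma gaussian_pos: "gaussian x > 0" and gaussian_le_1: "gaussian x \<le> 1"
  by (auto simp: gaussian_def)

lemma gaussian_minus [simp]: "gaussian (- x) = gaussian x"
  by (simp add: gaussian_def)

lemma gaussian_std_normal: "gaussian t = sqrt (2 * pi) * std_normal_density t"
  by (simp add: gaussian_def std_normal_density_def)

lemma gaussian_fourier_real:
  shows "integrable lborel (\<lambda>t::real. exp (- (\<i> * complex_of_real (t * s))) * gaussian t)" (is ?A)
    and "(LINT t|lborel. exp (- (\<i> * complex_of_real (t * s))) * gaussian t) = sqrt (2 * pi) * gaussian s" (is ?B)
proof -
  have i: "integrable lborel (gaussian :: real \<Rightarrow> real)"
    unfolding gaussian_std_normal[abs_def] by (intro integrable_mult_right integrable_normal_density) auto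
  have m: "(\<lambda>t. exp (- (\<i> * complex_of_real (t * s))) * complex_of_real (gaussian t)) \<in> borel_measurable borel"
    by measurable
  show ?A
    by (rule Bochner_Integration.integrable_bound[OF i])
       (use m in \<open>auto simp: norm_mult gaussian_pos less_imp_le\<close>)
  \<comment> \<open>The integral is a characteristic function of the standard normal distribution;
    the argument \<open>- s\<close> accounts for the sign convention of the Fourier kernel.\<close>
  have "char std_normal_distribution (- s) = (LINT t|lborel. std_normal_density t *\<^sub>R iexp (- s * t))"
    unfolding char_def by (subst integral_density) auto
  then have "(LINT t|lborel. std_normal_density t *\<^sub>R iexp (- s * t)) = gaussian s"
    by (simp add: char_std_normal_distribution gaussian_def)
  then have "complex_of_real (sqrt (2 * pi)) * (LINT t|lborel. std_normal_density t *\<^sub>R iexp (- s * t)) = sqrt (2 * pi) * gaussian s"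
    by simp
  then show ?B
    unfolding integral_mult_right_zero[symmetric]
    by (simp add: gaussian_std_normal scaleR_conv_of_real mult_ac)
qed

lemma
  fixes \<xi> :: "'a::euclidean_space"
  shows integrable_gaussian_fourier: "integrable lborel (\<lambda>x. wave x \<xi> * gaussian x)" (is ?A)
    and fourier_L1_gaussian: "fourier_L1 (\<lambda>x. complex_of_real (gaussian x)) \<xi> = sqrt (2 * pi) ^ DIM('a) * gaussian \<xi>" (is ?B)
proof -
  have e: "wave x \<xi> * gaussian x
     = (\<Prod>b\<in>Basis. exp (- (\<i> * complex_of_real ((x \<bullet> b) * (\<xi> \<bullet> b)))) * gaussian (x \<bullet> b))" for x :: 'a
    by (subst euclidean_inner, subst gaussian_prod)
       (simp add: prod.distrib exp_sum[symmetric] sum_distrib_left sum_negf)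
  show ?A unfolding e
    by (rule integrable_prod_Basis) (rule gaussian_fourier_real)
  show ?B unfolding fourier_L1_def e
    by (subst integral_prod_Basis)
       (simp_all add: gaussian_fourier_real gaussian_prod[of \<xi>] prod.distrib
         of_real_prod[symmetric] of_real_power[symmetric] of_real_mult[symmetric]
         del: of_real_mult of_real_prod of_real_power)
qed

lemma integrable_gaussian: "integrable lborel (gaussian :: 'a::euclidean_space \<Rightarrow> real)"
  using integrable_norm[OF integrable_gaussian_fourier[of "0::'a"]] by (simp add: gaussian_pos less_imp_le)

lemma integral_gaussian:
  "(LINT x|lborel. gaussian (x::'a::euclidean_space)) = sqrt (2 * pi) ^ DIM('a)"
proof -
  have "complex_of_real (LINT x|lborel. gaussian (x::'a)) = complex_of_real (sqrt (2 * pi) ^ DIM('a))"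
    using fourier_L1_gaussian[of "0::'a"] by (simp add: fourier_L1_def gaussian_def)
  then show ?thesis by (simp only: of_real_eq_iff)
qed

text \<open>Only the factor belonging to \<open>e\<close> carries the power; every other coordinate
  contributes \<open>sqrt (2 * pi)\<close>. This is one of the two evaluations that determine the
  moments of the sphere.\<close>

lemma
  fixes e :: "'a::euclidean_space"
  assumes e: "e \<in> Basis"
  shows integrable_gaussian_moment: "integrable lborel (\<lambda>x. (x \<bullet> e) ^ m * gaussian x)" (is ?A)
    and integral_gaussian_moment: "(LINT x|lborel. (x \<bullet> e) ^ m * gaussian x)
      = sqrt (2 * pi) ^ DIM('a) * (LINT t|lborel. std_normal_density t * t ^ m)" (is ?B)
proof -
  let ?g = "\<lambda>b t. complex_of_real ((if b = e then t ^ m else 1) * gaussian t)"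
  have i: "integrable lborel (?g b)" for b
  proof -
    have "integrable lborel (\<lambda>t::real. sqrt (2 * pi) * (std_normal_density t * t ^ n))" for n
      by (intro integrable_mult_right integrable_std_normal_moment)
    from this[of m] this[of 0] have "integrable lborel (\<lambda>t. (if b = e then t ^ m else 1) * gaussian t)"
      by (cases "b = e") (simp_all add: gaussian_std_normal mult_ac)
    then show ?thesis by (rule integrable_of_real)
  qed
  have eq: "complex_of_real ((x \<bullet> e) ^ m * gaussian x) = (\<Prod>b\<in>Basis. ?g b (x \<bullet> b))" for x :: 'a
  proof -
    have "(\<Prod>b\<in>Basis. (if b = e then (x \<bullet> b) ^ m else 1) * gaussian (x \<bullet> b)) = (x \<bullet> e) ^ m * gaussian x"
      using e by (simp add: prod.distrib gaussian_prod[of x])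
    then show ?thesis unfolding of_real_prod[symmetric] by simp
  qed
  have I: "(LINT t|lborel. ?g b t) = complex_of_real (sqrt (2 * pi) * (if b = e then LINT t|lborel. std_normal_density t * t ^ m else 1))" for b
  proof -
    have "(LINT t|lborel. gaussian (t::real)) = sqrt (2 * pi)"
      using integral_gaussian[where 'a=real] by simp
    moreover have "(LINT t|lborel. t ^ m * gaussian t) = sqrt (2 * pi) * (LINT t|lborel. std_normal_density t * t ^ m)"
      unfolding gaussian_std_normal integral_mult_right_zero[symmetric] by (simp add: mult_ac)
    ultimately show ?thesis by (cases "b = e") (simp_all del: of_real_mult)
  qed
  have "integrable lborel (\<lambda>x. complex_of_real ((x \<bullet> e) ^ m * gaussian x))"
    unfolding eq by (rule integrable_prod_Basis[OF i])
  then show ?A by (simp only: complex_of_real_integrable_eq)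
  have "complex_of_real (LINT x|lborel. (x \<bullet> e) ^ m * gaussian x) = (LINT x|lborel. complex_of_real ((x \<bullet> e) ^ m * gaussian x))"
    by (rule integral_complex_of_real[symmetric])
  also have "\<dots> = (\<Prod>b\<in>Basis. LINT t|lborel. ?g b t)"
    unfolding eq by (rule integral_prod_Basis[OF i])
  also have "\<dots> = complex_of_real (\<Prod>b\<in>(Basis::'a set). sqrt (2 * pi) * (if b = e then LINT t|lborel. std_normal_density t * t ^ m else 1))"
    unfolding I of_real_prod ..
  also have "\<dots> = complex_of_real (sqrt (2 * pi) ^ DIM('a) * (LINT t|lborel. std_normal_density t * t ^ m))"
    using e by (simp add: prod.distrib)
  finally have "complex_of_real (LINT x|lborel. (x \<bullet> e) ^ m * gaussian x) =
     complex_of_real (sqrt (2 * pi) ^ DIM('a) * (LINT t|lborel. std_normal_density t * t ^ m))" .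
  then show ?B by (simp only: of_real_eq_iff)
qed

section \<open>Fourier inversion\<close>

lemma norm_exp_neg_i [simp]: "norm (exp (- (\<i> * complex_of_real r))) = 1"
  by (simp add: norm_exp_eq_Re)

lemma integrable_fourier_kernel:
  fixes g :: "'a::euclidean_space \<Rightarrow> complex"
  assumes "integrable lborel g"
  shows "integrable lborel (\<lambda>x. wave x \<xi> * g x)"
proof (rule Bochner_Integration.integrable_bound[OF assms])
  have [measurable]: "g \<in> borel_measurable borel" using assms by auto
  show "(\<lambda>x. wave x \<xi> * g x) \<in> borel_measurable lborel" by measurable
qed (simp add: norm_mult)

lemma norm_fourier_L1_le: "norm (fourier_L1 g \<xi>) \<le> (LINT x|lborel. norm (g x))"
  unfolding fourier_L1_def
  by (rule order_trans[OF integral_norm_bound]) (simp add: norm_mult)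

lemma continuous_on_fourier_L1:
  fixes g :: "'a::euclidean_space \<Rightarrow> complex"
  assumes g: "integrable lborel g"
  shows "continuous_on A (fourier_L1 g)"
proof -
  have [measurable]: "g \<in> borel_measurable borel" using g by auto
  have "isCont (fourier_L1 g) \<xi>" for \<xi>
    unfolding continuous_at_sequentially o_def
  proof (intro allI impI)
    fix u :: "nat \<Rightarrow> 'a" assume u: "u \<longlonglongrightarrow> \<xi>"
    show "(\<lambda>n. fourier_L1 g (u n)) \<longlonglongrightarrow> fourier_L1 g \<xi>"
      unfolding fourier_L1_def
      by (rule integral_dominated_convergence[where w="\<lambda>x. norm (g x)"])
         (use g u in \<open>auto simp: norm_mult intro!: tendsto_intros\<close>)
  qed
  then show ?thesis by (simp add: continuous_at_imp_continuous_on)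
qed

lemma borel_measurable_fourier_L1 [measurable]:
  fixes g :: "'a::euclidean_space \<Rightarrow> complex"
  assumes [measurable]: "g \<in> borel_measurable borel"
  shows "fourier_L1 g \<in> borel_measurable borel"
  unfolding fourier_L1_def[abs_def] by measurable

lemma integrable_tensor:
  fixes g :: "'a::euclidean_space \<Rightarrow> complex" and h :: "'b::euclidean_space \<Rightarrow> complex"
  assumes g: "integrable lborel g" and h: "integrable lborel h"
  shows "integrable (lborel \<Otimes>\<^sub>M lborel) (\<lambda>(x, y). g x * h y)"
proof -
  have [measurable]: "g \<in> borel_measurable borel" "h \<in> borel_measurable borel" using g h by auto
  show ?thesis
    by (rule lborel_pair.Fubini_integrable)
       (use g h in \<open>auto simp: norm_mult case_prod_unfold\<close>)
qed

text \<open>The adjoint relation on which \<open>tempered_fourier\<close> is modelled. It is applied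
  with damped waves in the inversion theorem and with Schwartz functions to identify distributional
  transforms.\<close>

lemma fourier_L1_multiplication_formula:
  fixes g h :: "'a::euclidean_space \<Rightarrow> complex"
  assumes g: "integrable lborel g" and h: "integrable lborel h"
  shows "(LINT x|lborel. fourier_L1 g x * h x) = (LINT x|lborel. g x * fourier_L1 h x)"
proof -
  have [measurable]: "g \<in> borel_measurable borel" "h \<in> borel_measurable borel" using g h by auto
  have i: "integrable (lborel \<Otimes>\<^sub>M lborel) (\<lambda>(x, y). wave x y * (g x * h y))"
    by (rule Bochner_Integration.integrable_bound[OF integrable_tensor[OF g h]])
       (auto simp: case_prod_unfold norm_mult)
  have l: "fourier_L1 g y * h y = (LINT x|lborel. wave x y * (g x * h y))" for y
    unfolding fourier_L1_def integral_mult_left_zero[symmetric] by (simp add: mult.assoc)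
  have r: "g x * fourier_L1 h x = (LINT y|lborel. wave x y * (g x * h y))" for x
    unfolding fourier_L1_def integral_mult_right_zero[symmetric]
    by (simp add: mult.left_commute inner_commute)
  have "(LINT x|lborel. fourier_L1 g x * h x)
     = (LINT y|lborel. LINT x|lborel. wave x y * (g x * h y))"
    by (simp only: l)
  also have "\<dots> = (LINT x|lborel. LINT y|lborel. wave x y * (g x * h y))"
    by (rule lborel_pair.Fubini_integral[OF i])
  also have "\<dots> = (LINT x|lborel. g x * fourier_L1 h x)"
    by (simp only: r)
  finally show ?thesis .
qed

text \<open>A damped wave has as its transform a Gaussian of width \<open>t\<close> centred at
  \<open>x\<close>. As \<open>t\<close> tends to 0 the damping disappears, while the transform
  concentrates at \<open>x\<close>.\<close>

lemma fourier_L1_modulated_gaussian: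
  fixes x y :: "'a::euclidean_space"
  assumes t: "t > 0"
  shows "fourier_L1 (\<lambda>\<xi>. wave \<xi> (- x) * gaussian (t *\<^sub>R \<xi>)) y
     = sqrt (2 * pi) ^ DIM('a) / t ^ DIM('a) * gaussian ((y - x) /\<^sub>R t)"
proof -
  have "complex_of_real (sqrt (2 * pi) ^ DIM('a) * gaussian ((y - x) /\<^sub>R t)) =
      (LINT \<xi>|lborel. wave \<xi> ((y - x) /\<^sub>R t) * gaussian \<xi>)"
    using fourier_L1_gaussian[of "(y - x) /\<^sub>R t"] by (simp add: fourier_L1_def)
  also have "\<dots> = t ^ DIM('a) *\<^sub>R (LINT \<xi>|lborel. wave (0 + t *\<^sub>R \<xi>) ((y - x) /\<^sub>R t) * gaussian (0 + t *\<^sub>R \<xi>))"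
    using t by (subst integral_lborel_affine[where c=t and t=0]) auto
  also have "(LINT \<xi>|lborel. wave (0 + t *\<^sub>R \<xi>) ((y - x) /\<^sub>R t) * gaussian (0 + t *\<^sub>R \<xi>))
    = fourier_L1 (\<lambda>\<xi>. wave \<xi> (- x) * gaussian (t *\<^sub>R \<xi>)) y"
    unfolding fourier_L1_def mult.assoc[symmetric] exp_add[symmetric]
  proof (intro Bochner_Integration.integral_cong refl)
    fix \<xi> :: 'a
    have "(0 + t *\<^sub>R \<xi>) \<bullet> ((y - x) /\<^sub>R t) = \<xi> \<bullet> y - \<xi> \<bullet> x"
      using t by (simp add: inner_diff_right right_diff_distrib[symmetric])
    moreover have "- (\<i> * complex_of_real (\<xi> \<bullet> y - \<xi> \<bullet> x)) = - (\<i> * complex_of_real (\<xi> \<bullet> y)) + - (\<i> * complex_of_real (\<xi> \<bullet> - x))"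
      by (simp add: right_diff_distrib)
    ultimately show "wave (0 + t *\<^sub>R \<xi>) ((y - x) /\<^sub>R t) * complex_of_real (gaussian (0 + t *\<^sub>R \<xi>))
      = exp (- (\<i> * complex_of_real (\<xi> \<bullet> y)) + - (\<i> * complex_of_real (\<xi> \<bullet> - x))) * complex_of_real (gaussian (t *\<^sub>R \<xi>))"
      by (simp only: add_0_left)
  qed
  finally show ?thesis using t by (simp add: scaleR_conv_of_real field_simps)
qed

text \<open>Gauss summation: the inversion integral is damped by
  \<open>gaussian (t n *\<^sub>R \<xi>)\<close> and moved to \<open>\<phi>\<close> by the
  multiplication formula. Both sides converge by dominated convergence, with majorants
  \<open>norm (fourier_L1 \<phi> \<xi>)\<close> and \<open>gaussian w * B\<close>. One factor
  \<open>sqrt (2 * pi) ^ DIM('a)\<close> comes from the transform of the Gaussian, the other from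
  its total mass.\<close>

theorem fourier_L1_inversion:
  fixes \<phi> :: "'a::euclidean_space \<Rightarrow> complex"
  assumes \<phi>: "integrable lborel \<phi>" and cont: "continuous_on UNIV \<phi>" and bdd: "\<And>x. norm (\<phi> x) \<le> B"
    and F: "integrable lborel (fourier_L1 \<phi>)"
  shows "fourier_L1 (fourier_L1 \<phi>) (- x) = complex_of_real ((2 * pi) ^ DIM('a)) * \<phi> x"
proof -
  define t :: "nat \<Rightarrow> real" where "t n = inverse (Suc n)" for n
  have t: "t n > 0" for n by (simp add: t_def)
  have t0: "t \<longlonglongrightarrow> 0" unfolding t_def by (rule LIMSEQ_inverse_real_of_nat)
  have [measurable]: "\<phi> \<in> borel_measurable borel" using \<phi> by auto
  let ?\<psi> = "\<lambda>n \<xi>. wave \<xi> (- x) * gaussian (t n *\<^sub>R \<xi>)"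
  have i\<psi>: "integrable lborel (?\<psi> n)" for n
  proof -
    have "integrable lborel (\<lambda>\<xi>::'a. complex_of_real (gaussian (0 + t n *\<^sub>R \<xi>)))"
      using integrable_gaussian t[of n] by (subst integrable_lborel_affine_iff) auto
    from integrable_fourier_kernel[OF this, of "- x"] show ?thesis by simp
  qed
  have eq: "(LINT \<xi>|lborel. ?\<psi> n \<xi> * fourier_L1 \<phi> \<xi>) = sqrt (2 * pi) ^ DIM('a) * (LINT w|lborel. gaussian w * \<phi> (x + t n *\<^sub>R w))" for n
  proof -
    have "(LINT \<xi>|lborel. ?\<psi> n \<xi> * fourier_L1 \<phi> \<xi>) = (LINT y|lborel. fourier_L1 (?\<psi> n) y * \<phi> y)"
      by (rule fourier_L1_multiplication_formula[OF i\<psi> \<phi>, symmetric])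
    also have "\<dots> = (LINT y|lborel. sqrt (2 * pi) ^ DIM('a) / t n ^ DIM('a) * gaussian ((y - x) /\<^sub>R t n) * \<phi> y)"
      by (simp only: fourier_L1_modulated_gaussian[OF t])
    also have "\<dots> = t n ^ DIM('a) *\<^sub>R (LINT w|lborel. sqrt (2 * pi) ^ DIM('a) / t n ^ DIM('a) * gaussian ((x + t n *\<^sub>R w - x) /\<^sub>R t n) * \<phi> (x + t n *\<^sub>R w))"
      using t[of n] by (subst integral_lborel_affine[where c="t n" and t=x]) auto
    also have "\<dots> = sqrt (2 * pi) ^ DIM('a) * (LINT w|lborel. gaussian w * \<phi> (x + t n *\<^sub>R w))"
      using t[of n] by (simp add: scaleR_conv_of_real mult.assoc)
    finally show ?thesis .
  qed
  have l1: "(\<lambda>n. LINT \<xi>|lborel. ?\<psi> n \<xi> * fourier_L1 \<phi> \<xi>) \<longlonglongrightarrow> fourier_L1 (fourier_L1 \<phi>) (- x)"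
    unfolding fourier_L1_def[of "fourier_L1 \<phi>"]
  proof (rule integral_dominated_convergence[where w="\<lambda>\<xi>. norm (fourier_L1 \<phi> \<xi>)"])
    show "AE \<xi> in lborel. (\<lambda>n. ?\<psi> n \<xi> * fourier_L1 \<phi> \<xi>) \<longlonglongrightarrow> wave \<xi> (- x) * fourier_L1 \<phi> \<xi>"
    proof (rule AE_I2)
      fix \<xi> :: 'a
      have "(\<lambda>n. gaussian (t n *\<^sub>R \<xi>)) \<longlonglongrightarrow> gaussian (0 *\<^sub>R \<xi>)"
        using continuous_gaussian[of UNIV] t0
        by (intro isCont_tendsto_compose[where g=gaussian] tendsto_intros) (auto simp: continuous_on_eq_continuous_at)
      then have "(\<lambda>n. ?\<psi> n \<xi> * fourier_L1 \<phi> \<xi>) \<longlonglongrightarrow> wave \<xi> (- x) * complex_of_real (gaussian (0 *\<^sub>R \<xi>)) * fourier_L1 \<phi> \<xi>"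
        by (intro tendsto_intros)
      then show "(\<lambda>n. ?\<psi> n \<xi> * fourier_L1 \<phi> \<xi>) \<longlonglongrightarrow> wave \<xi> (- x) * fourier_L1 \<phi> \<xi>"
        by (simp add: gaussian_def)
    qed
  qed (use F in \<open>auto simp: norm_mult gaussian_pos less_imp_le gaussian_le_1 mult_left_le_one_le\<close>)
  have l2: "(\<lambda>n. LINT w|lborel. gaussian w * \<phi> (x + t n *\<^sub>R w)) \<longlonglongrightarrow> (LINT w|lborel. gaussian (w::'a) * \<phi> x)"
  proof (rule integral_dominated_convergence[where w="\<lambda>w. gaussian w * B"])
    show "AE w in lborel. (\<lambda>n. complex_of_real (gaussian w) * \<phi> (x + t n *\<^sub>R w)) \<longlonglongrightarrow> gaussian (w::'a) * \<phi> x"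
    proof (rule AE_I2)
      fix w :: 'a
      have "(\<lambda>n. x + t n *\<^sub>R w) \<longlonglongrightarrow> x + 0 *\<^sub>R w" by (intro tendsto_intros t0)
      then have "(\<lambda>n. \<phi> (x + t n *\<^sub>R w)) \<longlonglongrightarrow> \<phi> x"
        using cont by (intro isCont_tendsto_compose[where g=\<phi>]) (auto simp: continuous_on_eq_continuous_at)
      then show "(\<lambda>n. complex_of_real (gaussian w) * \<phi> (x + t n *\<^sub>R w)) \<longlonglongrightarrow> gaussian (w::'a) * \<phi> x"
        by (intro tendsto_intros)
    qed
  qed (use bdd integrable_gaussian in \<open>auto simp: norm_mult gaussian_pos less_imp_le intro!: mult_left_mono\<close>)
  have I: "(LINT w|lborel. gaussian (w::'a) * \<phi> x) = sqrt (2 * pi) ^ DIM('a) * \<phi> x"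
    by (simp add: integral_gaussian)
  have l3: "(\<lambda>n. LINT \<xi>|lborel. ?\<psi> n \<xi> * fourier_L1 \<phi> \<xi>) \<longlonglongrightarrow> sqrt (2 * pi) ^ DIM('a) * (sqrt (2 * pi) ^ DIM('a) * \<phi> x)"
    unfolding eq by (rule tendsto_mult[OF tendsto_const]) (rule l2[unfolded I])
  have "complex_of_real (sqrt (2 * pi) ^ DIM('a)) * (complex_of_real (sqrt (2 * pi) ^ DIM('a)) * \<phi> x)
      = complex_of_real ((2 * pi) ^ DIM('a)) * \<phi> x"
    by (subst mult.assoc[symmetric], subst of_real_mult[symmetric], subst power_mult_distrib[symmetric]) simp
  with LIMSEQ_unique[OF l1 l3] show ?thesis by (rule trans)
qed

section \<open>Schwartz functions\<close>

lemma iter_partial_append: "iter_partial (ds @ es) f = iter_partial ds (iter_partial es f)"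
  by (induction ds) auto

lemma schwartz_iter_partial:
  assumes "schwartz f" "set ds \<subseteq> Basis"
  shows "schwartz (iter_partial ds f)"
  unfolding schwartz_def
proof (intro allI impI)
  fix es :: "'a list" assume "set es \<subseteq> Basis"
  then have "set (es @ ds) \<subseteq> Basis" using assms by auto
  from assms(1)[unfolded schwartz_def, rule_format, OF this]
  show "(\<forall>x. iter_partial es (iter_partial ds f) differentiable at x) \<and>
      (\<forall>N::nat. bounded (range (\<lambda>x. norm x ^ N *\<^sub>R iter_partial es (iter_partial ds f) x)))"
    unfolding iter_partial_append .
qed

lemma schwartz_differentiable: "schwartz f \<Longrightarrow> f differentiable (at x)"
  unfolding schwartz_def by (metis empty_set empty_subsetI iter_partial.simps(1))

lemma schwartz_continuous: "schwartz f \<Longrightarrow> continuous_on A f"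
  by (meson schwartz_differentiable continuous_at_imp_continuous_on differentiable_imp_continuous_within)

lemma borel_measurable_schwartz: "schwartz f \<Longrightarrow> f \<in> borel_measurable borel"
  by (intro borel_measurable_continuous_onI schwartz_continuous)

lemma power_one_plus_le: "(1 + r) ^ N \<le> 2 ^ N * (1 + r ^ N)" if "0 \<le> r" for r :: real
proof -
  have "(1 + r) ^ N \<le> (2 * max 1 r) ^ N" using that by (intro power_mono) auto
  also have "\<dots> = 2 ^ N * max 1 r ^ N" by (simp add: power_mult_distrib)
  also have "max 1 r ^ N \<le> 1 + r ^ N" using that by (auto simp: max_def)
  finally show ?thesis by simp
qed

text \<open>Combines the seminorms for the powers 0 and \<open>N\<close>; the added 1 keeps the
  constant positive even for the zero function.\<close>

lemma schwartz_bound: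
  assumes "schwartz f"
  shows "\<exists>C>0. \<forall>x. norm (f x) \<le> C / (1 + norm x) ^ N"
proof -
  have b: "bounded (range (\<lambda>x. norm x ^ M *\<^sub>R f x))" for M
    using assms unfolding schwartz_def by (metis empty_set empty_subsetI iter_partial.simps(1))
  obtain A where A: "\<And>x. norm (f x) \<le> A" using b[of 0] by (auto simp: bounded_iff)
  obtain B where B: "\<And>x. norm (norm x ^ N *\<^sub>R f x) \<le> B" using b[of N] by (auto simp: bounded_iff)
  have "norm (f x) \<le> (2 ^ N * (A + B) + 1) / (1 + norm x) ^ N" for x
  proof -
    have "norm (f x) * (1 + norm x) ^ N \<le> norm (f x) * (2 ^ N * (1 + norm x ^ N))"
      by (intro mult_left_mono power_one_plus_le) auto
    also have "\<dots> = 2 ^ N * (norm (f x) + norm (norm x ^ N *\<^sub>R f x))"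
      by (simp add: algebra_simps)
    also have "\<dots> \<le> 2 ^ N * (A + B)" using A[of x] B[of x] by (intro mult_left_mono add_mono) auto
    finally show ?thesis
      using norm_ge_zero[of x] by (subst pos_le_divide_eq) (auto intro!: zero_less_power add_pos_nonneg)
  qed
  moreover have "A \<ge> 0" "B \<ge> 0" using A B norm_ge_zero order_trans by blast+
  ultimately show ?thesis by (intro exI[of _ "2 ^ N * (A + B) + 1"]) (auto intro!: add_nonneg_pos)
qed

lemma integrable_bounded_by_decay:
  fixes g :: "'a::euclidean_space \<Rightarrow> 'b::{banach, second_countable_topology}"
  assumes "g \<in> borel_measurable borel" "\<And>x. norm (g x) \<le> C / (1 + norm x) ^ N" "N > DIM('a)"
  shows "integrable lborel g"
proof (rule Bochner_Integration.integrable_bound)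
  show "integrable lborel (\<lambda>x::'a. C * (1 / (1 + norm x) ^ N))"
    by (intro integrable_mult_right integrable_decay assms)
  show "AE x in lborel. norm (g x) \<le> norm (C * (1 / (1 + norm x) ^ N))"
    using order_trans[OF assms(2) abs_ge_self] by simp
qed (use assms in simp)

lemma schwartz_integrable:
  fixes f :: "'a::euclidean_space \<Rightarrow> complex"
  assumes "schwartz f"
  shows "integrable lborel f"
proof -
  obtain C where C: "C > 0" "\<And>x. norm (f x) \<le> C / (1 + norm x) ^ Suc DIM('a)"
    using schwartz_bound[OF assms] by blast
  then show ?thesis
    by (intro integrable_bounded_by_decay[of f C "Suc DIM('a)"] borel_measurable_schwartz assms C) simp
qed

section \<open>Fourier transforms of Schwartz functions\<close>

lemma difference_quotient_tendsto:
  fixes f :: "'a::real_normed_vector \<Rightarrow> 'b::real_normed_vector"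
  assumes f: "(f has_derivative D) (at x)" and t: "t \<longlonglongrightarrow> 0" "\<And>n::nat. t n > 0"
  shows "(\<lambda>n. (f (x + t n *\<^sub>R b) - f x) /\<^sub>R t n) \<longlonglongrightarrow> D b"
proof -
  interpret D: bounded_linear D using f by (rule has_derivative_bounded_linear)
  have "((\<lambda>s::real. x + s *\<^sub>R b) has_derivative (\<lambda>s. s *\<^sub>R b)) (at 0)"
    by (auto intro!: derivative_eq_intros)
  from diff_chain_at[OF this, of f D] f
  have "((\<lambda>s. f (x + s *\<^sub>R b)) has_derivative (\<lambda>s. s *\<^sub>R D b)) (at 0)"
    by (simp add: o_def D.scaleR)
  then have "(\<lambda>h. norm (f (x + h *\<^sub>R b) - f x - h *\<^sub>R D b) / norm h) \<midarrow>0\<rightarrow> 0"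
    by (simp add: has_derivative_at)
  moreover have "filterlim t (at 0) sequentially"
    using t by (auto simp: filterlim_at less_imp_neq[symmetric] intro!: always_eventually)
  ultimately have l: "(\<lambda>n. norm (f (x + t n *\<^sub>R b) - f x - t n *\<^sub>R D b) / norm (t n)) \<longlonglongrightarrow> 0"
    by (rule filterlim_compose)
  have "norm (f (x + t n *\<^sub>R b) - f x - t n *\<^sub>R D b) / norm (t n) = norm ((f (x + t n *\<^sub>R b) - f x) /\<^sub>R t n - D b)" for n
  proof -
    have "(f (x + t n *\<^sub>R b) - f x) /\<^sub>R t n - D b = (f (x + t n *\<^sub>R b) - f x - t n *\<^sub>R D b) /\<^sub>R t n"
      using t(2)[of n] by (simp add: scaleR_diff_right)
    then show ?thesis using t(2)[of n] by (simp add: divide_inverse)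
  qed
  then have "(\<lambda>n. norm ((f (x + t n *\<^sub>R b) - f x) /\<^sub>R t n - D b)) \<longlonglongrightarrow> 0"
    using l by simp
  from LIM_zero_cancel[OF tendsto_norm_zero_cancel[OF this]] show ?thesis .
qed

lemma fourier_L1_translate:
  fixes g :: "'a::euclidean_space \<Rightarrow> complex"
  shows "fourier_L1 (\<lambda>x. g (x + c)) \<xi> = exp (\<i> * complex_of_real (c \<bullet> \<xi>)) * fourier_L1 g \<xi>"
proof -
  have "fourier_L1 g \<xi> = (LINT x|lborel. wave (c + 1 *\<^sub>R x) \<xi> * g (c + 1 *\<^sub>R x))"
    unfolding fourier_L1_def by (subst integral_lborel_affine[where c=1 and t=c]) auto
  also have "\<dots> = (LINT x|lborel. wave c \<xi> * (wave x \<xi> * g (x + c)))"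
    by (intro Bochner_Integration.integral_cong refl)
       (simp add: inner_add_left distrib_left exp_add[symmetric] mult.assoc[symmetric] add_ac)
  also have "\<dots> = wave c \<xi> * fourier_L1 (\<lambda>x. g (x + c)) \<xi>"
    unfolding fourier_L1_def by (rule integral_mult_right_zero)
  finally show ?thesis
    by (simp add: mult.assoc[symmetric] exp_add[symmetric])
qed

text \<open>No integration by parts: the transform of a difference quotient of \<open>f\<close> is
  known exactly from \<open>fourier_L1_translate\<close>, and both descriptions of it converge. One
  limit is a dominated convergence, the other the derivative of the exponential at 0.\<close>

lemma fourier_L1_partial:
  fixes f :: "'a::euclidean_space \<Rightarrow> complex"
  assumes f: "schwartz f" and b: "b \<in> Basis"
  shows "fourier_L1 (iter_partial [b] f) \<xi> = \<i> * complex_of_real (b \<bullet> \<xi>) * fourier_L1 f \<xi>"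
proof -
  define t :: "nat \<Rightarrow> real" where "t n = inverse (Suc n)" for n
  have t: "t n > 0" "t n \<le> 1" for n by (auto simp: t_def field_simps)
  have t0: "t \<longlonglongrightarrow> 0" unfolding t_def by (rule LIMSEQ_inverse_real_of_nat)
  let ?q = "\<lambda>n x. (f (x + t n *\<^sub>R b) - f x) /\<^sub>R t n"
  have d: "(f has_derivative frechet_derivative f (at x)) (at x)" for x
    using schwartz_differentiable[OF f] frechet_derivative_works by blast
  have f': "schwartz (iter_partial [b] f)" using f b by (intro schwartz_iter_partial) auto
  note [measurable] = borel_measurable_schwartz[OF f] borel_measurable_schwartz[OF f']
  let ?N = "Suc DIM('a)"
  obtain C where C: "C > 0" "\<And>x. norm (iter_partial [b] f x) \<le> C / (1 + norm x) ^ ?N"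
    using schwartz_bound[OF f'] by blast
  have dq: "norm (?q n x) \<le> 2 ^ ?N * C * (1 / (1 + norm x) ^ ?N)" for n x
  proof -
    let ?h = "\<lambda>s::real. f (x + s *\<^sub>R b)"
    have "norm (?h (t n) - ?h 0) \<le> 2 ^ ?N * C * (1 / (1 + norm x) ^ ?N) * norm (t n - 0)"
    proof (rule differentiable_bound[where S="{0..1}"])
      fix s :: real assume s: "s \<in> {0..1}"
      interpret D: bounded_linear "frechet_derivative f (at (x + s *\<^sub>R b))"
        using d by (rule has_derivative_bounded_linear)
      have "((\<lambda>s::real. x + s *\<^sub>R b) has_derivative (\<lambda>s. s *\<^sub>R b)) (at s)"
        by (auto intro!: derivative_eq_intros)
      from diff_chain_at[OF this d]
      have "(?h has_derivative (\<lambda>u. u *\<^sub>R iter_partial [b] f (x + s *\<^sub>R b))) (at s)"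
        by (simp add: o_def D.scaleR)
      then show "(?h has_derivative (\<lambda>u. u *\<^sub>R iter_partial [b] f (x + s *\<^sub>R b))) (at s within {0..1})"
        by (rule has_derivative_at_withinI)
      show "onorm (\<lambda>u. u *\<^sub>R iter_partial [b] f (x + s *\<^sub>R b)) \<le> 2 ^ ?N * C * (1 / (1 + norm x) ^ ?N)"
      proof (rule onorm_le)
        fix u :: real
        \<comment> \<open>A shift by a vector of norm at most 1 changes the weight by at most a
          factor 2, which explains \<open>2 ^ ?N\<close> in the majorant.\<close>
        have "1 + norm x \<le> 2 * (1 + norm (x + s *\<^sub>R b))"
          using norm_triangle_ineq4[of "x + s *\<^sub>R b" "s *\<^sub>R b"] s b norm_ge_zero[of "x + s *\<^sub>R b"]
          by (simp del: norm_ge_zero)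
        then have p: "(1 + norm x) ^ ?N \<le> 2 ^ ?N * (1 + norm (x + s *\<^sub>R b)) ^ ?N"
          unfolding power_mult_distrib[symmetric] by (intro power_mono) auto
        have pos: "(1 + norm y) ^ ?N > 0" for y :: 'a
          by (intro zero_less_power add_pos_nonneg) auto
        have "norm (iter_partial [b] f (x + s *\<^sub>R b)) \<le> C / (1 + norm (x + s *\<^sub>R b)) ^ ?N"
          by (rule C)
        also have "\<dots> \<le> 2 ^ ?N * C * (1 / (1 + norm x) ^ ?N)"
          using mult_left_mono[OF p, of C] C(1) pos[of x] pos[of "x + s *\<^sub>R b"]
          by (simp add: field_simps del: power_Suc)
        finally have "norm (iter_partial [b] f (x + s *\<^sub>R b)) * norm u \<le> 2 ^ ?N * C * (1 / (1 + norm x) ^ ?N) * norm u"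
          by (rule mult_right_mono) simp
        then show "norm (u *\<^sub>R iter_partial [b] f (x + s *\<^sub>R b)) \<le> 2 ^ ?N * C * (1 / (1 + norm x) ^ ?N) * norm u"
          unfolding norm_scaleR real_norm_def by (subst mult.commute)
      qed
    qed (use t[of n] in auto)
    then have "norm (?h (t n) - ?h 0) / t n \<le> 2 ^ ?N * C * (1 / (1 + norm x) ^ ?N)"
      using t[of n] by (subst pos_divide_le_eq) auto
    then show ?thesis using t[of n] by (simp add: divide_inverse mult.commute)
  qed
  let ?k = "\<lambda>x. wave x \<xi>"
  have "(\<lambda>n. LINT x|lborel. ?k x * (?q n x)) \<longlonglongrightarrow> (LINT x|lborel. ?k x * iter_partial [b] f x)"
  proof (rule integral_dominated_convergence[where w="\<lambda>x. 2 ^ ?N * C * (1 / (1 + norm x) ^ ?N)"])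
    show "integrable lborel (\<lambda>x::'a. 2 ^ ?N * C * (1 / (1 + norm x) ^ ?N))"
      by (intro integrable_mult_right integrable_decay) simp
    show "AE x in lborel. (\<lambda>n. ?k x * (?q n x)) \<longlonglongrightarrow> ?k x * iter_partial [b] f x"
      using difference_quotient_tendsto[OF d t0 t(1)] by (intro AE_I2 tendsto_intros) simp
    show "AE x in lborel. norm (?k x * (?q n x)) \<le> 2 ^ ?N * C * (1 / (1 + norm x) ^ ?N)" for n
      using dq by (simp add: norm_mult del: power_Suc)
  qed measurable
  then have l1: "(\<lambda>n. LINT x|lborel. ?k x * (?q n x)) \<longlonglongrightarrow> fourier_L1 (iter_partial [b] f) \<xi>"
    unfolding fourier_L1_def .
  \<comment> \<open>The terms \<open>0 + t n *\<^sub>R 1\<close> and \<open>0\<close> are spelled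
    out so that \<open>difference_quotient_tendsto\<close> applies literally, at the point 0 in
    direction 1.\<close>
  have eq: "(LINT x|lborel. ?k x * (?q n x))
     = ((exp (\<i> * complex_of_real ((0 + t n *\<^sub>R 1) * (b \<bullet> \<xi>))) - exp (\<i> * complex_of_real (0 * (b \<bullet> \<xi>)))) /\<^sub>R t n) * fourier_L1 f \<xi>" for n
  proof -
    have i: "integrable lborel f" by (rule schwartz_integrable[OF f])
    have i': "integrable lborel (\<lambda>x. f (x + t n *\<^sub>R b))"
      using integrable_lborel_affine_iff[of 1 f "t n *\<^sub>R b"] i by (simp add: add.commute)
    have "(LINT x|lborel. ?k x * (?q n x))
      = (LINT x|lborel. (?k x * f (x + t n *\<^sub>R b) - ?k x * f x) /\<^sub>R t n)"
      by (simp add: right_diff_distrib)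
    also have "\<dots> = (fourier_L1 (\<lambda>x. f (x + t n *\<^sub>R b)) \<xi> - fourier_L1 f \<xi>) /\<^sub>R t n"
      unfolding fourier_L1_def
      using integrable_fourier_kernel[OF i] integrable_fourier_kernel[OF i'] by simp
    finally show ?thesis
      unfolding fourier_L1_translate by (simp add: left_diff_distrib scaleR_conv_of_real right_diff_distrib mult.assoc)
  qed
  have "((\<lambda>s. exp (\<i> * complex_of_real (s * (b \<bullet> \<xi>)))) has_vector_derivative \<i> * complex_of_real (b \<bullet> \<xi>)) (at 0)"
  proof -
    have "((\<lambda>z. exp (\<i> * (z * complex_of_real (b \<bullet> \<xi>)))) has_field_derivative \<i> * complex_of_real (b \<bullet> \<xi>)) (at (of_real 0))"
      by (auto intro!: derivative_eq_intros)
    from has_vector_derivative_real_field[OF this] show ?thesis by (simp add: o_def)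
  qed
  then have "(\<lambda>n. (exp (\<i> * complex_of_real ((0 + t n *\<^sub>R 1) * (b \<bullet> \<xi>))) - exp (\<i> * complex_of_real (0 * (b \<bullet> \<xi>)))) /\<^sub>R t n)
     \<longlonglongrightarrow> 1 *\<^sub>R (\<i> * complex_of_real (b \<bullet> \<xi>))"
    unfolding has_vector_derivative_def by (rule difference_quotient_tendsto[OF _ t0 t(1)])
  then have "(\<lambda>n. LINT x|lborel. ?k x * (?q n x)) \<longlonglongrightarrow> 1 *\<^sub>R (\<i> * complex_of_real (b \<bullet> \<xi>)) * fourier_L1 f \<xi>"
    unfolding eq by (rule tendsto_mult_right)
  from LIMSEQ_unique[OF l1 this] show ?thesis by simp
qed

lemma fourier_L1_partial_power:
  fixes f :: "'a::euclidean_space \<Rightarrow> complex"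
  assumes f: "schwartz f" and b: "b \<in> Basis"
  shows "fourier_L1 (iter_partial (replicate m b) f) \<xi> = (\<i> * complex_of_real (b \<bullet> \<xi>)) ^ m * fourier_L1 f \<xi>"
proof (induction m)
  case (Suc m)
  have "schwartz (iter_partial (replicate m b) f)"
    using b by (intro schwartz_iter_partial[OF f]) auto
  from fourier_L1_partial[OF this b, of \<xi>] Suc show ?case by simp
qed simp

text \<open>Pure derivatives suffice. Let \<open>M\<close> be the largest modulus of a coordinate of
  \<open>\<xi>\<close>, or 1 if that is larger; then \<open>1 + norm \<xi>\<close> is at most
  \<open>(1 + DIM('a)) * M\<close>. If \<open>M\<close> is a coordinate, \<open>M ^ m\<close> times
  the transform is, in modulus, the transform of an \<open>m\<close>-th derivative in that
  direction; if \<open>M = 1\<close>, the trivial bound is enough.\<close>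

lemma fourier_L1_decay:
  fixes f :: "'a::euclidean_space \<Rightarrow> complex"
  assumes f: "schwartz f"
  shows "\<exists>C>0. \<forall>\<xi>. norm (fourier_L1 f \<xi>) \<le> C / (1 + norm \<xi>) ^ m"
proof -
  let ?F = "fourier_L1 f"
  let ?I = "\<lambda>b. LINT x|lborel. norm (iter_partial (replicate m b) f x)"
  define C where "C = (1 + real DIM('a)) ^ m * ((LINT x|lborel. norm (f x)) + (\<Sum>b\<in>(Basis::'a set). ?I b)) + 1"
  have "C > 0" unfolding C_def by (intro add_nonneg_pos mult_nonneg_nonneg add_nonneg_nonneg sum_nonneg) auto
  moreover have "norm (?F \<xi>) \<le> C / (1 + norm \<xi>) ^ m" for \<xi>
  proof -
    define M where "M = Max (insert 1 ((\<lambda>b. \<bar>b \<bullet> \<xi>\<bar>) ` Basis))"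
    have M1: "1 \<le> M" unfolding M_def by (intro Max_ge) auto
    have Mb: "\<bar>b \<bullet> \<xi>\<bar> \<le> M" if "b \<in> Basis" for b unfolding M_def using that by (intro Max_ge) auto
    have "norm \<xi> \<le> (\<Sum>b\<in>Basis. \<bar>\<xi> \<bullet> b\<bar>)" by (rule norm_le_l1)
    also have "\<dots> \<le> (\<Sum>b\<in>(Basis::'a set). M)" by (intro sum_mono) (metis Mb inner_commute)
    finally have "1 + norm \<xi> \<le> (1 + real DIM('a)) * M" using M1 by (simp add: algebra_simps)
    then have "(1 + norm \<xi>) ^ m \<le> ((1 + real DIM('a)) * M) ^ m" by (intro power_mono) auto
    then have p: "(1 + norm \<xi>) ^ m \<le> (1 + real DIM('a)) ^ m * M ^ m" by (simp add: power_mult_distrib)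
    have sm: "norm (?F \<xi>) * M ^ m \<le> (LINT x|lborel. norm (f x)) + (\<Sum>b\<in>(Basis::'a set). ?I b)"
    proof -
      have "M \<in> insert 1 ((\<lambda>b. \<bar>b \<bullet> \<xi>\<bar>) ` Basis)" unfolding M_def by (intro Max_in) auto
      then show ?thesis
      proof
        assume "M = 1"
        then show ?thesis using norm_fourier_L1_le[of f \<xi>]
          by (simp add: add_increasing2 sum_nonneg)
      next
        assume "M \<in> (\<lambda>b. \<bar>b \<bullet> \<xi>\<bar>) ` Basis"
        then obtain b where b: "b \<in> Basis" "M = \<bar>b \<bullet> \<xi>\<bar>" by auto
        have "norm (?F \<xi>) * M ^ m = norm (fourier_L1 (iter_partial (replicate m b) f) \<xi>)"
          unfolding fourier_L1_partial_power[OF f b(1)] by (simp add: norm_mult norm_power b(2))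
        also have "\<dots> \<le> ?I b" by (rule norm_fourier_L1_le)
        also have "\<dots> \<le> (\<Sum>b\<in>(Basis::'a set). ?I b)" by (rule member_le_sum[OF b(1)]) auto
        finally show ?thesis by (simp add: add_increasing)
      qed
    qed
    have "norm (?F \<xi>) * (1 + norm \<xi>) ^ m \<le> norm (?F \<xi>) * ((1 + real DIM('a)) ^ m * M ^ m)"
      by (intro mult_left_mono p) auto
    also have "\<dots> = (1 + real DIM('a)) ^ m * (norm (?F \<xi>) * M ^ m)" by simp
    also have "\<dots> \<le> C" unfolding C_def by (rule order_trans[OF mult_left_mono[OF sm]]) auto
    finally show ?thesis
      using norm_ge_zero[of \<xi>] by (subst pos_le_divide_eq) (auto intro!: zero_less_power add_pos_nonneg)
  qed
  ultimately show ?thesis by blast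
qed

lemma integrable_fourier_L1_schwartz:
  fixes f :: "'a::euclidean_space \<Rightarrow> complex"
  assumes f: "schwartz f"
  shows "integrable lborel (fourier_L1 f)"
proof -
  obtain C where C: "C > 0" "\<And>x. norm (fourier_L1 f x) \<le> C / (1 + norm x) ^ Suc DIM('a)"
    using fourier_L1_decay[OF f] by blast
  then show ?thesis
    by (intro integrable_bounded_by_decay[of _ C "Suc DIM('a)"] borel_measurable_fourier_L1 borel_measurable_schwartz f C) simp
qed

lemma fourier_L1_inversion_schwartz:
  fixes f :: "'a::euclidean_space \<Rightarrow> complex"
  assumes f: "schwartz f"
  shows "fourier_L1 (fourier_L1 f) (- x) = complex_of_real ((2 * pi) ^ DIM('a)) * f x"
proof -
  obtain C where C: "C > 0" "\<And>x. norm (f x) \<le> C / (1 + norm x) ^ 0"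
    using schwartz_bound[OF f] by blast
  then show ?thesis
    by (intro fourier_L1_inversion[of f C] schwartz_integrable schwartz_continuous integrable_fourier_L1_schwartz f) (use C in simp)
qed

section \<open>Gaussians are Schwartz functions\<close>

lemma real_polynomial_function_derivative:
  fixes p :: "'a::euclidean_space \<Rightarrow> real"
  assumes "real_polynomial_function p"
  shows "\<exists>D. (\<forall>x. (p has_derivative D x) (at x)) \<and> (\<forall>v. real_polynomial_function (\<lambda>x. D x v))"
  using assms
proof (induction p rule: real_polynomial_function.induct)
  case (linear f)
  then show ?case
    by (intro exI[of _ "\<lambda>_. f"]) (auto intro: bounded_linear_imp_has_derivative real_polynomial_function.intros(2))
next
  case (const c)
  show ?case by (intro exI[of _ "\<lambda>_ _. 0"]) auto
next
  case (add f g)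
  then obtain D E where "\<And>x. (f has_derivative D x) (at x)" "\<And>v. real_polynomial_function (\<lambda>x. D x v)"
    "\<And>x. (g has_derivative E x) (at x)" "\<And>v. real_polynomial_function (\<lambda>x. E x v)" by blast
  then show ?case
    by (intro exI[of _ "\<lambda>x v. D x v + E x v"]) (auto intro!: has_derivative_add)
next
  case (mult f g)
  then obtain D E where D: "\<And>x. (f has_derivative D x) (at x)" "\<And>v. real_polynomial_function (\<lambda>x. D x v)"
    "\<And>x. (g has_derivative E x) (at x)" "\<And>v. real_polynomial_function (\<lambda>x. E x v)" by blast
  then show ?case
    using mult.hyps by (intro exI[of _ "\<lambda>x v. f x * E x v + D x v * g x"])
      (auto intro!: has_derivative_mult real_polynomial_function.intros(3,4))
qed

lemma real_polynomial_function_growth: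
  fixes p :: "'a::euclidean_space \<Rightarrow> real"
  assumes "real_polynomial_function p"
  shows "\<exists>C M. \<forall>x. \<bar>p x\<bar> \<le> C * (1 + norm x) ^ M"
  using assms
proof (induction p rule: real_polynomial_function.induct)
  case (linear f)
  have "\<bar>f x\<bar> \<le> onorm f * (1 + norm x) ^ 1" for x
    using onorm[OF linear, of x] onorm_pos_le[OF linear] by (simp add: algebra_simps)
  then show ?case by blast
next
  case (const c)
  show ?case by (intro exI[of _ "\<bar>c\<bar>"] exI[of _ 0]) auto
next
  case (add f g)
  then obtain C M C' M' where b: "\<And>x. \<bar>f x\<bar> \<le> C * (1 + norm x) ^ M" "\<And>x. \<bar>g x\<bar> \<le> C' * (1 + norm x) ^ M'" by blast
  have "C \<ge> 0" "C' \<ge> 0" using b[of 0] by auto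
  have "\<bar>f x + g x\<bar> \<le> (C + C') * (1 + norm x) ^ (M + M')" for x
  proof -
    have "\<bar>f x + g x\<bar> \<le> C * (1 + norm x) ^ M + C' * (1 + norm x) ^ M'"
      using b[of x] by linarith
    also have "\<dots> \<le> C * (1 + norm x) ^ (M + M') + C' * (1 + norm x) ^ (M + M')"
      using \<open>C \<ge> 0\<close> \<open>C' \<ge> 0\<close> by (intro add_mono mult_left_mono power_increasing) auto
    finally show ?thesis by (simp add: algebra_simps)
  qed
  then show ?case by blast
next
  case (mult f g)
  then obtain C M C' M' where b: "\<And>x. \<bar>f x\<bar> \<le> C * (1 + norm x) ^ M" "\<And>x. \<bar>g x\<bar> \<le> C' * (1 + norm x) ^ M'" by blast
  have "C \<ge> 0" "C' \<ge> 0" using b[of 0] by auto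
  have "\<bar>f x * g x\<bar> \<le> (C * C') * (1 + norm x) ^ (M + M')" for x
  proof -
    have "\<bar>f x * g x\<bar> \<le> (C * (1 + norm x) ^ M) * (C' * (1 + norm x) ^ M')"
      unfolding abs_mult using b \<open>C \<ge> 0\<close> by (intro mult_mono) auto
    then show ?thesis by (simp add: power_add algebra_simps)
  qed
  then show ?case by blast
qed

text \<open>For fixed \<open>q\<close> the products of a polynomial with \<open>exp q\<close> are
  closed under partial derivatives, so every derivative of a Gaussian has the same shape and needs
  only one estimate.\<close>

lemma iter_partial_polynomial_exp:
  fixes p q :: "'a::euclidean_space \<Rightarrow> real"
  assumes p: "real_polynomial_function p" and q: "real_polynomial_function q"
  shows "\<exists>p'. real_polynomial_function p' \<and>
     iter_partial ds (\<lambda>x. complex_of_real (p x * exp (q x))) = (\<lambda>x. complex_of_real (p' x * exp (q x)))"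
proof (induction ds)
  case Nil
  then show ?case using p by auto
next
  case (Cons b ds)
  then obtain p' where p': "real_polynomial_function p'"
    "iter_partial ds (\<lambda>x. complex_of_real (p x * exp (q x))) = (\<lambda>x. complex_of_real (p' x * exp (q x)))" by blast
  obtain D where D: "\<And>x. (p' has_derivative D x) (at x)" "\<And>v. real_polynomial_function (\<lambda>x. D x v)"
    using real_polynomial_function_derivative[OF p'(1)] by blast
  obtain E where E: "\<And>x. (q has_derivative E x) (at x)" "\<And>v. real_polynomial_function (\<lambda>x. E x v)"
    using real_polynomial_function_derivative[OF q] by blast
  have "frechet_derivative (\<lambda>x. complex_of_real (p' x * exp (q x))) (at x) b
      = complex_of_real ((D x b + p' x * E x b) * exp (q x))" for x
  proof -
    have "((\<lambda>x. complex_of_real (p' x * exp (q x))) has_derivative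
        (\<lambda>v. complex_of_real ((D x v + p' x * E x v) * exp (q x)))) (at x)"
      by (rule derivative_eq_intros D E refl | rule ext)+ (auto simp: algebra_simps)
    from fun_cong[OF frechet_derivative_at[OF this], of b] show ?thesis by (rule sym)
  qed
  then show ?case unfolding iter_partial.simps p'(2)
    using D(2)[of b] E(2)[of b] p'(1) by (intro exI[of _ "\<lambda>x. D x b + p' x * E x b"]) auto
qed

text \<open>Apply \<open>1 + t \<le> exp t\<close> with \<open>t = r^2 / (2 M)\<close> and raise to
  the power \<open>M = N + 1\<close>, which turns the exponential into \<open>exp (r^2 / 2)\<close>.
  Taking \<open>N + 1\<close> instead of \<open>N\<close> keeps \<open>M\<close> positive for
  \<open>N = 0\<close>.\<close>

lemma gaussian_decay: "\<exists>K>0. \<forall>x::'a::euclidean_space. gaussian x \<le> K / (1 + norm x) ^ N"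
proof -
  define M where "M = real (Suc N)"
  have M: "M \<ge> 1" by (simp add: M_def)
  have "gaussian x \<le> (2 * M) ^ Suc N / (1 + norm x) ^ N" for x :: 'a
  proof -
    define r where "r = norm x"
    have r: "r \<ge> 0" by (simp add: r_def)
    have "1 + r \<le> 2 * M + r\<^sup>2"
      using M r sum_squares_ge_zero[of "r - 1/2" 0] by (simp add: power2_eq_square algebra_simps)
    also have "\<dots> = 2 * M * (1 + r\<^sup>2 / 2 / M)" using M by (simp add: field_simps)
    also have "\<dots> \<le> 2 * M * exp (r\<^sup>2 / 2 / M)" using M by (intro mult_left_mono exp_ge_add_one_self) auto
    finally have "(1 + r) ^ Suc N \<le> (2 * M * exp (r\<^sup>2 / 2 / M)) ^ Suc N" using r by (intro power_mono) auto
    also have "\<dots> = (2 * M) ^ Suc N * exp (r\<^sup>2 / 2 / M) ^ Suc N" by (rule power_mult_distrib)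
    also have "exp (r\<^sup>2 / 2 / M) ^ Suc N = exp (r\<^sup>2 / 2)"
      unfolding exp_of_nat_mult[symmetric] M_def by (simp del: of_nat_Suc)
    finally have 1: "(1 + r) ^ Suc N \<le> (2 * M) ^ Suc N * exp (r\<^sup>2 / 2)" .
    have "(1 + r) ^ N \<le> (1 + r) ^ Suc N" using r by (intro power_increasing) auto
    also note 1
    finally have "(1 + r) ^ N / exp (r\<^sup>2 / 2) \<le> (2 * M) ^ Suc N"
      unfolding pos_divide_le_eq[OF exp_gt_zero] .
    moreover have "exp (- r\<^sup>2 / 2) = inverse (exp (r\<^sup>2 / 2))"
      unfolding exp_minus[symmetric] by simp
    ultimately have "exp (- r\<^sup>2 / 2) * (1 + r) ^ N \<le> (2 * M) ^ Suc N"
      unfolding divide_inverse[of _ "exp (r\<^sup>2 / 2)"] by (simp only: mult.commute)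
    then show ?thesis
      unfolding r_def gaussian_def by (subst pos_le_divide_eq) (auto intro!: zero_less_power add_pos_nonneg)
  qed
  moreover have "(2 * M) ^ Suc N > 0" using M by (intro zero_less_power) auto
  ultimately show ?thesis by blast
qed

text \<open>A Peetre-type inequality. Applied with \<open>- w\<close> it bounds the weight at
  \<open>u\<close> by the weight at \<open>u + t *\<^sub>R w\<close>, which is how decay is carried
  from one point to another below.\<close>

lemma one_plus_norm_le:
  assumes "0 \<le> t"
  shows "1 + norm (u + t *\<^sub>R w) \<le> (1 + norm u) * (1 + t) * (1 + norm w)"
proof -
  have "norm (u + t *\<^sub>R w) \<le> norm u + t * norm w"
    using norm_triangle_ineq[of u "t *\<^sub>R w"] assms by simp
  then have "1 + norm (u + t *\<^sub>R w) \<le> 1 + norm u + t * norm w" by simp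
  also have "\<dots> \<le> (1 + norm u) * (1 + t) * (1 + norm w)"
    using assms by (auto simp: algebra_simps intro!: add_nonneg_nonneg mult_nonneg_nonneg)
  finally show ?thesis .
qed

text \<open>The constant depends on the centre only through \<open>R\<close>; this uniformity is
  what Fubini over all centres in a ball requires.\<close>

lemma translated_gaussian_decay:
  assumes e: "e > 0" and c: "norm c \<le> R"
    and K: "K > 0" "\<And>x::'a::euclidean_space. gaussian x \<le> K / (1 + norm x) ^ N"
  shows "gaussian ((x - c :: 'a) /\<^sub>R e) \<le> K * ((1 + R) * (1 + e)) ^ N / (1 + norm x) ^ N"
proof -
  have "1 + norm x \<le> (1 + norm c) * (1 + e) * (1 + norm ((x - c) /\<^sub>R e))"
    using one_plus_norm_le[of e c "(x - c) /\<^sub>R e"] e by simp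
  also have "\<dots> \<le> (1 + R) * (1 + e) * (1 + norm ((x - c) /\<^sub>R e))"
    using c e by (intro mult_right_mono) auto
  finally have "(1 + norm x) ^ N \<le> ((1 + R) * (1 + e) * (1 + norm ((x - c) /\<^sub>R e))) ^ N"
    by (intro power_mono) auto
  also have "\<dots> = ((1 + R) * (1 + e)) ^ N * (1 + norm ((x - c) /\<^sub>R e)) ^ N" by (rule power_mult_distrib)
  finally have 1: "(1 + norm x) ^ N \<le> ((1 + R) * (1 + e)) ^ N * (1 + norm ((x - c) /\<^sub>R e)) ^ N" .
  have pos: "(1 + norm y) ^ N > 0" for y :: 'a by (intro zero_less_power add_pos_nonneg) auto
  have "gaussian ((x - c) /\<^sub>R e) \<le> K / (1 + norm ((x - c) /\<^sub>R e)) ^ N" by (rule K)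
  also have "\<dots> \<le> K * ((1 + R) * (1 + e)) ^ N / (1 + norm x) ^ N"
  proof -
    have "K * (1 + norm x) ^ N \<le> K * (((1 + R) * (1 + e)) ^ N * (1 + norm ((x - c) /\<^sub>R e)) ^ N)"
      using 1 K(1) by (intro mult_left_mono) auto
    then show ?thesis
      by (subst pos_divide_le_eq[OF pos], subst times_divide_eq_left, subst pos_le_divide_eq[OF pos])
         (simp only: mult.assoc)
  qed
  finally show ?thesis .
qed

lemma schwartz_gaussian:
  fixes c :: "'a::euclidean_space"
  assumes e: "e > 0"
  shows "schwartz (\<lambda>x. complex_of_real (gaussian ((x - c) /\<^sub>R e)))"
proof -
  define q where "q x = - (norm ((x - c) /\<^sub>R e))\<^sup>2 / 2" for x
  have "(norm ((x - c) /\<^sub>R e))\<^sup>2 = (\<Sum>b\<in>Basis. (((x \<bullet> b) - (c \<bullet> b)) / e)\<^sup>2)" for x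
  proof -
    have "((x - c) /\<^sub>R e) \<bullet> b = ((x \<bullet> b) - (c \<bullet> b)) / e" for b
      unfolding inner_scaleR_left inner_diff_left divide_inverse by (rule mult.commute)
    moreover have "(norm ((x - c) /\<^sub>R e))\<^sup>2 = (\<Sum>b\<in>Basis. (((x - c) /\<^sub>R e) \<bullet> b)\<^sup>2)"
      unfolding power2_norm_eq_inner by (subst euclidean_inner) (simp add: power2_eq_square)
    ultimately show ?thesis by (simp only:)
  qed
  then have "q = (\<lambda>x. - (\<Sum>b\<in>Basis. (((x \<bullet> b) - (c \<bullet> b)) / e)\<^sup>2) / 2)"
    unfolding q_def by simp
  moreover have "real_polynomial_function (\<lambda>x. - (\<Sum>b\<in>Basis. (((x \<bullet> b) - (c \<bullet> b)) / e)\<^sup>2) / 2)"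
    by (intro real_polynomial_function_divide real_polynomial_function_minus real_polynomial_function_sum
          real_polynomial_function_power real_polynomial_function_diff real_polynomial_function.intros(1)
          real_polynomial_function.intros(2) bounded_linear_inner_left) auto
  ultimately have q: "real_polynomial_function q" by simp
  have g: "gaussian ((x - c) /\<^sub>R e) = exp (q x)" for x by (simp add: gaussian_def q_def)
  show ?thesis unfolding schwartz_def
  proof (intro allI impI)
    fix ds :: "'a list"
    obtain p where p: "real_polynomial_function p"
      "iter_partial ds (\<lambda>x. complex_of_real (gaussian ((x - c) /\<^sub>R e))) = (\<lambda>x. complex_of_real (p x * exp (q x)))"
      using iter_partial_polynomial_exp[OF real_polynomial_function.intros(2)[of 1] q, of ds] unfolding g by auto
    have "p differentiable at x" "q differentiable at x" for x
      using real_polynomial_function_derivative p(1) q unfolding differentiable_def by blast+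
    then obtain D E where "\<And>x. (p has_derivative D x) (at x)" "\<And>x. (q has_derivative E x) (at x)"
      unfolding differentiable_def by metis
    then have "(\<lambda>x. complex_of_real (p x * exp (q x))) differentiable at x" for x
      unfolding differentiable_def by (intro exI) (rule derivative_eq_intros refl | assumption)+
    moreover have "bounded (range (\<lambda>x. norm x ^ N *\<^sub>R complex_of_real (p x * exp (q x))))" for N
    proof -
      obtain C M where C: "\<And>x. \<bar>p x\<bar> \<le> C * (1 + norm x) ^ M"
        using real_polynomial_function_growth[OF p(1)] by blast
      have C0: "C \<ge> 0" using C[of 0] by auto
      obtain K where K: "K > 0" "\<And>x::'a. gaussian x \<le> K / (1 + norm x) ^ (N + M)"
        using gaussian_decay by blast
      define L where "L = K * ((1 + norm c) * (1 + e)) ^ (N + M)"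
      have "norm (norm x ^ N *\<^sub>R complex_of_real (p x * exp (q x))) \<le> C * L" for x
      proof -
        have "norm (norm x ^ N *\<^sub>R complex_of_real (p x * exp (q x))) = norm x ^ N * \<bar>p x\<bar> * exp (q x)"
          by (simp add: abs_mult norm_mult)
        also have "\<dots> \<le> (1 + norm x) ^ N * (C * (1 + norm x) ^ M) * (L / (1 + norm x) ^ (N + M))"
          using C[of x] C0 translated_gaussian_decay[OF e order_refl K, of x c]
          by (intro mult_mono power_mono) (auto simp: g L_def)
        also have "\<dots> = C * L"
        proof -
          have "1 + norm x \<noteq> 0" using norm_ge_zero[of x] by linarith
          then show ?thesis by (simp add: power_add)
        qed
        finally show ?thesis .
      qed
      then show ?thesis by (auto simp: bounded_iff)
    qed
    ultimately show "(\<forall>x. iter_partial ds (\<lambda>x. complex_of_real (gaussian ((x - c) /\<^sub>R e))) differentiable at x) \<and>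
      (\<forall>N::nat. bounded (range (\<lambda>x. norm x ^ N *\<^sub>R iter_partial ds (\<lambda>x. complex_of_real (gaussian ((x - c) /\<^sub>R e))) x)))"
      unfolding p(2) by blast
  qed
qed

section \<open>Fourier transforms of tempered functions\<close>

lemma of_real_mult_inverse_scaleR: "a \<noteq> 0 \<Longrightarrow> complex_of_real a * (z /\<^sub>R a) = z"
  by (simp add: scaleR_conv_of_real)

lemma borel_measurable_tempered_fun:
  fixes G :: "'a::euclidean_space \<Rightarrow> complex"
  assumes "tempered_fun G"
  shows "G \<in> borel_measurable borel"
proof -
  obtain N where "integrable lborel (\<lambda>x. G x /\<^sub>R (1 + norm x) ^ N)"
    using assms unfolding tempered_fun_def by blast
  then have [measurable]: "(\<lambda>x. G x /\<^sub>R (1 + norm x) ^ N) \<in> borel_measurable borel" by auto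
  have "1 + norm x \<noteq> 0" for x :: 'a using norm_ge_zero[of x] by linarith
  then have e: "G = (\<lambda>x. complex_of_real ((1 + norm x) ^ N) * (G x /\<^sub>R (1 + norm x) ^ N))"
    by (simp only: fun_eq_iff of_real_mult_inverse_scaleR power_not_zero simp_thms)
  show ?thesis by (subst e) measurable
qed

lemma integrable_schwartz_mult:
  fixes G \<phi> :: "'a::euclidean_space \<Rightarrow> complex"
  assumes G: "tempered_fun G" and \<phi>: "schwartz \<phi>"
  shows "integrable lborel (\<lambda>x. G x * \<phi> x)"
proof -
  obtain N where N: "integrable lborel (\<lambda>x. G x /\<^sub>R (1 + norm x) ^ N)"
    using G unfolding tempered_fun_def by blast
  obtain C where C: "C > 0" "\<And>x. norm (\<phi> x) \<le> C / (1 + norm x) ^ N"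
    using schwartz_bound[OF \<phi>] by blast
  have [measurable]: "\<phi> \<in> borel_measurable borel" by (rule borel_measurable_schwartz[OF \<phi>])
  note [measurable] = borel_measurable_tempered_fun[OF G]
  show ?thesis
  proof (rule Bochner_Integration.integrable_bound)
    show "integrable lborel (\<lambda>x. C *\<^sub>R (G x /\<^sub>R (1 + norm x) ^ N))" by (rule integrable_scaleR_right[OF N])
    show "(\<lambda>x. G x * \<phi> x) \<in> borel_measurable lborel" by measurable
    show "AE x in lborel. norm (G x * \<phi> x) \<le> norm (C *\<^sub>R (G x /\<^sub>R (1 + norm x) ^ N))"
    proof (rule AE_I2)
      fix x :: 'a
      have "norm (G x * \<phi> x) \<le> norm (G x) * (C / (1 + norm x) ^ N)"
        unfolding norm_mult by (intro mult_left_mono C) auto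
      also have "\<dots> = norm (C *\<^sub>R (G x /\<^sub>R (1 + norm x) ^ N))"
        using C(1) by (simp add: divide_inverse mult_ac abs_of_nonneg add_nonneg_nonneg)
      finally show "norm (G x * \<phi> x) \<le> norm (C *\<^sub>R (G x /\<^sub>R (1 + norm x) ^ N))" .
    qed
  qed
qed

text \<open>If \<open>\<xi> + t *\<^sub>R w\<close> lies in a fixed ball and
  \<open>t \<le> 1\<close>, a large \<open>\<xi>\<close> forces a large \<open>w\<close>, where the
  Gaussian is small. Of its \<open>N + DIM('a) + 1\<close> powers of decay, \<open>N\<close> pay for
  the weight in \<open>\<xi>\<close> and the rest keeps the integral over \<open>w\<close> finite.
  Uniformity in \<open>t\<close> provides a majorant for the limit at 0.\<close>

lemma smoothed_ball_decay:
  fixes p :: "'a::euclidean_space"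
  assumes r: "r > 0"
  shows "\<exists>C. \<forall>\<xi>. \<forall>t\<in>{0..1}. (LINT w|lborel. indicator (ball p r) (\<xi> + t *\<^sub>R w) * gaussian w) \<le> C / (1 + norm \<xi>) ^ N"
proof -
  define R where "R = norm p + r"
  have [measurable]: "ball p r \<in> sets borel" by auto
  obtain K where K: "K > 0" "\<And>x::'a. gaussian x \<le> K / (1 + norm x) ^ (N + Suc DIM('a))"
    using gaussian_decay by blast
  define D where "D = (1 + R) ^ N * 2 ^ N * K"
  have "(LINT w|lborel. indicator (ball p r) (\<xi> + t *\<^sub>R w) * gaussian w)
      \<le> (D * (LINT w|lborel. 1 / (1 + norm (w::'a)) ^ Suc DIM('a))) / (1 + norm \<xi>) ^ N" if t: "t \<in> {0..1}" for \<xi> t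
  proof -
    have pos: "(1 + norm x) ^ M > 0" for x :: 'a and M by (intro zero_less_power add_pos_nonneg) auto
    have "(LINT w|lborel. indicator (ball p r) (\<xi> + t *\<^sub>R w) * gaussian w)
      \<le> (LINT w|lborel. D / (1 + norm \<xi>) ^ N * (1 / (1 + norm (w::'a)) ^ Suc DIM('a)))"
    proof (rule integral_mono)
      show "integrable lborel (\<lambda>w. indicator (ball p r) (\<xi> + t *\<^sub>R w) * gaussian w)"
        by (rule Bochner_Integration.integrable_bound[OF integrable_gaussian])
           (auto split: split_indicator simp: gaussian_pos less_imp_le)
      show "integrable lborel (\<lambda>w::'a. D / (1 + norm \<xi>) ^ N * (1 / (1 + norm w) ^ Suc DIM('a)))"
        by (intro integrable_mult_right integrable_decay) simp
      fix w :: 'a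
      have D0: "D \<ge> 0" using K(1) r by (auto simp: D_def R_def)
      show "indicator (ball p r) (\<xi> + t *\<^sub>R w) * gaussian w \<le> D / (1 + norm \<xi>) ^ N * (1 / (1 + norm w) ^ Suc DIM('a))"
      proof (cases "\<xi> + t *\<^sub>R w \<in> ball p r")
        case True
        define u where "u = \<xi> + t *\<^sub>R w"
        have "norm u \<le> R" using True norm_triangle_ineq2[of u p] unfolding u_def R_def by (simp add: dist_norm norm_minus_commute)
        have "1 + norm \<xi> \<le> (1 + norm u) * (1 + t) * (1 + norm w)"
          using one_plus_norm_le[of t u "- w"] t by (simp add: u_def)
        also have "\<dots> \<le> (1 + R) * 2 * (1 + norm w)"
          using \<open>norm u \<le> R\<close> order_trans[OF norm_ge_zero \<open>norm u \<le> R\<close>] t by (intro mult_right_mono mult_mono) auto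
        finally have "(1 + norm \<xi>) ^ N \<le> ((1 + R) * 2 * (1 + norm w)) ^ N" by (intro power_mono) auto
        then have 1: "(1 + norm \<xi>) ^ N \<le> (1 + R) ^ N * 2 ^ N * (1 + norm w) ^ N"
          by (simp only: power_mult_distrib)
        have "gaussian w * (1 + norm \<xi>) ^ N \<le> K / (1 + norm w) ^ (N + Suc DIM('a)) * ((1 + R) ^ N * 2 ^ N * (1 + norm w) ^ N)"
          using 1 K by (intro mult_mono) auto
        also have "\<dots> = D * (1 / (1 + norm w) ^ Suc DIM('a))"
          using pos[of w N] unfolding power_add D_def by (simp add: field_simps del: power_Suc)
        finally show ?thesis using True
          by (subst times_divide_eq_left, subst pos_le_divide_eq[OF pos]) simp
      next
        case False
        then show ?thesis using D0 by simp
      qed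
    qed
    also have "\<dots> = D / (1 + norm \<xi>) ^ N * (LINT w|lborel. 1 / (1 + norm (w::'a)) ^ Suc DIM('a))"
      by (rule integral_mult_right_zero)
    finally show ?thesis by (simp only: times_divide_eq_left)
  qed
  then show ?thesis by blast
qed

text \<open>The indicator of a ball is a limit of its Gaussian mollifications, which are superpositions of
  Schwartz functions.\<close>

lemma set_integral_ball_eq_0:
  fixes H :: "'a::euclidean_space \<Rightarrow> complex"
  assumes H: "tempered_fun H" and zero: "\<And>\<phi>. schwartz \<phi> \<Longrightarrow> (LINT x|lborel. H x * \<phi> x) = 0" and r: "r > 0"
  shows "(LINT x:ball p r|lborel. H x) = 0"
proof -
  let ?B = "ball p r"
  let ?b = "\<lambda>\<xi>. sqrt (2 * pi) ^ DIM('a) * indicator ?B \<xi>"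
  define t :: "nat \<Rightarrow> real" where "t n = inverse (Suc n)" for n
  have t: "t n > 0" "t n \<le> 1" for n by (auto simp: t_def field_simps)
  have t0: "t \<longlonglongrightarrow> 0" unfolding t_def by (rule LIMSEQ_inverse_real_of_nat)
  obtain N where N: "integrable lborel (\<lambda>x. H x /\<^sub>R (1 + norm x) ^ N)"
    using H unfolding tempered_fun_def by blast
  note [measurable] = borel_measurable_tempered_fun[OF H]
  have [measurable]: "?B \<in> sets borel" by auto
  define \<psi> where "\<psi> s \<xi> = (LINT w|lborel. indicator ?B (\<xi> + s *\<^sub>R w) * gaussian w)" for s and \<xi> :: 'a
  obtain K where K: "K > 0" "\<And>x::'a. gaussian x \<le> K / (1 + norm x) ^ N"
    using gaussian_decay by blast
  have z: "(LINT \<xi>|lborel. H \<xi> * \<psi> (t n) \<xi>) = 0" for n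
  proof -
    let ?s = "t n"
    let ?g = "\<lambda>\<xi> c. complex_of_real (gaussian ((\<xi> - c) /\<^sub>R ?s))"
    have "integrable (lborel \<Otimes>\<^sub>M lborel) (\<lambda>(\<xi>, c). H \<xi> * (indicator ?B c * ?g \<xi> c))"
    proof (rule Bochner_Integration.integrable_bound)
      let ?L = "K * ((1 + (norm p + r)) * (1 + ?s)) ^ N"
      have "integrable lborel (\<lambda>c::'a. complex_of_real (indicator ?B c))"
        using emeasure_lborel_ball_finite[of p r] by (intro integrable_of_real integrable_real_indicator) auto
      from integrable_tensor[OF N this]
      show "integrable (lborel \<Otimes>\<^sub>M lborel) (\<lambda>x. ?L *\<^sub>R (\<lambda>(\<xi>, c). (H \<xi> /\<^sub>R (1 + norm \<xi>) ^ N) * complex_of_real (indicator ?B c)) x)"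
        by (intro integrable_scaleR_right)
      show "AE x in lborel \<Otimes>\<^sub>M lborel. norm (case x of (\<xi>, c) \<Rightarrow> H \<xi> * (indicator ?B c * ?g \<xi> c))
        \<le> norm (?L *\<^sub>R (\<lambda>(\<xi>, c). (H \<xi> /\<^sub>R (1 + norm \<xi>) ^ N) * complex_of_real (indicator ?B c)) x)"
      proof (rule AE_I2, clarify)
        fix \<xi> c :: 'a
        have L0: "?L \<ge> 0" using K r t(1)[of n] by simp
        show "norm (H \<xi> * (indicator ?B c * ?g \<xi> c))
          \<le> norm (?L *\<^sub>R ((H \<xi> /\<^sub>R (1 + norm \<xi>) ^ N) * complex_of_real (indicator ?B c)))"
        proof (cases "c \<in> ?B")
          case True
          then have "norm c \<le> norm p + r" using norm_triangle_ineq2[of c p] by (simp add: dist_norm norm_minus_commute)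
          from translated_gaussian_decay[OF t(1)[of n] this K, of \<xi>]
          have "norm (H \<xi>) * gaussian ((\<xi> - c) /\<^sub>R ?s) \<le> norm (H \<xi>) * (?L / (1 + norm \<xi>) ^ N)"
            by (rule mult_left_mono) simp
          also have "\<dots> = norm (?L *\<^sub>R ((H \<xi> /\<^sub>R (1 + norm \<xi>) ^ N) * complex_of_real 1))"
            using L0 by (simp only: norm_scaleR norm_mult abs_of_nonneg) (simp add: divide_inverse abs_of_nonneg add_nonneg_nonneg)
          finally show ?thesis using True by (simp add: norm_mult gaussian_pos less_imp_le)
        qed simp
      qed
    qed (simp add: case_prod_unfold)
    from lborel_pair.Fubini_integral[OF this]
    have "(LINT c|lborel. LINT \<xi>|lborel. H \<xi> * (indicator ?B c * ?g \<xi> c)) = (LINT \<xi>|lborel. LINT c|lborel. H \<xi> * (indicator ?B c * ?g \<xi> c))" .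
    moreover have "(LINT \<xi>|lborel. H \<xi> * (indicator ?B c * ?g \<xi> c)) = 0" for c
      using zero[OF schwartz_gaussian[OF t(1)[of n], of c]]
      unfolding mult.left_commute[of _ "indicator ?B c"] integral_mult_right_zero by simp
    \<comment> \<open>The substitution \<open>c = \<xi> + ?s *\<^sub>R w\<close> recovers the
      mollified indicator, because the Gaussian is even.\<close>
    moreover have "(LINT c|lborel. H \<xi> * (indicator ?B c * ?g \<xi> c)) = ?s ^ DIM('a) *\<^sub>R (H \<xi> * \<psi> ?s \<xi>)" for \<xi>
    proof -
      have "(LINT c|lborel. indicator ?B c * gaussian ((\<xi> - c) /\<^sub>R ?s)) = ?s ^ DIM('a) *\<^sub>R \<psi> ?s \<xi>"
        unfolding \<psi>_def using t(1)[of n] by (subst integral_lborel_affine[where c="?s" and t=\<xi>]) auto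
      then have "(LINT c|lborel. complex_of_real (indicator ?B c * gaussian ((\<xi> - c) /\<^sub>R ?s))) = complex_of_real (?s ^ DIM('a) *\<^sub>R \<psi> ?s \<xi>)"
        unfolding integral_complex_of_real by (rule arg_cong)
      moreover have "complex_of_real (indicator ?B c) = indicator ?B c" for c
        by (simp split: split_indicator)
      ultimately show ?thesis by (simp add: scaleR_conv_of_real)
    qed
    ultimately show ?thesis using t(1)[of n] by simp
  qed
  have "(\<lambda>n. LINT \<xi>|lborel. H \<xi> * \<psi> (t n) \<xi>) \<longlonglongrightarrow> (LINT \<xi>|lborel. H \<xi> * complex_of_real (?b \<xi>))"
  proof -
    obtain C where C: "\<And>\<xi> s. s \<in> {0..1} \<Longrightarrow> \<psi> s \<xi> \<le> C / (1 + norm \<xi>) ^ N"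
      using smoothed_ball_decay[OF r, of p N] unfolding \<psi>_def by blast
    have \<psi>0: "\<psi> s \<xi> \<ge> 0" for s \<xi>
      unfolding \<psi>_def by (intro Bochner_Integration.integral_nonneg) (auto simp: gaussian_pos less_imp_le)
    show ?thesis
    proof (rule integral_dominated_convergence[where w="\<lambda>x. norm (C *\<^sub>R (H x /\<^sub>R (1 + norm x) ^ N))"])
      show "integrable lborel (\<lambda>x. norm (C *\<^sub>R (H x /\<^sub>R (1 + norm x) ^ N)))"
        by (intro integrable_norm integrable_scaleR_right N)
      show "AE \<xi> in lborel. norm (H \<xi> * complex_of_real (\<psi> (t n) \<xi>)) \<le> norm (C *\<^sub>R (H \<xi> /\<^sub>R (1 + norm \<xi>) ^ N))" for n
      proof (rule AE_I2)
        fix \<xi>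
        have "norm (H \<xi> * complex_of_real (\<psi> (t n) \<xi>)) \<le> norm (H \<xi>) * (\<bar>C\<bar> / (1 + norm \<xi>) ^ N)"
        proof -
          have "\<psi> (t n) \<xi> \<le> C / (1 + norm \<xi>) ^ N" using C t[of n] by (simp add: less_imp_le)
          also have "\<dots> \<le> \<bar>C\<bar> / (1 + norm \<xi>) ^ N" by (intro divide_right_mono) auto
          finally have "norm (H \<xi>) * \<psi> (t n) \<xi> \<le> norm (H \<xi>) * (\<bar>C\<bar> / (1 + norm \<xi>) ^ N)"
            by (rule mult_left_mono) simp
          then show ?thesis using \<psi>0[of "t n" \<xi>] by (simp add: norm_mult)
        qed
        then show "norm (H \<xi> * complex_of_real (\<psi> (t n) \<xi>)) \<le> norm (C *\<^sub>R (H \<xi> /\<^sub>R (1 + norm \<xi>) ^ N))"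
          by (simp add: divide_inverse abs_mult abs_of_nonneg add_nonneg_nonneg mult_ac)
      qed
      \<comment> \<open>Off the bounding sphere the indicator is locally constant, so the
        mollifications converge to a multiple of it there; the sphere is a null set.\<close>
      have sph: "AE \<xi> in lborel. \<xi> \<notin> sphere p r"
        using negligible_sphere[of p r] by (intro AE_not_in) (simp add: negligible_iff_null_sets null_sets_completion_iff)
      show "AE \<xi> in lborel. (\<lambda>n. H \<xi> * complex_of_real (\<psi> (t n) \<xi>)) \<longlonglongrightarrow> H \<xi> * complex_of_real (?b \<xi>)"
        using sph
      proof (rule AE_mp, intro AE_I2 impI)
        fix \<xi> assume \<xi>: "\<xi> \<notin> sphere p r"
        have "(\<lambda>n. \<psi> (t n) \<xi>) \<longlonglongrightarrow> (LINT w|lborel. indicator ?B \<xi> * gaussian (w::'a))"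
          unfolding \<psi>_def
        proof (rule integral_dominated_convergence[where w=gaussian])
          show "AE w in lborel. (\<lambda>n. indicator ?B (\<xi> + t n *\<^sub>R w) * gaussian w) \<longlonglongrightarrow> indicator ?B \<xi> * gaussian w"
          proof (rule AE_I2)
            fix w :: 'a
            have l: "(\<lambda>n. \<xi> + t n *\<^sub>R w) \<longlonglongrightarrow> \<xi> + 0 *\<^sub>R w" by (intro tendsto_intros t0)
            have "\<forall>\<^sub>F n in sequentially. \<xi> + t n *\<^sub>R w \<in> ?B \<longleftrightarrow> \<xi> \<in> ?B"
            proof (cases "\<xi> \<in> ?B")
              case True
              then show ?thesis using topological_tendstoD[OF l, of "?B"] by simp
            next
              case False
              then have "\<xi> \<in> - cball p r" using \<xi> by auto
              then have "\<forall>\<^sub>F n in sequentially. \<xi> + t n *\<^sub>R w \<in> - cball p r"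
                using topological_tendstoD[OF l, of "- cball p r"] by auto
              then show ?thesis by (rule eventually_mono) (use False in auto)
            qed
            then have "\<forall>\<^sub>F n in sequentially. indicator ?B (\<xi> + t n *\<^sub>R w) * gaussian w = indicator ?B \<xi> * gaussian w"
              by (rule eventually_mono) (auto split: split_indicator)
            then show "(\<lambda>n. indicator ?B (\<xi> + t n *\<^sub>R w) * gaussian w) \<longlonglongrightarrow> indicator ?B \<xi> * gaussian w"
              by (rule tendsto_eventually)
          qed
        qed (auto simp: integrable_gaussian gaussian_pos less_imp_le split: split_indicator)
        also have "(LINT w|lborel. indicator ?B \<xi> * gaussian (w::'a)) = sqrt (2 * pi) ^ DIM('a) * indicator ?B \<xi>"
          by (simp add: integral_gaussian)
        finally show "(\<lambda>n. H \<xi> * complex_of_real (\<psi> (t n) \<xi>)) \<longlonglongrightarrow> H \<xi> * complex_of_real (?b \<xi>)"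
          by (intro tendsto_intros)
      qed
    qed (auto simp: \<psi>_def)
  qed
  then have "(LINT \<xi>|lborel. H \<xi> * complex_of_real (?b \<xi>)) = 0"
    unfolding z LIMSEQ_const_iff by (rule sym)
  moreover have "(LINT \<xi>|lborel. H \<xi> * complex_of_real (?b \<xi>))
     = complex_of_real (sqrt (2 * pi) ^ DIM('a)) * (LINT x:?B|lborel. H x)"
    unfolding set_lebesgue_integral_def integral_mult_right_zero[symmetric]
    by (intro Bochner_Integration.integral_cong refl) (simp split: split_indicator)
  ultimately show ?thesis by simp
qed

section \<open>Ball averages and uniqueness of the distributional transform\<close>

lemma set_integrable_ball_tempered:
  fixes G :: "'a::euclidean_space \<Rightarrow> complex"
  assumes G: "tempered_fun G"
  shows "set_integrable lborel (ball p r) G"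
proof -
  obtain N where N: "integrable lborel (\<lambda>x. G x /\<^sub>R (1 + norm x) ^ N)"
    using G unfolding tempered_fun_def by blast
  note [measurable] = borel_measurable_tempered_fun[OF G]
  have [measurable]: "ball p r \<in> sets borel" by auto
  let ?R = "(1 + (norm p + \<bar>r\<bar>)) ^ N"
  show ?thesis unfolding set_integrable_def
  proof (rule Bochner_Integration.integrable_bound)
    show "integrable lborel (\<lambda>x. ?R *\<^sub>R (G x /\<^sub>R (1 + norm x) ^ N))" using N by (intro integrable_scaleR_right)
    show "AE x in lborel. norm (indicator (ball p r) x *\<^sub>R G x) \<le> norm (?R *\<^sub>R (G x /\<^sub>R (1 + norm x) ^ N))"
    proof (rule AE_I2)
      fix x
      show "norm (indicator (ball p r) x *\<^sub>R G x) \<le> norm (?R *\<^sub>R (G x /\<^sub>R (1 + norm x) ^ N))"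
      proof (cases "x \<in> ball p r")
        case True
        then have "norm x \<le> norm p + \<bar>r\<bar>" using norm_triangle_ineq2[of x p] by (simp add: dist_norm norm_minus_commute)
        then have "(1 + norm x) ^ N \<le> ?R" by (intro power_mono) auto
        moreover have pos: "(1 + norm x) ^ N > 0" by (intro zero_less_power add_pos_nonneg) auto
        ultimately have "1 \<le> ?R / (1 + norm x) ^ N" by simp
        from mult_left_mono[OF this, of "norm (G x)"] show ?thesis
          using True by (simp add: divide_inverse abs_mult abs_of_nonneg add_nonneg_nonneg mult_ac)
      qed simp
    qed
  qed simp
qed

lemma tempered_fun_diff:
  fixes G G' :: "'a::euclidean_space \<Rightarrow> complex"
  assumes "tempered_fun G" "tempered_fun G'"
  shows "tempered_fun (\<lambda>x. G x - G' x)"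
proof -
  obtain N M where N: "integrable lborel (\<lambda>x. G x /\<^sub>R (1 + norm x) ^ N)"
    and M: "integrable lborel (\<lambda>x. G' x /\<^sub>R (1 + norm x) ^ M)"
    using assms unfolding tempered_fun_def by blast
  have more: "integrable lborel (\<lambda>x. G x /\<^sub>R (1 + norm x) ^ (N + M))"
    if N: "integrable lborel (\<lambda>x. G x /\<^sub>R (1 + norm x) ^ N)" for G :: "'a \<Rightarrow> complex" and N M
  proof (rule Bochner_Integration.integrable_bound[OF N])
    have [measurable]: "(\<lambda>x. G x /\<^sub>R (1 + norm x) ^ N) \<in> borel_measurable borel" using N by auto
    have e: "G x /\<^sub>R (1 + norm x) ^ (N + M) = inverse ((1 + norm x) ^ M) *\<^sub>R (G x /\<^sub>R (1 + norm x) ^ N)" for x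
      by (simp add: power_add)
    show "(\<lambda>x. G x /\<^sub>R (1 + norm x) ^ (N + M)) \<in> borel_measurable lborel" unfolding e by measurable
    show "AE x in lborel. norm (G x /\<^sub>R (1 + norm x) ^ (N + M)) \<le> norm (G x /\<^sub>R (1 + norm x) ^ N)"
    proof (rule AE_I2)
      fix x :: 'a
      have "inverse ((1 + norm x) ^ M) \<le> 1" by (intro inverse_le_1_iff[THEN iffD2] disjI2 one_le_power) auto
      from mult_right_mono[OF this, of "norm (G x /\<^sub>R (1 + norm x) ^ N)"]
      show "norm (G x /\<^sub>R (1 + norm x) ^ (N + M)) \<le> norm (G x /\<^sub>R (1 + norm x) ^ N)"
        unfolding e norm_scaleR[of "inverse ((1 + norm x) ^ M)"] by simp
    qed
  qed
  have "integrable lborel (\<lambda>x. G x /\<^sub>R (1 + norm x) ^ (N + M) - G' x /\<^sub>R (1 + norm x) ^ (M + N))"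
    by (intro Bochner_Integration.integrable_diff more N M)
  then show ?thesis unfolding tempered_fun_def
    by (intro exI[of _ "N + M"]) (simp add: scaleR_diff_right add.commute)
qed

text \<open>Representatives are compared through ball integrals only, since \<open>fourier\<close>
  sees them through nothing else.\<close>

lemma tempered_fourier_unique:
  fixes g G G' :: "'a::euclidean_space \<Rightarrow> complex"
  assumes G: "tempered_fourier g G" and G': "tempered_fourier g G'" and r: "r > 0"
  shows "(LINT x:ball p r|lborel. G x) = (LINT x:ball p r|lborel. G' x)"
proof -
  have t: "tempered_fun G" "tempered_fun G'" using G G' by (auto simp: tempered_fourier_def)
  have "(LINT x:ball p r|lborel. G x - G' x) = 0"
  proof (rule set_integral_ball_eq_0[OF tempered_fun_diff[OF t] _ r])
    fix \<phi> :: "'a \<Rightarrow> complex" assume \<phi>: "schwartz \<phi>"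
    have "(LINT x|lborel. (G x - G' x) * \<phi> x) = (LINT x|lborel. G x * \<phi> x) - (LINT x|lborel. G' x * \<phi> x)"
      unfolding left_diff_distrib using integrable_schwartz_mult[OF _ \<phi>] t by simp
    also have "\<dots> = 0" using G G' \<phi> by (simp add: tempered_fourier_def)
    finally show "(LINT x|lborel. (G x - G' x) * \<phi> x) = 0" .
  qed
  then show ?thesis
    using set_integral_diff(2)[OF set_integrable_ball_tempered[OF t(1)] set_integrable_ball_tempered[OF t(2)]]
    by simp
qed

lemma ball_average_tendsto:
  fixes G :: "'a::euclidean_space \<Rightarrow> complex"
  assumes G: "tempered_fun G" and cont: "isCont G p"
  shows "((\<lambda>r. (LINT x:ball p r|lborel. G x) /\<^sub>R measure lborel (ball p r)) \<longlongrightarrow> G p) (at_right 0)"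
proof (rule tendstoI)
  fix e :: real assume "e > 0"
  then have "e / 2 > 0" by simp
  with cont obtain d where d: "d > 0" "\<And>x. dist x p < d \<Longrightarrow> dist (G x) (G p) < e / 2"
    unfolding continuous_at_eps_delta by blast
  have "dist ((LINT x:ball p r|lborel. G x) /\<^sub>R measure lborel (ball p r)) (G p) < e" if r: "0 < r" "r < d" for r
  proof -
    let ?B = "ball p r" and ?m = "measure lborel (ball p r)"
    have fin: "emeasure lborel ?B < \<infinity>" by (rule emeasure_lborel_ball_finite)
    have m: "?m > 0" using r by (simp add: content_ball_pos)
    have c: "set_integrable lborel ?B (\<lambda>_. G p)"
      using fin unfolding set_integrable_def by (intro integrable_scaleR_left integrable_real_indicator) auto
    have "(LINT x:?B|lborel. G p) = ?m *\<^sub>R G p"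
      using fin unfolding set_lebesgue_integral_def by (subst integral_scaleR_left) (auto intro!: integrable_real_indicator)
    then have "(LINT x:?B|lborel. G x) - ?m *\<^sub>R G p = (LINT x:?B|lborel. G x - G p)"
      using set_integral_diff(2)[OF set_integrable_ball_tempered[OF G] c] by simp
    also have "norm \<dots> \<le> (LINT x:?B|lborel. e / 2)"
      unfolding set_lebesgue_integral_def
    proof (rule Bochner_Integration.integral_norm_bound_integral)
      show "integrable lborel (\<lambda>x. indicator ?B x *\<^sub>R (G x - G p))"
        using set_integral_diff(1)[OF set_integrable_ball_tempered[OF G] c] by (simp add: set_integrable_def)
      show "integrable lborel (\<lambda>x. indicat_real ?B x *\<^sub>R (e / 2))"
        using fin by (intro integrable_scaleR_left integrable_real_indicator) auto
      show "norm (indicator ?B x *\<^sub>R (G x - G p)) \<le> indicator ?B x *\<^sub>R (e / 2)" for x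
        using d(2)[of x] r by (auto split: split_indicator simp: dist_norm norm_minus_commute)
    qed
    also have "(LINT x:?B|lborel. e / 2) = ?m * (e / 2)"
      using fin unfolding set_lebesgue_integral_def by (subst integral_scaleR_left) (auto intro!: integrable_real_indicator)
    finally have n: "norm ((LINT x:?B|lborel. G x) - ?m *\<^sub>R G p) \<le> ?m * (e / 2)" .
    have "(LINT x:?B|lborel. G x) /\<^sub>R ?m - G p = ((LINT x:?B|lborel. G x) - ?m *\<^sub>R G p) /\<^sub>R ?m"
      using m by (simp add: scaleR_diff_right)
    then have "norm ((LINT x:?B|lborel. G x) /\<^sub>R ?m - G p) = norm ((LINT x:?B|lborel. G x) - ?m *\<^sub>R G p) / ?m"
      using m by (simp add: divide_inverse mult.commute)
    also have "\<dots> \<le> e / 2" using n m by (simp add: pos_divide_le_eq mult.commute)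
    finally show ?thesis using \<open>e > 0\<close> by (simp add: dist_norm)
  qed
  then show "\<forall>\<^sub>F r in at_right 0. dist ((LINT x:ball p r|lborel. G x) /\<^sub>R measure lborel (ball p r)) (G p) < e"
    using d(1) by (auto simp: eventually_at_right_field)
qed

lemma tempered_fun_integrable: "integrable lborel G \<Longrightarrow> tempered_fun G"
  unfolding tempered_fun_def by (intro exI[of _ 0]) simp

lemma tempered_fun_bounded:
  fixes g :: "'a::euclidean_space \<Rightarrow> complex"
  assumes "g \<in> borel_measurable borel" "\<And>x. norm (g x) \<le> B"
  shows "tempered_fun g"
  unfolding tempered_fun_def
proof (intro exI[of _ "Suc DIM('a)"] integrable_bounded_by_decay[where C=B and N="Suc DIM('a)"])
  show "norm (g x /\<^sub>R (1 + norm x) ^ Suc DIM('a)) \<le> B / (1 + norm x) ^ Suc DIM('a)" for x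
  proof -
    have "norm (g x /\<^sub>R (1 + norm x) ^ Suc DIM('a)) = norm (g x) / (1 + norm x) ^ Suc DIM('a)"
      by (simp only: norm_scaleR abs_inverse power_abs abs_of_nonneg add_nonneg_nonneg norm_ge_zero zero_le_one)
         (simp only: divide_inverse mult.commute)
    also have "\<dots> \<le> B / (1 + norm x) ^ Suc DIM('a)"
      by (intro divide_right_mono assms zero_le_power add_nonneg_nonneg) auto
    finally show ?thesis .
  qed
qed (use assms in simp_all)

lemma tempered_fourier_integrable:
  fixes g :: "'a::euclidean_space \<Rightarrow> complex"
  assumes g: "integrable lborel g"
  shows "tempered_fourier g (fourier_L1 g)"
  unfolding tempered_fourier_def
proof (intro conjI allI impI)
  show "tempered_fun g" by (rule tempered_fun_integrable[OF g])
  show "tempered_fun (fourier_L1 g)"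
    using g by (intro tempered_fun_bounded[OF _ norm_fourier_L1_le] borel_measurable_fourier_L1) auto
  show "(LINT x|lborel. g x * fourier_L1 \<phi> x) = (LINT \<xi>|lborel. fourier_L1 g \<xi> * \<phi> \<xi>)" if "schwartz \<phi>" for \<phi>
    by (rule fourier_L1_multiplication_formula[OF g schwartz_integrable[OF that], symmetric])
qed

text \<open>Serves both branches of \<open>fourier\<close>: for integrable \<open>g\<close> the
  function \<open>fourier_L1 g\<close> is itself a representative, and a continuous one, so its
  averages must have the same limit as those of \<open>G\<close>. Hence it need not be decided for
  which \<open>k\<close> a Riesz potential is integrable.\<close>

lemma fourier_eqI:
  fixes g G :: "'a::euclidean_space \<Rightarrow> complex"
  assumes G: "tempered_fourier g G" and cont: "isCont G p"
  shows "fourier g p = G p"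
proof -
  let ?avg = "\<lambda>G r. (LINT x:ball p r|lborel. G x) /\<^sub>R measure lborel (ball p r)"
  have lim: "(?avg G \<longlongrightarrow> G p) (at_right 0)"
    using G by (intro ball_average_tendsto cont) (auto simp: tempered_fourier_def)
  have uniq: "c = G p" if G': "tempered_fourier g G'"
    and l: "(?avg G' \<longlongrightarrow> c) (at_right 0)" for G' c
  proof -
    have "(?avg G \<longlongrightarrow> c) (at_right 0)"
    proof (rule Lim_transform_eventually[OF l])
      show "\<forall>\<^sub>F r in at_right 0. ?avg G' r = ?avg G r"
        using eventually_at_right_less[of 0] by eventually_elim (simp add: tempered_fourier_unique[OF G' G])
    qed
    from tendsto_unique[OF _ this lim] show ?thesis by simp
  qed
  show ?thesis
  proof (cases "integrable lborel g")
    case True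
    have "fourier_L1 g p = G p"
    proof (rule uniq[OF tempered_fourier_integrable[OF True]])
      show "((\<lambda>r. (LINT x:ball p r|lborel. fourier_L1 g x) /\<^sub>R measure lborel (ball p r)) \<longlongrightarrow> fourier_L1 g p) (at_right 0)"
        using tempered_fourier_integrable[OF True] continuous_on_fourier_L1[OF True, of UNIV]
        by (intro ball_average_tendsto) (auto simp: tempered_fourier_def continuous_on_eq_continuous_at)
    qed
    then show ?thesis using True by (simp add: fourier_def)
  next
    case False
    have "(THE c. \<exists>G. tempered_fourier g G \<and>
        (?avg G \<longlongrightarrow> c) (at_right 0)) = G p"
    proof (rule the_equality)
      show "\<exists>G'. tempered_fourier g G' \<and>
        (?avg G' \<longlongrightarrow> G p) (at_right 0)"
        using G lim by blast
    qed (elim exE conjE, rule uniq)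
    then show ?thesis unfolding fourier_def using False by (simp only: if_False)
  qed
qed

lemma fourier_integrable: "integrable lborel g \<Longrightarrow> fourier g = fourier_L1 g"
  by (auto simp: fourier_def fun_eq_iff)

lemma inv_fourier_integrable:
  fixes G :: "'a::euclidean_space \<Rightarrow> complex"
  shows "integrable lborel G \<Longrightarrow> inv_fourier G x = (2 * pi) powi (- int DIM('a)) *\<^sub>R fourier_L1 G (- x)"
  by (simp add: inv_fourier_def fourier_integrable)

lemma fourier_L1_reflect:
  fixes g :: "'a::euclidean_space \<Rightarrow> complex"
  shows "fourier_L1 (\<lambda>x. g (- x)) \<xi> = fourier_L1 g (- \<xi>)"
  unfolding fourier_L1_def
  by (subst (2) integral_lborel_affine[where c="-1" and t=0]) auto

text \<open>In general \<open>inv_fourier G\<close> is merely bounded, so inversion cannot be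
  applied to it. The multiplication formula moves the transform to the test function, where
  inversion for Schwartz functions is available.\<close>

lemma tempered_fourier_inv_fourier:
  fixes G :: "'a::euclidean_space \<Rightarrow> complex"
  assumes G: "integrable lborel G"
  shows "tempered_fourier (inv_fourier G) G"
  unfolding tempered_fourier_def
proof (intro conjI allI impI)
  let ?c = "(2 * pi) powi (- int DIM('a))"
  have inv: "inv_fourier G = (\<lambda>x. ?c *\<^sub>R fourier_L1 G (- x))"
    using inv_fourier_integrable[OF G] by auto
  have [measurable]: "G \<in> borel_measurable borel" using G by auto
  show "tempered_fun G" by (rule tempered_fun_integrable[OF G])
  show "tempered_fun (inv_fourier G)"
  proof (rule tempered_fun_bounded)
    show "inv_fourier G \<in> borel_measurable borel" unfolding inv by measurable
    show "norm (inv_fourier G x) \<le> ?c * (LINT x|lborel. norm (G x))" for x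
      unfolding inv norm_scaleR by (intro mult_mono norm_fourier_L1_le) auto
  qed
  fix \<phi> :: "'a \<Rightarrow> complex" assume \<phi>: "schwartz \<phi>"
  have i: "integrable lborel (\<lambda>x. fourier_L1 \<phi> (- x))"
    using integrable_fourier_L1_schwartz[OF \<phi>] integrable_lborel_affine_iff[of "-1" "fourier_L1 \<phi>" 0] by simp
  have "(LINT x|lborel. inv_fourier G x * fourier_L1 \<phi> x) = (LINT x|lborel. ?c *\<^sub>R (fourier_L1 G (- x) * fourier_L1 \<phi> x))"
    unfolding inv by simp
  also have "\<dots> = ?c *\<^sub>R (LINT x|lborel. fourier_L1 G (- x) * fourier_L1 \<phi> x)" by simp
  also have "(LINT x|lborel. fourier_L1 G (- x) * fourier_L1 \<phi> x) = (LINT x|lborel. fourier_L1 G x * fourier_L1 \<phi> (- x))"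
    by (subst integral_lborel_affine[where c="-1" and t=0]) auto
  also have "\<dots> = (LINT x|lborel. G x * fourier_L1 (\<lambda>x. fourier_L1 \<phi> (- x)) x)"
    by (rule fourier_L1_multiplication_formula[OF G i])
  also have "\<dots> = (LINT x|lborel. (2 * pi) ^ DIM('a) *\<^sub>R (G x * \<phi> x))"
    unfolding fourier_L1_reflect fourier_L1_inversion_schwartz[OF \<phi>]
    by (simp add: scaleR_conv_of_real mult_ac)
  also have "?c *\<^sub>R \<dots> = (?c * (2 * pi) ^ DIM('a)) *\<^sub>R (LINT \<xi>|lborel. G \<xi> * \<phi> \<xi>)"
    unfolding integral_scaleR_right scaleR_scaleR ..
  also have "?c * (2 * pi) ^ DIM('a) = 1"
    unfolding power_int_minus power_int_of_nat by (rule left_inverse) simp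
  finally show "(LINT x|lborel. inv_fourier G x * fourier_L1 \<phi> x) = (LINT \<xi>|lborel. G \<xi> * \<phi> \<xi>)"
    by (simp only: scaleR_one)
qed

text \<open>Continuity at the single point \<open>p\<close> is the form suited to symbols such as
  \<open>norm \<xi> powr (- k)\<close>, which are singular at the origin.\<close>

corollary fourier_inv_fourier:
  fixes G :: "'a::euclidean_space \<Rightarrow> complex"
  assumes "integrable lborel G" "isCont G p"
  shows "fourier (inv_fourier G) p = G p"
  by (rule fourier_eqI[OF tempered_fourier_inv_fourier[OF assms(1)] assms(2)])

section \<open>Orthogonal invariance\<close>

lemma borel_measurable_orthogonal:
  fixes U :: "'a::euclidean_space \<Rightarrow> 'a"
  assumes "orthogonal_transformation U"
  shows "U \<in> borel_measurable borel"
  using orthogonal_transformation_linear[OF assms]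
  by (intro borel_measurable_continuous_onI linear_continuous_on) (simp add: linear_conv_bounded_linear)

text \<open>As in the proof of uniqueness of Haar measure, the double integral of
  \<open>f x * gaussian (U y)\<close> is evaluated in two ways by means of translations; the Gaussian itself is
  invariant under \<open>U\<close>.\<close>

lemma nn_integral_orthogonal:
  fixes U :: "'a::euclidean_space \<Rightarrow> 'a"
  assumes U: "orthogonal_transformation U" and [measurable]: "h \<in> borel_measurable borel"
  shows "(\<integral>\<^sup>+x. h (U x) \<partial>lborel) = (\<integral>\<^sup>+x. h x \<partial>lborel)"
proof -
  interpret U: linear U using U by (rule orthogonal_transformation_linear)
  note [measurable] = borel_measurable_orthogonal[OF U]
  define V where "V = inv U"
  have UV: "U (V x) = x" for x
    using orthogonal_transformation_surj[OF U] by (simp add: V_def surj_f_inv_f)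
  let ?g = "\<lambda>x::'a. ennreal (gaussian x)"
  have gU: "gaussian (U y) = gaussian y" for y using U by (simp add: gaussian_def orthogonal_transformation_norm)
  define I where "I = (\<integral>\<^sup>+x. ?g x \<partial>lborel)"
  have I: "I = ennreal (sqrt (2 * pi) ^ DIM('a))"
    unfolding I_def using integral_gaussian[where 'a='a] integrable_gaussian[where 'a='a]
    by (subst nn_integral_eq_integral) (auto simp: gaussian_pos less_imp_le)
  have "I * (\<integral>\<^sup>+x. h x \<partial>lborel) = (\<integral>\<^sup>+y. (\<integral>\<^sup>+x. ?g (U y) * h x \<partial>lborel) \<partial>lborel)"
    unfolding I_def gU by (subst nn_integral_cmult, simp, subst nn_integral_multc) auto
  also have "\<dots> = (\<integral>\<^sup>+y. (\<integral>\<^sup>+x. ?g (U y) * h (U y + x) \<partial>lborel) \<partial>lborel)"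
  proof (rule nn_integral_cong)
    fix y
    show "(\<integral>\<^sup>+x. ?g (U y) * h x \<partial>lborel) = (\<integral>\<^sup>+x. ?g (U y) * h (U y + x) \<partial>lborel)"
      by (subst nn_integral_lborel_affine[where c=1 and t="U y"]) auto
  qed
  also have "\<dots> = (\<integral>\<^sup>+x. (\<integral>\<^sup>+y. ?g (U y) * h (U y + x) \<partial>lborel) \<partial>lborel)"
    by (rule lborel_pair.Fubini'[symmetric]) simp
  also have "\<dots> = (\<integral>\<^sup>+x. (\<integral>\<^sup>+y. ?g (U y - x) * h (U y) \<partial>lborel) \<partial>lborel)"
  proof (rule nn_integral_cong)
    fix x
    show "(\<integral>\<^sup>+y. ?g (U y) * h (U y + x) \<partial>lborel) = (\<integral>\<^sup>+y. ?g (U y - x) * h (U y) \<partial>lborel)"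
      by (subst nn_integral_lborel_affine[where c=1 and t="- V x"]) (auto simp: U.add U.neg U.diff UV)
  qed
  also have "\<dots> = (\<integral>\<^sup>+y. (\<integral>\<^sup>+x. ?g (U y - x) * h (U y) \<partial>lborel) \<partial>lborel)"
    by (rule lborel_pair.Fubini') simp
  also have "\<dots> = (\<integral>\<^sup>+y. I * h (U y) \<partial>lborel)"
  proof (rule nn_integral_cong)
    fix y
    have "I = (\<integral>\<^sup>+x. ?g (U y - x) \<partial>lborel)"
      unfolding I_def by (subst nn_integral_lborel_affine[where c="-1" and t="U y"]) auto
    then show "(\<integral>\<^sup>+x. ?g (U y - x) * h (U y) \<partial>lborel) = I * h (U y)"
      by (subst nn_integral_multc) auto
  qed
  also have "\<dots> = I * (\<integral>\<^sup>+y. h (U y) \<partial>lborel)" by (rule nn_integral_cmult) simp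
  finally have "I * (\<integral>\<^sup>+x. h x \<partial>lborel) = I * (\<integral>\<^sup>+y. h (U y) \<partial>lborel)" .
  moreover have "I \<noteq> 0" "I \<noteq> \<top>" unfolding I by auto
  ultimately show ?thesis by (simp add: ennreal_mult_cancel_left)
qed

lemma lborel_distr_orthogonal:
  fixes U :: "'a::euclidean_space \<Rightarrow> 'a"
  assumes U: "orthogonal_transformation U"
  shows "distr lborel borel U = lborel"
proof (rule measure_eqI)
  note [measurable] = borel_measurable_orthogonal[OF U]
  fix A assume "A \<in> sets (distr lborel borel U)"
  then have [measurable]: "A \<in> sets borel" by simp
  have "emeasure (distr lborel borel U) A = (\<integral>\<^sup>+x. indicator A x \<partial>distr lborel borel U)" by simp
  also have "\<dots> = (\<integral>\<^sup>+x. indicator A (U x) \<partial>lborel)" by (subst nn_integral_distr) auto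
  also have "\<dots> = (\<integral>\<^sup>+x. indicator A x \<partial>lborel)" by (rule nn_integral_orthogonal[OF U]) simp
  finally show "emeasure (distr lborel borel U) A = emeasure lborel A" by simp
qed simp

lemma fourier_L1_orthogonal:
  fixes g :: "'a::euclidean_space \<Rightarrow> complex" and U :: "'a \<Rightarrow> 'a"
  assumes U: "orthogonal_transformation U" and [measurable]: "g \<in> borel_measurable borel"
  shows "fourier_L1 (\<lambda>x. g (U x)) \<xi> = fourier_L1 g (U \<xi>)"
proof -
  note [measurable] = borel_measurable_orthogonal[OF U]
  have "fourier_L1 g (U \<xi>) = (LINT x|distr lborel borel U. wave x (U \<xi>) * g x)"
    unfolding fourier_L1_def lborel_distr_orthogonal[OF U] ..
  also have "\<dots> = (LINT x|lborel. wave (U x) (U \<xi>) * g (U x))"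
    by (rule integral_distr) auto
  also have "\<dots> = fourier_L1 (\<lambda>x. g (U x)) \<xi>"
    using U unfolding fourier_L1_def orthogonal_transformation_def by simp
  finally show ?thesis by (rule sym)
qed

text \<open>Some orthogonal \<open>U\<close> maps \<open>\<xi>\<close> to \<open>\<eta>\<close>, and
  composition with \<open>U\<close> commutes with the Fourier transform.\<close>

lemma fourier_L1_radial:
  fixes g :: "real^'m \<Rightarrow> complex"
  assumes g: "g \<in> borel_measurable borel" and inv: "\<And>U x. orthogonal_transformation U \<Longrightarrow> g (U x) = g x"
    and norm: "norm \<xi> = norm \<eta>"
  shows "fourier_L1 g \<xi> = fourier_L1 g \<eta>"
proof -
  obtain U where U: "orthogonal_transformation U" "U \<xi> = \<eta>"
    using orthogonal_transformation_exists[OF norm] by blast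
  from fourier_L1_orthogonal[OF U(1) g, of \<xi>] show ?thesis
    by (simp only: inv[OF U(1)] U(2))
qed

section \<open>Functions of two variables\<close>

lemma fourier_L1_pair:
  fixes g :: "'a::euclidean_space \<times> 'b::euclidean_space \<Rightarrow> complex"
  assumes g: "integrable lborel g"
  shows "fourier_L1 g (\<xi>, \<eta>) = fourier_L1 (\<lambda>y. fourier_L1 (\<lambda>x. g (x, y)) \<xi>) \<eta>"
    and "fourier_L1 g (\<xi>, \<eta>) = fourier_L1 (\<lambda>x. fourier_L1 (\<lambda>y. g (x, y)) \<eta>) \<xi>"
proof -
  let ?k = "\<lambda>x y. wave x \<xi> * (wave y \<eta> * g (x, y))"
  have e: "wave z (\<xi>, \<eta>) * g z = (case z of (x, y) \<Rightarrow> ?k x y)" for z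
    by (cases z) (simp add: inner_Pair distrib_left exp_add[symmetric] mult.assoc[symmetric])
  have i: "integrable (lborel \<Otimes>\<^sub>M lborel) (\<lambda>(x, y). ?k x y)"
    using integrable_fourier_kernel[OF g, of "(\<xi>, \<eta>)"] unfolding e lborel_prod .
  have F: "fourier_L1 g (\<xi>, \<eta>) = (LINT z|(lborel \<Otimes>\<^sub>M lborel). (case z of (x, y) \<Rightarrow> ?k x y))"
    unfolding fourier_L1_def e lborel_prod ..
  have "fourier_L1 g (\<xi>, \<eta>) = (LINT y|lborel. LINT x|lborel. ?k x y)"
    unfolding F by (rule lborel_pair.integral_snd[OF i, symmetric])
  also have "\<dots> = (LINT y|lborel. LINT x|lborel. wave y \<eta> * (wave x \<xi> * g (x, y)))"
    by (simp only: mult.left_commute)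
  finally show "fourier_L1 g (\<xi>, \<eta>) = fourier_L1 (\<lambda>y. fourier_L1 (\<lambda>x. g (x, y)) \<xi>) \<eta>"
    unfolding fourier_L1_def integral_mult_right_zero .
  have "fourier_L1 g (\<xi>, \<eta>) = (LINT x|lborel. LINT y|lborel. ?k x y)"
    unfolding F using lborel_pair.integral_fst'[OF i] by simp
  then show "fourier_L1 g (\<xi>, \<eta>) = fourier_L1 (\<lambda>x. fourier_L1 (\<lambda>y. g (x, y)) \<eta>) \<xi>"
    unfolding fourier_L1_def integral_mult_right_zero .
qed

lemma norm_Pair_ge: "norm x \<le> norm (x, y)" "norm y \<le> norm (x, y)"
  using norm_fst_le[of x y] norm_snd_le[of y x] by simp_all

lemma decay_Pair:
  assumes "\<And>z. norm (g z) \<le> C / (1 + norm z) ^ (N + M)" "C > 0"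
  shows "norm (g (x, y)) \<le> C / ((1 + norm x) ^ N * (1 + norm y) ^ M)"
proof -
  have "(1 + norm x) ^ N * (1 + norm y) ^ M \<le> (1 + norm (x, y)) ^ N * (1 + norm (x, y)) ^ M"
    by (intro mult_mono power_mono) (auto simp: norm_Pair_ge)
  also have "\<dots> = (1 + norm (x, y)) ^ (N + M)" by (simp only: power_add)
  finally have "C / (1 + norm (x, y)) ^ (N + M) \<le> C / ((1 + norm x) ^ N * (1 + norm y) ^ M)"
    using assms(2) by (intro divide_left_mono) (auto intro!: mult_pos_pos zero_less_power add_pos_nonneg)
  then show ?thesis using assms(1)[of "(x, y)"] by linarith
qed

text \<open>Here \<open>p\<close> stands for the untransformed variable: decay in it, measured by
  \<open>w p\<close>, survives a partial Fourier transform in the other variable.\<close>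

lemma fourier_L1_uniform_decay:
  fixes g :: "'p \<Rightarrow> 'a::euclidean_space \<Rightarrow> complex"
  assumes C: "C > 0" "\<And>p x. norm (g p x) \<le> C / ((1 + norm x) ^ Suc DIM('a) * w p)"
    and w: "\<And>p. w p > 0" and i: "\<And>p. integrable lborel (g p)"
  shows "\<exists>C>0. \<forall>p \<xi>. norm (fourier_L1 (g p) \<xi>) \<le> C / w p"
proof -
  let ?J = "LINT x|lborel. 1 / (1 + norm (x::'a)) ^ Suc DIM('a)"
  have "norm (fourier_L1 (g p) \<xi>) \<le> (C * ?J + 1) / w p" for p \<xi>
  proof -
    have "norm (fourier_L1 (g p) \<xi>) \<le> (LINT x|lborel. norm (g p x))" by (rule norm_fourier_L1_le)
    also have "\<dots> \<le> (LINT x|lborel. C / w p * (1 / (1 + norm (x::'a)) ^ Suc DIM('a)))"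
      using C(2)[of p]
      by (intro integral_mono integrable_norm i integrable_mult_right integrable_decay)
         (simp_all add: mult.commute del: power_Suc)
    also have "\<dots> = C / w p * ?J" by (rule integral_mult_right_zero)
    also have "\<dots> \<le> (C * ?J + 1) / w p"
      unfolding times_divide_eq_left using w[of p] by (intro divide_right_mono) auto
    finally show ?thesis .
  qed
  moreover have "?J \<ge> 0" by (intro Bochner_Integration.integral_nonneg) auto
  then have "C * ?J + 1 > 0" using C(1) by (intro add_nonneg_pos mult_nonneg_nonneg) auto
  ultimately show ?thesis by blast
qed

lemma integrable_powr_mult:
  fixes g :: "'a::euclidean_space \<Rightarrow> complex"
  assumes [measurable]: "g \<in> borel_measurable borel" and p: "p > - real DIM('a)"
    and g: "\<And>N. \<exists>C>0. \<forall>x. norm (g x) \<le> C / (1 + norm x) ^ N"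
  shows "integrable lborel (\<lambda>x. norm x powr p *\<^sub>R g x)"
proof -
  obtain N :: nat where N: "real N \<ge> p + DIM('a) + 1" using real_arch_simple by blast
  obtain C where C: "C > 0" "\<And>x. norm (g x) \<le> C / (1 + norm x) ^ N" using g by blast
  show ?thesis
  proof (rule Bochner_Integration.integrable_bound)
    show "integrable lborel (\<lambda>x::'a. C * (norm x powr p / (1 + norm x) ^ N))"
      by (intro integrable_mult_right integrable_powr_decay p N)
    show "AE x in lborel. norm (norm x powr p *\<^sub>R g x) \<le> norm (C * (norm x powr p / (1 + norm x) ^ N))"
    proof (rule AE_I2)
      fix x :: 'a
      have "norm (norm x powr p *\<^sub>R g x) \<le> norm x powr p * (C / (1 + norm x) ^ N)"
        using mult_left_mono[OF C(2)[of x], of "norm x powr p"] by simp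
      also have "\<dots> = C * (norm x powr p / (1 + norm x) ^ N)" by simp
      also have "\<dots> \<le> norm (C * (norm x powr p / (1 + norm x) ^ N))"
        unfolding real_norm_def by (rule abs_ge_self)
      finally show "norm (norm x powr p *\<^sub>R g x) \<le> norm (C * (norm x powr p / (1 + norm x) ^ N))" .
    qed
  qed simp
qed

text \<open>Decay of total order \<open>N + M\<close> is split between the variables:
  \<open>N\<close> powers control \<open>norm x powr p\<close> at infinity, and
  \<open>M = DIM('b) + 1\<close> powers make the second factor integrable.\<close>

lemma integrable_powr_mult_Pair:
  fixes g :: "'a::euclidean_space \<times> 'b::euclidean_space \<Rightarrow> complex"
  assumes [measurable]: "g \<in> borel_measurable borel" and p: "p > - real DIM('a)"
    and g: "\<And>N. \<exists>C>0. \<forall>z. norm (g z) \<le> C / (1 + norm z) ^ N"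
  shows "integrable lborel (\<lambda>(x, y). norm x powr p *\<^sub>R g (x, y))"
proof -
  obtain N :: nat where N: "real N \<ge> p + DIM('a) + 1" using real_arch_simple by blast
  define M where "M = Suc DIM('b)"
  obtain C where C: "C > 0" "\<And>z. norm (g z) \<le> C / (1 + norm z) ^ (N + M)" using g by blast
  have [measurable]: "g \<in> borel_measurable (borel \<Otimes>\<^sub>M borel)" using assms(1) by (simp add: borel_prod)
  have "integrable (lborel \<Otimes>\<^sub>M lborel) (\<lambda>(x, y). complex_of_real (norm (x::'a) powr p / (1 + norm x) ^ N) * complex_of_real (1 / (1 + norm (y::'b)) ^ M))"
    by (intro integrable_tensor integrable_of_real integrable_powr_decay integrable_decay p N) (simp add: M_def)
  then have i: "integrable lborel (\<lambda>(x, y). complex_of_real C * (complex_of_real (norm (x::'a) powr p / (1 + norm x) ^ N) * complex_of_real (1 / (1 + norm (y::'b)) ^ M)))"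
    unfolding lborel_prod case_prod_unfold by (rule integrable_mult_right)
  show ?thesis
  proof (rule Bochner_Integration.integrable_bound[OF i])
    show "(\<lambda>(x, y). norm x powr p *\<^sub>R g (x, y)) \<in> borel_measurable lborel"
      by (simp add: case_prod_unfold borel_prod[symmetric])
    show "AE z in lborel. norm (case z of (x, y) \<Rightarrow> norm x powr p *\<^sub>R g (x, y))
      \<le> norm (case z of (x, y) \<Rightarrow> complex_of_real C * (complex_of_real (norm (x::'a) powr p / (1 + norm x) ^ N) * complex_of_real (1 / (1 + norm (y::'b)) ^ M)))"
    proof (rule AE_I2, clarify)
      fix x :: 'a and y :: 'b
      have "norm (norm x powr p *\<^sub>R g (x, y)) \<le> norm x powr p * (C / ((1 + norm x) ^ N * (1 + norm y) ^ M))"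
        using mult_left_mono[OF decay_Pair[OF C(2) C(1), of x y], of "norm x powr p"] by simp
      also have "\<dots> = C * ((norm x powr p / (1 + norm x) ^ N) * (1 / (1 + norm y) ^ M))" by simp
      also have "\<dots> = norm (complex_of_real C * (complex_of_real (norm x powr p / (1 + norm x) ^ N) * complex_of_real (1 / (1 + norm y) ^ M)))"
        unfolding of_real_mult[symmetric] norm_of_real using C(1) by (intro abs_of_nonneg[symmetric] mult_nonneg_nonneg divide_nonneg_nonneg) auto
      finally show "norm (norm x powr p *\<^sub>R g (x, y)) \<le> norm (complex_of_real C * (complex_of_real (norm x powr p / (1 + norm x) ^ N) * complex_of_real (1 / (1 + norm y) ^ M)))" .
    qed
  qed
qed

section \<open>The first identity\<close>

locale radial_schwartz =
  fixes f :: "(real^'m) \<times> (real^'m) \<Rightarrow> complex" and a k :: real and b :: ereal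
  assumes radial: "f \<in> schwartz_radial" and k: "k < real CARD('m)" and a: "0 \<le> a"
begin

definition F :: "(real^'m) \<times> (real^'m) \<Rightarrow> complex" where
  "F = fourier_L1 f"

definition F1 :: "real^'m \<Rightarrow> real^'m \<Rightarrow> complex" where
  "F1 \<xi> y = fourier_L1 (\<lambda>x. f (x, y)) \<xi>"

text \<open>The cut-off of \<open>proj\<close>, while \<open>W\<close> is that of
  \<open>cone_lim\<close>. The two correspond under \<open>\<eta> = norm \<xi> *\<^sub>R w\<close>
  with \<open>\<xi> \<noteq> 0\<close>, see \<open>K_scale\<close>.\<close>

definition K :: "real^'m \<Rightarrow> real^'m \<Rightarrow> complex" where
  "K \<xi> \<eta> = indicator {\<eta>. a * norm \<xi> < norm \<eta> \<and> ereal (norm \<eta>) < b * ereal (norm \<xi>)} \<eta>"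

definition W :: "real^'m \<Rightarrow> complex" where
  "W v = indicator {v. a < norm v \<and> ereal (norm v) < b} v"

text \<open>\<open>G\<close> is the Fourier transform of \<open>P_(a,b) I_1^k f\<close>.\<close>

definition G :: "real^'m \<Rightarrow> real^'m \<Rightarrow> complex" where
  "G \<xi> \<eta> = K \<xi> \<eta> * (norm \<xi> powr (- k) *\<^sub>R F (\<xi>, \<eta>))"

lemma schwartz: "schwartz f"
  using radial by (simp add: schwartz_radial_def)

lemma f_orthogonal:
  assumes "orthogonal_transformation U"
  shows "f (x, U y) = f (x, y)"
proof -
  have "\<forall>U. orthogonal_transformation U \<longrightarrow> (\<forall>x y. f (x, y) = f (x, U y))"
    using radial unfolding schwartz_radial_def by blast
  from this[rule_format, OF assms, of x y] show ?thesis by (rule sym)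
qed

section \<open>Decay and partial transforms of \<open>f\<close>\<close>

lemma borel_measurable_f [measurable]: "f \<in> borel_measurable (borel \<Otimes>\<^sub>M borel)"
  unfolding borel_prod by (rule borel_measurable_schwartz[OF schwartz])

lemma borel_measurable_F [measurable]: "F \<in> borel_measurable (borel \<Otimes>\<^sub>M borel)"
  unfolding borel_prod F_def by (rule borel_measurable_fourier_L1[OF borel_measurable_schwartz[OF schwartz]])

lemma integrable_f: "integrable lborel f"
  by (rule schwartz_integrable[OF schwartz])

lemma f_decay: "\<exists>C>0. \<forall>x y. norm (f (x, y)) \<le> C / ((1 + norm x) ^ N * (1 + norm y) ^ M)"
  using schwartz_bound[OF schwartz, of "N + M"] decay_Pair[of f _ N M] by blast

lemma F_decay: "\<exists>C>0. \<forall>\<xi> \<eta>. norm (F (\<xi>, \<eta>)) \<le> C / ((1 + norm \<xi>) ^ N * (1 + norm \<eta>) ^ M)"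
  using fourier_L1_decay[OF schwartz, of "N + M"] decay_Pair[of F _ N M] unfolding F_def by blast

lemma F_cont: "continuous_on A F"
  unfolding F_def by (rule continuous_on_fourier_L1[OF integrable_f])

lemma integrable_section: "integrable lborel (\<lambda>x. f (x, y))"
proof -
  obtain C where "C > 0" "\<And>x y. norm (f (x, y)) \<le> C / ((1 + norm x) ^ Suc DIM(real^'m) * (1 + norm y) ^ 0)"
    using f_decay by blast
  then show ?thesis
    by (intro integrable_bounded_by_decay[where C=C and N="Suc DIM(real^'m)"]) auto
qed

lemma F1_decay_snd: "\<exists>C>0. \<forall>\<xi> y. norm (F1 \<xi> y) \<le> C / (1 + norm y) ^ M"
proof -
  obtain C where "C > 0" "\<And>x y. norm (f (x, y)) \<le> C / ((1 + norm x) ^ Suc DIM(real^'m) * (1 + norm y) ^ M)"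
    using f_decay by blast
  then show ?thesis
    unfolding F1_def using fourier_L1_uniform_decay[of C "\<lambda>y x. f (x, y)" "\<lambda>y. (1 + norm y) ^ M"] integrable_section
    by (simp add: add_pos_nonneg) blast
qed

lemma F1_cont: "continuous_on A (F1 \<xi>)"
proof -
  let ?N = "Suc DIM(real^'m)"
  obtain C where C: "C > 0" "\<And>x y. norm (f (x, y)) \<le> C / ((1 + norm x) ^ ?N * (1 + norm y) ^ 0)"
    using f_decay by blast
  have "isCont (F1 \<xi>) y" for y
    unfolding continuous_at_sequentially o_def
  proof (intro allI impI)
    fix u :: "nat \<Rightarrow> real^'m" assume u: "u \<longlonglongrightarrow> y"
    show "(\<lambda>n. F1 \<xi> (u n)) \<longlonglongrightarrow> F1 \<xi> y"
      unfolding F1_def fourier_L1_def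
    proof (rule integral_dominated_convergence[where w="\<lambda>x::real^'m. C * (1 / (1 + norm x) ^ ?N)"])
      show "AE x in lborel. (\<lambda>n. wave x \<xi> * f (x, u n)) \<longlonglongrightarrow> wave x \<xi> * f (x, y)"
      proof (rule AE_I2)
        fix x
        have "(\<lambda>n. f (x, u n)) \<longlonglongrightarrow> f (x, y)"
          using schwartz_continuous[OF schwartz, of UNIV] u
          by (intro isCont_tendsto_compose[where g=f] tendsto_intros) (auto simp: continuous_on_eq_continuous_at)
        then show "(\<lambda>n. wave x \<xi> * f (x, u n)) \<longlonglongrightarrow> wave x \<xi> * f (x, y)"
          by (intro tendsto_intros)
      qed
      show "integrable lborel (\<lambda>x::real^'m. C * (1 / (1 + norm x) ^ ?N))"
        by (intro integrable_mult_right integrable_decay) simp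
      show "AE x in lborel. norm (wave x \<xi> * f (x, u n)) \<le> C * (1 / (1 + norm x) ^ ?N)" for n
        using C(2)[of _ "u n"] by (simp add: norm_mult del: power_Suc)
    qed measurable
  qed
  then show ?thesis by (simp add: continuous_at_imp_continuous_on)
qed

lemma borel_measurable_F1_snd [measurable]: "F1 \<xi> \<in> borel_measurable borel"
  by (intro borel_measurable_continuous_onI F1_cont)

lemma borel_measurable_F1_fst [measurable]: "(\<lambda>\<xi>. F1 \<xi> y) \<in> borel_measurable borel"
  unfolding F1_def by measurable

lemma integrable_F1: "integrable lborel (F1 \<xi>)"
proof -
  obtain C where "C > 0" "\<And>\<xi> y. norm (F1 \<xi> y) \<le> C / (1 + norm y) ^ Suc DIM(real^'m)"
    using F1_decay_snd by blast
  then show ?thesis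
    by (intro integrable_bounded_by_decay[where C=C and N="Suc DIM(real^'m)"]) auto
qed

lemma F_eq: "F (\<xi>, \<eta>) = fourier_L1 (F1 \<xi>) \<eta>"
  unfolding F_def F1_def[abs_def] by (rule fourier_L1_pair(1)[OF integrable_f])

lemma integrable_F_section: "integrable lborel (\<lambda>\<eta>. F (\<xi>, \<eta>))"
proof -
  obtain C where "C > 0" "\<And>\<xi> \<eta>. norm (F (\<xi>, \<eta>)) \<le> C / ((1 + norm \<xi>) ^ 0 * (1 + norm \<eta>) ^ Suc DIM(real^'m))"
    using F_decay by blast
  then show ?thesis
    by (intro integrable_bounded_by_decay[where C=C and N="Suc DIM(real^'m)"]) auto
qed

lemma F_inversion: "fourier_L1 (\<lambda>\<eta>. F (\<xi>, \<eta>)) (- y) = complex_of_real ((2 * pi) ^ CARD('m)) * F1 \<xi> y"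
proof -
  obtain C where "C > 0" "\<And>\<xi> y. norm (F1 \<xi> y) \<le> C / (1 + norm y) ^ 0"
    using F1_decay_snd by blast
  then have "fourier_L1 (fourier_L1 (F1 \<xi>)) (- y) = complex_of_real ((2 * pi) ^ DIM(real^'m)) * F1 \<xi> y"
    using integrable_F_section[of \<xi>]
    by (intro fourier_L1_inversion[where B=C] integrable_F1 F1_cont) (auto simp: F_eq)
  then show ?thesis by (simp add: F_eq)
qed

text \<open>The decay is inherited from \<open>F\<close> by inverting in the second variable, so no
  derivatives of the sections of \<open>f\<close> are involved. The constant
  \<open>(2 * pi) ^ CARD('m)\<close> may be dropped because it is at least 1.\<close>

lemma F1_decay_fst: "\<exists>C>0. \<forall>\<xi>. norm (F1 \<xi> y) \<le> C / (1 + norm \<xi>) ^ N"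
proof -
  obtain C where C: "C > 0" "\<And>\<xi> \<eta>. norm (F (\<xi>, \<eta>)) \<le> C / ((1 + norm \<xi>) ^ N * (1 + norm \<eta>) ^ Suc DIM(real^'m))"
    using F_decay by blast
  then obtain C' where C': "C' > 0" "\<And>\<xi> z. norm (fourier_L1 (\<lambda>\<eta>. F (\<xi>, \<eta>)) z) \<le> C' / (1 + norm \<xi>) ^ N"
    using fourier_L1_uniform_decay[of C "\<lambda>\<xi> \<eta>. F (\<xi>, \<eta>)" "\<lambda>\<xi>. (1 + norm \<xi>) ^ N"] integrable_F_section
    by (simp add: add_pos_nonneg mult.commute) blast
  have "norm (F1 \<xi> y) \<le> C' / (1 + norm \<xi>) ^ N" for \<xi>
  proof -
    have "1 * norm (F1 \<xi> y) \<le> norm (complex_of_real ((2 * pi) ^ CARD('m))) * norm (F1 \<xi> y)"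
      unfolding norm_of_real
    proof (rule mult_right_mono)
      have "1 \<le> (2 * pi) ^ CARD('m)" using pi_gt3 by (intro one_le_power) linarith
      then show "1 \<le> \<bar>(2 * pi) ^ CARD('m)\<bar>" by linarith
    qed simp
    also have "\<dots> \<le> C' / (1 + norm \<xi>) ^ N"
      using C'(2)[of \<xi> "- y"] unfolding F_inversion norm_mult .
    finally show ?thesis by simp
  qed
  then show ?thesis using C'(1) by blast
qed

section \<open>The projection of the Riesz potential\<close>

lemma integrable_weighted_F: "integrable lborel (\<lambda>(\<xi>, \<eta>). norm \<xi> powr (- k) *\<^sub>R F (\<xi>, \<eta>))"
proof (rule integrable_powr_mult_Pair)
  show "F \<in> borel_measurable borel" using borel_measurable_F by (simp add: borel_prod)
  show "\<exists>C>0. \<forall>z. norm (F z) \<le> C / (1 + norm z) ^ N" for N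
    unfolding F_def by (rule fourier_L1_decay[OF schwartz])
qed (use k in simp)

lemma integrable_weighted_F1: "integrable lborel (\<lambda>\<xi>. norm \<xi> powr (- k) *\<^sub>R F1 \<xi> y)"
  using k F1_decay_fst by (intro integrable_powr_mult) auto

lemma riesz1_f: "riesz1 k f (x, y) = inv_fourier (\<lambda>\<xi>. norm \<xi> powr (- k) *\<^sub>R F1 \<xi> y) x"
  unfolding riesz1_def inv_fourier1_def fourier1_def F1_def
  by (simp add: fourier_integrable[OF integrable_section])

lemma two_pi_powi: "(2 * pi) powi (- int (n + m)) *\<^sub>R (complex_of_real ((2 * pi) ^ n) * z) = (2 * pi) powi (- int m) *\<^sub>R z"
proof -
  have "(2 * pi) powi (- int (n + m)) * (2 * pi) ^ n = (2 * pi) powi (- int m)"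
    unfolding power_int_minus power_int_of_nat power_add
    by (subst inverse_mult_distrib, subst mult.commute, subst mult.assoc[symmetric], subst right_inverse) simp_all
  then show ?thesis by (simp add: scaleR_conv_of_real mult.assoc[symmetric] of_real_mult[symmetric] del: of_real_mult)
qed

text \<open>The definition of \<open>riesz1\<close> inverts in the first variable only. Inverting
  \<open>F\<close> in the second variable as well presents the potential as a full inverse transform
  of an integrable function, which is what \<open>fourier_inv_fourier\<close> needs.\<close>

lemma riesz1_f_inv_fourier: "riesz1 k f = inv_fourier (\<lambda>(\<xi>, \<eta>). norm \<xi> powr (- k) *\<^sub>R F (\<xi>, \<eta>))"
proof (rule ext, clarify)
  fix x y
  let ?G = "\<lambda>(\<xi>, \<eta>). norm \<xi> powr (- k) *\<^sub>R F (\<xi>, \<eta>)"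
  let ?g = "\<lambda>\<xi> \<eta>. norm \<xi> powr (- k) *\<^sub>R F (\<xi>, \<eta>)"
  let ?C = "complex_of_real ((2 * pi) ^ CARD('m))"
  have "fourier_L1 ?G (- x, - y)
     = fourier_L1 (\<lambda>\<xi>. fourier_L1 (?g \<xi>) (- y)) (- x)"
    by (subst fourier_L1_pair(2)[OF integrable_weighted_F]) simp
  also have "(\<lambda>\<xi>. fourier_L1 (?g \<xi>) (- y))
     = (\<lambda>\<xi>. ?C * (norm \<xi> powr (- k) *\<^sub>R F1 \<xi> y))"
  proof
    fix \<xi>
    have "fourier_L1 (?g \<xi>) (- y) = norm \<xi> powr (- k) *\<^sub>R fourier_L1 (\<lambda>\<eta>. F (\<xi>, \<eta>)) (- y)"
      unfolding fourier_L1_def by simp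
    then show "fourier_L1 (?g \<xi>) (- y) = ?C * (norm \<xi> powr (- k) *\<^sub>R F1 \<xi> y)"
      unfolding F_inversion by (simp add: scaleR_conv_of_real)
  qed
  also have "fourier_L1 (\<lambda>\<xi>. ?C * (norm \<xi> powr (- k) *\<^sub>R F1 \<xi> y)) (- x)
     = ?C * fourier_L1 (\<lambda>\<xi>. norm \<xi> powr (- k) *\<^sub>R F1 \<xi> y) (- x)"
    unfolding fourier_L1_def mult.left_commute[of _ "?C"] by (rule integral_mult_right_zero)
  finally have "fourier_L1 ?G (- x, - y)
     = ?C * fourier_L1 (\<lambda>\<xi>. norm \<xi> powr (- k) *\<^sub>R F1 \<xi> y) (- x)" .
  then show "riesz1 k f (x, y) = inv_fourier ?G (x, y)"
    unfolding riesz1_f inv_fourier_integrable[OF integrable_weighted_F] inv_fourier_integrable[OF integrable_weighted_F1]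
    using two_pi_powi[of "CARD('m)" "CARD('m)"] by simp
qed

lemma fourier_riesz1_f:
  assumes "\<xi> \<noteq> 0"
  shows "fourier (riesz1 k f) (\<xi>, \<eta>) = norm \<xi> powr (- k) *\<^sub>R F (\<xi>, \<eta>)"
proof -
  have "isCont F p" for p using F_cont[of UNIV] continuous_on_eq_continuous_at[OF open_UNIV, of F] by blast
  then have "isCont (\<lambda>z. norm (fst z) powr (- k) *\<^sub>R F z) (\<xi>, \<eta>)"
    using assms by (intro continuous_intros) auto
  then have "isCont (\<lambda>(\<xi>, \<eta>). norm \<xi> powr (- k) *\<^sub>R F (\<xi>, \<eta>)) (\<xi>, \<eta>)"
    by (simp add: case_prod_unfold)
  from fourier_inv_fourier[OF integrable_weighted_F this] show ?thesis
    unfolding riesz1_f_inv_fourier by simp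
qed

text \<open>As \<open>\<infinity> * 0 = 0\<close> in \<open>ereal\<close>, the cut-off vanishes at \<open>\<xi> = 0\<close> also for \<open>b = \<infinity>\<close>, so
  that the value of the Fourier transform at the singularity of \<open>|\<xi>|^(-k)\<close> does not matter.\<close>

lemma K_0: "K 0 \<eta> = 0"
proof -
  have "b * ereal 0 = 0" by (cases b) (auto simp: zero_ereal_def)
  then show ?thesis by (simp add: K_def zero_ereal_def[symmetric])
qed

lemma proj_riesz1_f: "proj a b (riesz1 k f) = inv_fourier (\<lambda>(\<xi>, \<eta>). G \<xi> \<eta>)"
proof -
  have "indicator {\<eta>. a * norm \<xi> < norm \<eta> \<and> ereal (norm \<eta>) < b * ereal (norm \<xi>)} \<eta> * fourier (riesz1 k f) (\<xi>, \<eta>) = G \<xi> \<eta>" for \<xi> \<eta>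
    using fourier_riesz1_f[of \<xi> \<eta>] K_0[of \<eta>] by (cases "\<xi> = 0") (auto simp: G_def K_def)
  then show ?thesis unfolding proj_def by simp
qed

lemma borel_measurable_W [measurable]: "W \<in> borel_measurable borel"
  unfolding W_def[abs_def] by measurable

lemma borel_measurable_K [measurable]: "(\<lambda>(\<xi>, \<eta>). K \<xi> \<eta>) \<in> borel_measurable (borel \<Otimes>\<^sub>M borel)"
  unfolding K_def[abs_def] by measurable

lemma norm_K_le: "norm (K \<xi> \<eta>) \<le> 1" and norm_W_le: "norm (W v) \<le> 1"
  by (auto simp: K_def W_def split: split_indicator)

lemma integrable_G: "integrable lborel (\<lambda>(\<xi>, \<eta>). G \<xi> \<eta>)"
proof (rule Bochner_Integration.integrable_bound[OF integrable_weighted_F])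
  show "(\<lambda>(\<xi>, \<eta>). G \<xi> \<eta>) \<in> borel_measurable lborel"
    using borel_measurable_K unfolding G_def case_prod_unfold by (simp add: borel_prod[symmetric])
  show "AE z in lborel. norm (case z of (\<xi>, \<eta>) \<Rightarrow> G \<xi> \<eta>) \<le> norm (case z of (\<xi>, \<eta>) \<Rightarrow> norm \<xi> powr (- k) *\<^sub>R F (\<xi>, \<eta>))"
  proof (rule AE_I2, clarify)
    fix \<xi> \<eta>
    show "norm (G \<xi> \<eta>) \<le> norm (norm \<xi> powr (- k) *\<^sub>R F (\<xi>, \<eta>))"
      unfolding G_def norm_mult using mult_right_mono[OF norm_K_le norm_ge_zero] by (simp only: mult_1)
  qed
qed

lemma F_radial:
  assumes "norm \<eta> = norm \<eta>'"
  shows "F (\<xi>, \<eta>) = F (\<xi>, \<eta>')"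
  unfolding F_eq
proof (rule fourier_L1_radial[OF _ _ assms])
  show "F1 \<xi> (U y) = F1 \<xi> y" if "orthogonal_transformation U" for U y
    unfolding F1_def by (simp add: f_orthogonal[OF that])
qed simp

lemma G_radial: "norm \<eta> = norm \<eta>' \<Longrightarrow> G \<xi> \<eta> = G \<xi> \<eta>'"
  unfolding G_def K_def by (simp add: F_radial[of \<eta> \<eta>'] indicator_def)

end

section \<open>The limited cone transform and its Riesz potential\<close>

context radial_schwartz
begin

text \<open>By radiality of \<open>F\<close> in the second variable, \<open>Q\<close> is the Fourier transform of \<open>I_1^(k+1-n) C_(a,b) f\<close> in the first
  variable.\<close>

definition Q :: "real^'m \<Rightarrow> real^'m \<Rightarrow> complex" where
  "Q \<xi> w = norm \<xi> powr (real CARD('m) - k) *\<^sub>R (W w * F (\<xi>, norm \<xi> *\<^sub>R w))"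

text \<open>By \<open>riesz1_cone_lim\<close> this is \<open>I_1^(k+1-n) C_(a,b) f\<close> at
  \<open>(x, v)\<close>; by \<open>h_norm\<close> it depends on \<open>v\<close> only through its
  norm.\<close>

definition h :: "real^'m \<Rightarrow> real^'m \<Rightarrow> complex" where
  "h x v = inv_fourier (\<lambda>\<xi>. Q \<xi> v) x"

text \<open>The \<open>N\<close> additional powers of decay in \<open>y\<close> pay for replacing
  the weight at \<open>u + s *\<^sub>R y\<close> by the weight at \<open>u\<close>.\<close>

lemma f_shear_decay:
  assumes s: "s \<ge> 0"
  shows "\<exists>C>0. \<forall>u y. norm (f (u + s *\<^sub>R y, y)) \<le> C / ((1 + norm u) ^ N * (1 + norm y) ^ M)"
proof -
  obtain C where C: "C > 0" "\<And>x y. norm (f (x, y)) \<le> C / ((1 + norm x) ^ N * (1 + norm y) ^ (N + M))"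
    using f_decay by blast
  have "norm (f (u + s *\<^sub>R y, y)) \<le> (C * (1 + s) ^ N) / ((1 + norm u) ^ N * (1 + norm y) ^ M)" for u y
  proof -
    let ?X = "1 + norm (u + s *\<^sub>R y)" and ?Y = "1 + norm y" and ?U = "1 + norm u"
    have pos: "0 < ?X" "0 < ?Y" "0 < ?U" by (auto intro!: add_pos_nonneg)
    have "?U \<le> ?X * (1 + s) * ?Y"
      using one_plus_norm_le[OF s, of "u + s *\<^sub>R y" "- y"] by simp
    then have "?U ^ N \<le> (?X * (1 + s) * ?Y) ^ N" using pos by (intro power_mono) auto
    then have "?U ^ N * ?Y ^ M \<le> (?X * (1 + s) * ?Y) ^ N * ?Y ^ M"
      using pos by (intro mult_right_mono) auto
    also have "\<dots> = (1 + s) ^ N * (?X ^ N * ?Y ^ (N + M))"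
      by (simp only: power_mult_distrib power_add mult_ac)
    finally have 1: "?U ^ N * ?Y ^ M \<le> (1 + s) ^ N * (?X ^ N * ?Y ^ (N + M))" .
    have p1: "?X ^ N * ?Y ^ (N + M) > 0" and p2: "?U ^ N * ?Y ^ M > 0" using pos by auto
    have "norm (f (u + s *\<^sub>R y, y)) \<le> C / (?X ^ N * ?Y ^ (N + M))" by (rule C)
    also have "\<dots> \<le> (C * (1 + s) ^ N) / (?U ^ N * ?Y ^ M)"
      using mult_left_mono[OF 1, of C] C(1)
      by (subst pos_divide_le_eq[OF p1], subst times_divide_eq_left, subst pos_le_divide_eq[OF p2])
         (simp only: mult.assoc less_imp_le)
    finally show ?thesis .
  qed
  moreover have "C * (1 + s) ^ N > 0" using C(1) s by simp
  ultimately show ?thesis by blast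
qed

lemma integrable_shear:
  assumes s: "s \<ge> 0"
  shows "integrable (lborel \<Otimes>\<^sub>M lborel) (\<lambda>(u, y). f (u + s *\<^sub>R y, y))"
proof -
  let ?N = "Suc DIM(real^'m)"
  obtain C where C: "C > 0" "\<And>u y. norm (f (u + s *\<^sub>R y, y)) \<le> C / ((1 + norm u) ^ ?N * (1 + norm y) ^ ?N)"
    using f_shear_decay[OF s] by blast
  have i: "integrable (lborel \<Otimes>\<^sub>M lborel) (\<lambda>(u, y). complex_of_real (C * (1 / (1 + norm (u::real^'m)) ^ ?N)) * complex_of_real (1 / (1 + norm (y::real^'m)) ^ ?N))"
    by (intro integrable_tensor integrable_of_real integrable_mult_right integrable_decay) auto
  show ?thesis
  proof (rule Bochner_Integration.integrable_bound[OF i])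
    show "AE z in lborel \<Otimes>\<^sub>M lborel. norm (case z of (u, y) \<Rightarrow> f (u + s *\<^sub>R y, y))
      \<le> norm (case z of (u, y) \<Rightarrow> complex_of_real (C * (1 / (1 + norm (u::real^'m)) ^ ?N)) * complex_of_real (1 / (1 + norm (y::real^'m)) ^ ?N))"
    proof (rule AE_I2, clarify)
      fix u y :: "real^'m"
      have "norm (f (u + s *\<^sub>R y, y)) \<le> (C * (1 / (1 + norm u) ^ ?N)) * (1 / (1 + norm y) ^ ?N)"
        using C(2)[of u y] by simp
      also have "\<dots> = norm (complex_of_real (C * (1 / (1 + norm u) ^ ?N)) * complex_of_real (1 / (1 + norm y) ^ ?N))"
        unfolding of_real_mult[symmetric] norm_of_real
        using C(1) by (intro abs_of_nonneg[symmetric] mult_nonneg_nonneg divide_nonneg_nonneg zero_le_power add_nonneg_nonneg) auto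
      finally show "norm (f (u + s *\<^sub>R y, y)) \<le> norm (complex_of_real (C * (1 / (1 + norm u) ^ ?N)) * complex_of_real (1 / (1 + norm y) ^ ?N))" .
    qed
  qed (simp add: case_prod_unfold)
qed

lemma integrable_shear_section:
  assumes s: "s \<ge> 0"
  shows "integrable lborel (\<lambda>y. f (u + s *\<^sub>R y, y))"
proof -
  obtain C where "C > 0" "\<And>u y. norm (f (u + s *\<^sub>R y, y)) \<le> C / ((1 + norm u) ^ 0 * (1 + norm y) ^ Suc DIM(real^'m))"
    using f_shear_decay[OF s] by blast
  then show ?thesis
    by (intro integrable_bounded_by_decay[where C=C and N="Suc DIM(real^'m)"]) auto
qed

lemma integrable_cone_transform: "integrable lborel (\<lambda>u. cone_transform f (u, v))"
  using lborel_pair.integrable_fst'[OF integrable_shear[of "norm v"]] by (simp add: cone_transform_def)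

lemma fourier_cone_transform: "fourier_L1 (\<lambda>u. cone_transform f (u, v)) \<xi> = F (\<xi>, norm v *\<^sub>R \<xi>)"
proof -
  let ?s = "norm v"
  have i: "integrable lborel (\<lambda>(u, y). f (u + ?s *\<^sub>R y, y))"
    using integrable_shear[of ?s] by (simp add: lborel_prod)
  \<comment> \<open>Read as a transform at frequency 0, the integral over \<open>y\<close> can be
    exchanged with the transform in \<open>u\<close> by the two halves of
    \<open>fourier_L1_pair\<close>.\<close>
  have "fourier_L1 (\<lambda>u. cone_transform f (u, v)) \<xi> = fourier_L1 (\<lambda>u. fourier_L1 (\<lambda>y. f (u + ?s *\<^sub>R y, y)) 0) \<xi>"
    by (simp add: cone_transform_def fourier_L1_def)
  also have "\<dots> = fourier_L1 (\<lambda>(u, y). f (u + ?s *\<^sub>R y, y)) (\<xi>, 0)"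
    by (subst fourier_L1_pair(2)[OF i]) simp
  also have "\<dots> = fourier_L1 (\<lambda>y. fourier_L1 (\<lambda>u. f (u + ?s *\<^sub>R y, y)) \<xi>) 0"
    by (subst fourier_L1_pair(1)[OF i]) simp
  also have "\<dots> = fourier_L1 (\<lambda>y. exp (\<i> * complex_of_real ((?s *\<^sub>R y) \<bullet> \<xi>)) * F1 \<xi> y) 0"
    unfolding F1_def fourier_L1_translate[of "\<lambda>u. f (u, _)"] ..
  \<comment> \<open>The phase produced by the translation is the Fourier kernel in \<open>y\<close>
    at the frequency \<open>- (?s *\<^sub>R \<xi>)\<close>.\<close>
  also have "\<dots> = F (\<xi>, - (?s *\<^sub>R \<xi>))"
    unfolding F_eq by (simp add: fourier_L1_def)
  also have "\<dots> = F (\<xi>, ?s *\<^sub>R \<xi>)" by (rule F_radial) simp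
  finally show ?thesis .
qed

lemma fourier1_cone_lim: "fourier1 (cone_lim a b f) (\<xi>, v) = W v * F (\<xi>, norm v *\<^sub>R \<xi>)"
proof -
  have "fourier1 (cone_lim a b f) (\<xi>, v) = fourier (\<lambda>u. W v * cone_transform f (u, v)) \<xi>"
    by (simp add: fourier1_def cone_lim_def W_def)
  also have "\<dots> = fourier_L1 (\<lambda>u. W v * cone_transform f (u, v)) \<xi>"
    by (subst fourier_integrable) (auto intro: integrable_cone_transform)
  also have "\<dots> = W v * fourier_L1 (\<lambda>u. cone_transform f (u, v)) \<xi>"
    unfolding fourier_L1_def mult.left_commute[of _ "W v"] by (rule integral_mult_right_zero)
  finally show ?thesis by (simp only: fourier_cone_transform)
qed

lemma riesz1_cone_lim: "riesz1 (k - real CARD('m)) (cone_lim a b f) (x, v) = h x v"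
proof -
  have "F (\<xi>, norm v *\<^sub>R \<xi>) = F (\<xi>, norm \<xi> *\<^sub>R v)" for \<xi>
    by (rule F_radial) simp
  then show ?thesis
    by (simp add: riesz1_def inv_fourier1_def fourier1_cone_lim h_def Q_def)
qed

lemma borel_measurable_Q [measurable]: "(\<lambda>(\<xi>, w). Q \<xi> w) \<in> borel_measurable (borel \<Otimes>\<^sub>M borel)"
  unfolding Q_def case_prod_unfold by measurable

lemma integrable_Q_fst: "integrable lborel (\<lambda>\<xi>. Q \<xi> v)"
  unfolding Q_def
proof (rule integrable_powr_mult)
  fix N
  obtain C where C: "C > 0" "\<And>\<xi> \<eta>. norm (F (\<xi>, \<eta>)) \<le> C / ((1 + norm \<xi>) ^ N * (1 + norm \<eta>) ^ 0)"
    using F_decay by blast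
  have "norm (W v * F (\<xi>, norm \<xi> *\<^sub>R v)) \<le> C / (1 + norm \<xi>) ^ N" for \<xi>
    using mult_mono[OF norm_W_le[of v] C(2)[of \<xi> "norm \<xi> *\<^sub>R v"]] by (simp add: norm_mult)
  then show "\<exists>C>0. \<forall>\<xi>. norm (W v * F (\<xi>, norm \<xi> *\<^sub>R v)) \<le> C / (1 + norm \<xi>) ^ N"
    using C(1) by blast
qed (use k in simp_all)

lemma h_eq: "h x v = (2 * pi) powi (- int CARD('m)) *\<^sub>R fourier_L1 (\<lambda>\<xi>. Q \<xi> v) (- x)"
  unfolding h_def inv_fourier_integrable[OF integrable_Q_fst] by simp

lemma h_norm: "norm v = norm v' \<Longrightarrow> h x v = h x v'"
proof -
  assume n: "norm v = norm v'"
  have "F (\<xi>, norm \<xi> *\<^sub>R v) = F (\<xi>, norm \<xi> *\<^sub>R v')" for \<xi>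
    by (rule F_radial) (simp add: n)
  then show "h x v = h x v'" unfolding h_def Q_def W_def by (simp add: n indicator_def)
qed

lemma K_scale: "\<xi> \<noteq> 0 \<Longrightarrow> K \<xi> (norm \<xi> *\<^sub>R w) = W w"
  unfolding K_def W_def by (cases b) (auto simp: indicator_def mult.commute[of _ "norm \<xi>"])

lemma G_0: "G 0 \<eta> = 0"
  by (simp add: G_def K_0)

text \<open>This explains the order \<open>k + 1 - n\<close> of the second Riesz potential: its
  symbol is \<open>norm \<xi> powr (- k)\<close> times the Jacobian of
  \<open>\<eta> = norm \<xi> *\<^sub>R w\<close>. At \<open>\<xi> = 0\<close> both sides vanish,
  since \<open>0 powr _\<close> is 0 and so is \<open>G 0\<close>.\<close>

lemma Q_eq_G: "Q \<xi> w = norm \<xi> ^ CARD('m) *\<^sub>R G \<xi> (norm \<xi> *\<^sub>R w)"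
proof (cases "\<xi> = 0")
  case True
  then show ?thesis by (simp add: Q_def G_0)
next
  case False
  then have "norm \<xi> powr (real CARD('m) - k) = norm \<xi> ^ CARD('m) * norm \<xi> powr (- k)"
    by (simp add: powr_diff powr_realpow powr_minus divide_inverse)
  then show ?thesis by (simp add: Q_def G_def K_scale[OF False])
qed

lemma integrable_G_section: "integrable lborel (G \<xi>)"
proof (rule Bochner_Integration.integrable_bound)
  show "integrable lborel (\<lambda>\<eta>. norm \<xi> powr (- k) *\<^sub>R F (\<xi>, \<eta>))"
    by (intro integrable_scaleR_right integrable_F_section)
  have "(\<lambda>\<eta>. K \<xi> \<eta>) \<in> borel_measurable borel"
    using measurable_compose[OF measurable_Pair1' borel_measurable_K, of \<xi>] by simp
  then show "G \<xi> \<in> borel_measurable lborel" unfolding G_def[abs_def] by simp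
  show "AE \<eta> in lborel. norm (G \<xi> \<eta>) \<le> norm (norm \<xi> powr (- k) *\<^sub>R F (\<xi>, \<eta>))"
    unfolding G_def norm_mult using mult_right_mono[OF norm_K_le norm_ge_zero] by (intro AE_I2) (simp only: mult_1)
qed

lemma integral_scaled_section:
  fixes g :: "real^'m \<Rightarrow> 'b::{banach, second_countable_topology}"
  assumes "\<xi> \<noteq> 0"
  shows "(LINT w|lborel. norm \<xi> ^ CARD('m) *\<^sub>R g (norm \<xi> *\<^sub>R w)) = (LINT \<eta>|lborel. g \<eta>)"
  using assms by (subst (2) integral_lborel_affine[where c="norm \<xi>" and t=0]) auto

text \<open>For each \<open>\<xi> \<noteq> 0\<close> scaling turns the integral of
  \<open>norm (Q \<xi> w)\<close> over \<open>w\<close> into that of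
  \<open>norm (G \<xi> \<eta>)\<close> over \<open>\<eta>\<close>, so joint integrability is
  inherited from \<open>G\<close>. The degenerate slice \<open>\<xi> = 0\<close> is identically 0
  for both.\<close>

lemma integrable_Q: "integrable (lborel \<Otimes>\<^sub>M lborel) (\<lambda>(\<xi>, w). Q \<xi> w)"
proof (rule lborel_pair.Fubini_integrable)
  show "(\<lambda>(\<xi>, w). Q \<xi> w) \<in> borel_measurable (lborel \<Otimes>\<^sub>M lborel)"
    using borel_measurable_Q by simp
  have "(LINT w|lborel. norm (Q \<xi> w)) = (LINT \<eta>|lborel. norm (G \<xi> \<eta>))" for \<xi>
  proof (cases "\<xi> = 0")
    case True
    then show ?thesis by (simp add: Q_eq_G G_0)
  next
    case False
    have "(LINT w|lborel. norm (Q \<xi> w)) = (LINT w|lborel. norm \<xi> ^ CARD('m) *\<^sub>R norm (G \<xi> (norm \<xi> *\<^sub>R w)))"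
      by (simp add: Q_eq_G)
    also have "\<dots> = (LINT \<eta>|lborel. norm (G \<xi> \<eta>))"
      by (rule integral_scaled_section[OF False, where g="\<lambda>\<eta>. norm (G \<xi> \<eta>)"])
    finally show ?thesis .
  qed
  moreover have "integrable (lborel \<Otimes>\<^sub>M lborel) (\<lambda>z. norm (case z of (\<xi>, \<eta>) \<Rightarrow> G \<xi> \<eta>))"
    using integrable_norm[OF integrable_G] by (simp add: lborel_prod)
  from lborel_pair.integrable_fst'[OF this]
  have "integrable lborel (\<lambda>\<xi>. LINT \<eta>|lborel. norm (G \<xi> \<eta>))" by simp
  ultimately show "integrable lborel (\<lambda>\<xi>. LINT w|lborel. norm (case (\<xi>, w) of (\<xi>, w) \<Rightarrow> Q \<xi> w))"
    by simp
  have "integrable lborel (Q \<xi>)" for \<xi>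
  proof (cases "\<xi> = 0")
    case True
    then show ?thesis by (simp add: Q_eq_G[abs_def] G_0)
  next
    case False
    then have "integrable lborel (\<lambda>w. G \<xi> (0 + norm \<xi> *\<^sub>R w))"
      using integrable_G_section by (subst integrable_lborel_affine_iff) auto
    then show ?thesis by (simp add: Q_eq_G[abs_def])
  qed
  then show "AE \<xi> in lborel. integrable lborel (\<lambda>w. case (\<xi>, w) of (\<xi>, w) \<Rightarrow> Q \<xi> w)"
    by simp
qed

text \<open>The radius \<open>s\<close> and the vector \<open>y\<close> are kept apart so that the
  result serves both \<open>cone_transform\<close>, with \<open>s = norm y\<close>, and
  \<open>cone_rad\<close>, with \<open>y = s *\<^sub>R e\<close>.\<close>

lemma
  assumes s: "norm y = s"
  shows integrable_h_shear: "integrable lborel (\<lambda>w. h (x + s *\<^sub>R w) w)" (is ?A)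
    and integral_h_shear: "(LINT w|lborel. h (x + s *\<^sub>R w) w) =
      (2 * pi) powi (- int CARD('m)) *\<^sub>R fourier_L1 (\<lambda>\<xi>. fourier_L1 (G \<xi>) (- y)) (- x)" (is ?B)
proof -
  let ?c = "(2 * pi) powi (- int CARD('m))"
  let ?T = "\<lambda>\<xi> w. wave \<xi> (- (x + s *\<^sub>R w)) * Q \<xi> w"
  have i: "integrable (lborel \<Otimes>\<^sub>M lborel) (\<lambda>(\<xi>, w). ?T \<xi> w)"
  proof (rule Bochner_Integration.integrable_bound[OF integrable_Q])
    show "(\<lambda>(\<xi>, w). ?T \<xi> w) \<in> borel_measurable (lborel \<Otimes>\<^sub>M lborel)"
      using borel_measurable_Q unfolding case_prod_unfold by simp
  qed (simp add: norm_mult case_prod_unfold)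
  have hT: "h (x + s *\<^sub>R w) w = ?c *\<^sub>R (LINT \<xi>|lborel. ?T \<xi> w)" for w
    unfolding h_eq fourier_L1_def ..
  show ?A unfolding hT by (intro integrable_scaleR_right lborel_pair.integrable_snd[OF i])
  have "(LINT w|lborel. h (x + s *\<^sub>R w) w) = ?c *\<^sub>R (LINT w|lborel. LINT \<xi>|lborel. ?T \<xi> w)"
    unfolding hT by (rule integral_scaleR_right)
  also have "(LINT w|lborel. LINT \<xi>|lborel. ?T \<xi> w) = (LINT \<xi>|lborel. LINT w|lborel. ?T \<xi> w)"
    by (rule lborel_pair.Fubini_integral[OF i])
  also have "(\<lambda>\<xi>. LINT w|lborel. ?T \<xi> w) = (\<lambda>\<xi>. wave \<xi> (- x) * fourier_L1 (G \<xi>) (- y))"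
  proof
    fix \<xi>
    show "(LINT w|lborel. ?T \<xi> w) = wave \<xi> (- x) * fourier_L1 (G \<xi>) (- y)"
    proof (cases "\<xi> = 0")
      case True
      then show ?thesis by (simp add: Q_eq_G G_0 fourier_L1_def)
    next
      case False
      \<comment> \<open>Chosen so that \<open>(norm \<xi> *\<^sub>R w) \<bullet> z\<close> is the
        part \<open>- s * (\<xi> \<bullet> w)\<close> of the phase. As
        \<open>norm z = norm y\<close>, radiality of \<open>G \<xi>\<close> lets \<open>- y\<close>
        take the place of \<open>z\<close> after the integration.\<close>
      define z where "z = - ((s / norm \<xi>) *\<^sub>R \<xi>)"
      have z: "norm z = norm (- y)" using False s[symmetric] by (simp add: z_def)
      have T: "?T \<xi> w = wave \<xi> (- x) *
          (norm \<xi> ^ CARD('m) *\<^sub>R (wave (norm \<xi> *\<^sub>R w) z * G \<xi> (norm \<xi> *\<^sub>R w)))" for w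
      proof -
        have "\<xi> \<bullet> - (x + s *\<^sub>R w) = \<xi> \<bullet> - x + (norm \<xi> *\<^sub>R w) \<bullet> z"
          using False by (simp add: z_def inner_add_right inner_diff_right inner_commute)
        then have "wave \<xi> (- (x + s *\<^sub>R w))
          = wave \<xi> (- x) * wave (norm \<xi> *\<^sub>R w) z"
          by (simp only: of_real_add distrib_left minus_add_distrib exp_add)
        then show ?thesis unfolding Q_eq_G by (simp only: mult_scaleR_right mult.assoc)
      qed
      have "(LINT w|lborel. ?T \<xi> w) = wave \<xi> (- x) *
          (LINT w|lborel. norm \<xi> ^ CARD('m) *\<^sub>R (wave (norm \<xi> *\<^sub>R w) z * G \<xi> (norm \<xi> *\<^sub>R w)))"
        unfolding T by (rule integral_mult_right_zero)
      also have "(LINT w|lborel. norm \<xi> ^ CARD('m) *\<^sub>R (wave (norm \<xi> *\<^sub>R w) z * G \<xi> (norm \<xi> *\<^sub>R w)))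
        = fourier_L1 (G \<xi>) z"
        unfolding fourier_L1_def
        by (rule integral_scaled_section[OF False, where g="\<lambda>\<eta>. wave \<eta> z * G \<xi> \<eta>"])
      also have "\<dots> = fourier_L1 (G \<xi>) (- y)"
      proof (rule fourier_L1_radial[OF _ _ z])
        show "G \<xi> \<in> borel_measurable borel" using integrable_G_section[of \<xi>] by auto
        show "G \<xi> (U v) = G \<xi> v" if "orthogonal_transformation U" for U v
          by (rule G_radial) (rule orthogonal_transformation_norm[OF that])
      qed
      finally show ?thesis .
    qed
  qed
  finally show ?B unfolding fourier_L1_def[of "\<lambda>\<xi>. fourier_L1 (G \<xi>) (- y)"] .
qed

lemma proj_riesz1_f_eq:
  "proj a b (riesz1 k f) (x, y) =
     (2 * pi) powi (- int (CARD('m) + CARD('m))) *\<^sub>R fourier_L1 (\<lambda>\<xi>. fourier_L1 (G \<xi>) (- y)) (- x)"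
  unfolding proj_riesz1_f inv_fourier_integrable[OF integrable_G]
  using fourier_L1_pair(2)[OF integrable_G, of "- x" "- y"] by simp

lemma proj_eq_integral_h:
  assumes "norm y = s"
  shows "proj a b (riesz1 k f) (x, y) = (2 * pi) powi (- int CARD('m)) *\<^sub>R (LINT w|lborel. h (x + s *\<^sub>R w) w)"
proof -
  have "(2 * pi) powi (- int (CARD('m) + CARD('m))) = (2 * pi) powi (- int CARD('m)) * (2 * pi) powi (- int CARD('m))"
    unfolding power_int_minus power_int_of_nat power_add by (rule inverse_mult_distrib)
  then show ?thesis
    unfolding integral_h_shear[OF assms] proj_riesz1_f_eq by (simp only: scaleR_scaleR)
qed

theorem proj_riesz1:
  "proj a b (riesz1 k f) (x, y) =
     (2 * pi) powi (- int CARD('m)) *\<^sub>R cone_transform (riesz1 (k - real CARD('m)) (cone_lim a b f)) (x, y)"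
  using proj_eq_integral_h[OF refl] by (simp add: cone_transform_def riesz1_cone_lim)

end

section \<open>Bessel functions and radial Fourier transforms\<close>

text \<open>Lets the even moments of a Gaussian on the half line be written by the same Gamma value
  as the odd ones.\<close>

lemma Gamma_half_nat: "Gamma (real k + 1 / 2) = sqrt pi * (fact (2 * k) / (2 ^ (2 * k) * fact k))"
proof (induction k)
  case 0
  then show ?case by (simp add: Gamma_one_half_real)
next
  case (Suc k)
  have nz: "real k + 1 / 2 \<notin> \<int>\<^sub>\<le>\<^sub>0"
  proof
    assume "real k + 1 / 2 \<in> \<int>\<^sub>\<le>\<^sub>0"
    then have "real k + 1 / 2 \<le> 0" by (auto elim: nonpos_Ints_cases)
    then show False by simp
  qed
  have "Gamma (real (Suc k) + 1 / 2) = Gamma ((real k + 1 / 2) + 1)" by (simp add: add_ac)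
  also have "\<dots> = (real k + 1 / 2) * Gamma (real k + 1 / 2)"
    by (rule Gamma_plus1[OF nz])
  also have "\<dots> = sqrt pi * (fact (2 * Suc k) / (2 ^ (2 * Suc k) * fact (Suc k)))"
  proof -
    have alg: "w * (S * (A / (P * B))) = S * ((2 * u * (2 * w) * A) / ((4 * P) * (u * B)))"
      if "u \<noteq> 0" "P \<noteq> 0" "B \<noteq> 0" for u w S A P B :: real
      using that by (simp add: field_simps)
    have "fact (2 * Suc k) = 2 * (real k + 1) * (2 * (real k + 1 / 2)) * fact (2 * k)"
      by (simp add: algebra_simps)
    moreover have "(2::real) ^ (2 * Suc k) = 4 * 2 ^ (2 * k)" by simp
    moreover have "fact (Suc k) = (real k + 1) * fact k" by (simp add: algebra_simps)
    ultimately show ?thesis unfolding Suc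
      by (simp only:) (rule alg; simp add: add_nonneg_eq_0_iff)
  qed
  finally show ?case .
qed

lemma half_gaussian_moment:
  "(LINT r:{0<..}|lborel. r ^ n * gaussian r) = sqrt 2 ^ Suc n * Gamma ((real n + 1) / 2) / 2"
proof -
  let ?g = "\<lambda>x::real. indicator {0..} x *\<^sub>R (exp (- x\<^sup>2) * x ^ n)"
  have g: "has_bochner_integral lborel ?g (Gamma ((real n + 1) / 2) / 2)"
  proof (cases "even n")
    case True
    then obtain k where n: "n = 2 * k" by blast
    have "(real n + 1) / 2 = real k + 1 / 2" by (simp add: n add_divide_distrib)
    then have G: "Gamma ((real n + 1) / 2) / 2 = (sqrt pi / 2) * (fact (2 * k) / (2 ^ (2 * k) * fact k))"
      by (simp only: Gamma_half_nat) simp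
    show ?thesis unfolding G unfolding n by (rule gaussian_moment_even_pos)
  next
    case False
    then obtain k where n: "n = 2 * k + 1" by (rule oddE)
    have "(real n + 1) / 2 = 1 + real k" by (simp add: n add_divide_distrib)
    then have G: "Gamma ((real n + 1) / 2) / 2 = fact k / 2"
      by (simp only: Gamma_fact)
    show ?thesis unfolding G unfolding n by (rule gaussian_moment_odd_pos)
  qed
  \<comment> \<open>The function \<open>?g\<close> is built on \<open>exp (- x^2)\<close>. Scaling
    by \<open>inverse (sqrt 2)\<close> turns it into \<open>gaussian\<close>; the power contributes
    \<open>sqrt 2 ^ n\<close> and the Jacobian one more factor.\<close>
  have e: "sqrt 2 ^ n * ?g (0 + inverse (sqrt 2) * r) = indicator {0..} r *\<^sub>R (r ^ n * gaussian r)" for r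
    by (auto simp: gaussian_def power_mult_distrib power_inverse field_simps split: split_indicator)
  have g': "has_bochner_integral lborel (\<lambda>r. ?g (0 + inverse (sqrt 2) * r)) ((Gamma ((real n + 1) / 2) / 2) /\<^sub>R inverse (sqrt 2))"
    using lborel_has_bochner_integral_real_affine_iff[of "inverse (sqrt 2)" ?g _ 0] g by simp
  have "has_bochner_integral lborel (\<lambda>r. sqrt 2 ^ n * ?g (0 + inverse (sqrt 2) * r)) (sqrt 2 ^ n * ((Gamma ((real n + 1) / 2) / 2) /\<^sub>R inverse (sqrt 2)))"
    by (intro has_bochner_integral_mult_right g')
  then have m: "has_bochner_integral lborel (\<lambda>r. indicator {0..} r *\<^sub>R (r ^ n * gaussian r)) (sqrt 2 ^ Suc n * Gamma ((real n + 1) / 2) / 2)"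
    unfolding e by (simp add: mult_ac)
  have "has_bochner_integral lborel (\<lambda>r. indicator {0<..} r *\<^sub>R (r ^ n * gaussian r)) (sqrt 2 ^ Suc n * Gamma ((real n + 1) / 2) / 2)"
  proof (rule has_bochner_integral_cong_AE[THEN iffD1, OF _ _ _ m])
    show "AE r in lborel. indicator {0..} r *\<^sub>R (r ^ n * gaussian r) = indicator {0<..} r *\<^sub>R (r ^ n * gaussian r)"
      by (rule AE_mp[OF AE_lborel_singleton[of 0]], rule AE_I2) (auto split: split_indicator)
  qed auto
  then show ?thesis by (simp add: has_bochner_integral_iff set_lebesgue_integral_def)
qed

text \<open>The integral of \<open>(x \<bullet> e) ^ m * gaussian x\<close> is evaluated coordinatewise and in polar
  coordinates.\<close>

lemma sphere_moment_times:
  fixes e :: "'a::euclidean_space"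
  assumes e: "e \<in> Basis"
  shows "(LINT \<theta>|sphere_measure. (\<theta> \<bullet> e) ^ m) * (sqrt 2 ^ (DIM('a) + m) * Gamma ((real DIM('a) + real m) / 2) / 2)
     = sqrt (2 * pi) ^ DIM('a) * (LINT t|lborel. std_normal_density t * t ^ m)"
proof -
  let ?L = "\<lambda>\<theta>. LINT r:{0<..}|lborel. r ^ (DIM('a) - 1) *\<^sub>R ((r *\<^sub>R \<theta> \<bullet> e) ^ m * gaussian (r *\<^sub>R \<theta>))"
  \<comment> \<open>The subtraction is genuine because the dimension is positive; the radial
    integral is the half-line moment of order \<open>DIM('a) - 1 + m\<close>.\<close>
  have D: "Suc (DIM('a) - 1 + m) = DIM('a) + m" using DIM_positive[where 'a='a] by simp
  have D': "real (DIM('a) - 1 + m) + 1 = real DIM('a) + real m" using D by linarith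
  let ?R = "LINT r:{0<..}|lborel. r ^ (DIM('a) - 1 + m) * gaussian r"
  have "sqrt (2 * pi) ^ DIM('a) * (LINT t|lborel. std_normal_density t * t ^ m) = (LINT x|lborel. (x \<bullet> e) ^ m * gaussian x)"
    by (rule integral_gaussian_moment[OF e, symmetric])
  also have "\<dots> = (LINT \<theta>|sphere_measure. ?L \<theta>)"
    by (rule integral_polar[OF integrable_gaussian_moment[OF e]])
  also have "\<dots> = (LINT \<theta>|sphere_measure. (\<theta> \<bullet> e) ^ m * ?R)"
  proof (rule Bochner_Integration.integral_cong[OF refl])
    fix \<theta> :: 'a assume "\<theta> \<in> space sphere_measure"
    then have n: "norm \<theta> = 1" by simp
    have "?L \<theta>
      = (LINT r:{0<..}|lborel. (\<theta> \<bullet> e) ^ m * (r ^ (DIM('a) - 1 + m) * gaussian r))"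
    proof (intro set_lebesgue_integral_cong allI impI)
      fix r :: real
      have "gaussian (r *\<^sub>R \<theta>) = gaussian r" using n by (simp add: gaussian_def)
      then show "r ^ (DIM('a) - 1) *\<^sub>R ((r *\<^sub>R \<theta> \<bullet> e) ^ m * gaussian (r *\<^sub>R \<theta>)) = (\<theta> \<bullet> e) ^ m * (r ^ (DIM('a) - 1 + m) * gaussian r)"
        by (simp only: inner_scaleR_left real_scaleR_def power_mult_distrib power_add mult_ac)
    qed simp
    then show "?L \<theta> = (\<theta> \<bullet> e) ^ m * ?R"
      by simp
  qed
  also have "\<dots> = (LINT \<theta>|sphere_measure. (\<theta> \<bullet> e) ^ m) * ?R" by (rule integral_mult_left_zero)
  also have "?R = sqrt 2 ^ (DIM('a) + m) * Gamma ((real DIM('a) + real m) / 2) / 2"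
    unfolding half_gaussian_moment D D' ..
  finally show ?thesis by (rule sym)
qed

lemma Gamma_half_pos: "Gamma ((real DIM('a::euclidean_space) + real m) / 2) > 0"
  by (intro Gamma_real_pos divide_pos_pos add_pos_nonneg) auto

lemma sphere_moment_odd:
  fixes e :: "'a::euclidean_space"
  assumes e: "e \<in> Basis"
  shows "(LINT \<theta>|sphere_measure. (\<theta> \<bullet> e) ^ (2 * j + 1)) = 0"
proof -
  let ?c = "sqrt 2 ^ (DIM('a) + (2 * j + 1)) * Gamma ((real DIM('a) + real (2 * j + 1)) / 2) / 2"
  have "?c > 0" by (intro divide_pos_pos mult_pos_pos Gamma_half_pos) auto
  moreover have "(LINT \<theta>|sphere_measure. (\<theta> \<bullet> e) ^ (2 * j + 1)) * ?c = 0"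
    unfolding sphere_moment_times[OF e] integral_std_normal_moment_odd by simp
  ultimately show ?thesis unfolding mult_eq_0_iff by (elim disjE) (assumption, simp only: less_irrefl)
qed

text \<open>Stated with \<open>rGamma\<close> to match the series in \<open>bessel_J\<close>: for
  the order \<open>\<nu> = (DIM('a) - 2) / 2\<close> the argument \<open>j + DIM('a) / 2\<close> is
  \<open>j + \<nu> + 1\<close>.\<close>

lemma sphere_moment_even:
  fixes e :: "'a::euclidean_space"
  assumes e: "e \<in> Basis"
  shows "(LINT \<theta>|sphere_measure. (\<theta> \<bullet> e) ^ (2 * j))
    = 2 * sqrt pi ^ DIM('a) * fact (2 * j) * rGamma (real j + real DIM('a) / 2) / (4 ^ j * fact j)"
proof -
  let ?G = "Gamma ((real DIM('a) + real (2 * j)) / 2)"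
  have G: "?G > 0" by (rule Gamma_half_pos)
  have arg: "(real DIM('a) + real (2 * j)) / 2 = real j + real DIM('a) / 2" by (simp add: add_divide_distrib)
  have rG: "rGamma (real j + real DIM('a) / 2) = inverse ?G"
    unfolding arg by (simp add: rGamma_inverse_Gamma)
  have s2: "sqrt 2 ^ (DIM('a) + 2 * j) = sqrt 2 ^ DIM('a) * 2 ^ j"
    by (simp add: power_add power_mult)
  have s3: "sqrt (2 * pi) ^ DIM('a) = sqrt 2 ^ DIM('a) * sqrt pi ^ DIM('a)"
    by (simp add: real_sqrt_mult power_mult_distrib)
  have four: "(4::real) ^ j = 2 ^ j * 2 ^ j" by (simp add: power_mult_distrib[symmetric])
  let ?M = "LINT \<theta>|sphere_measure. (\<theta> \<bullet> e) ^ (2 * j)"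
  have "?M * (sqrt 2 ^ DIM('a) * 2 ^ j * ?G / 2) = sqrt 2 ^ DIM('a) * sqrt pi ^ DIM('a) * (fact (2 * j) / (2 ^ j * fact j))"
    using sphere_moment_times[OF e, of "2 * j"] unfolding integral_std_normal_moment_even s2 s3 .
  moreover have "M = 2 * p * A * inverse g / (t * t * B)"
    if "M * (s * t * g / 2) = s * p * (A / (t * B))" "s \<noteq> 0" "t \<noteq> 0" "B \<noteq> 0" "g \<noteq> 0" for M s t g p A B :: real
    using that by (simp add: field_simps)
  ultimately show ?thesis unfolding rG four using G by simp
qed

lemma integrable_sphere_bounded:
  fixes g :: "'a::euclidean_space \<Rightarrow> 'b::{banach, second_countable_topology}"
  assumes "g \<in> borel_measurable borel" and "\<And>x. norm x = 1 \<Longrightarrow> norm (g x) \<le> B"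
  shows "integrable sphere_measure g"
  by (rule sphere_measure.integrable_const_bound[where B=B])
     (use assms measurable_sphere_measureI in auto)

text \<open>The exponential series may be integrated term by term, being dominated on the sphere by
  the series of \<open>exp r\<close>. Odd moments vanish by \<open>sphere_moment_odd\<close>, and
  the even ones produce the coefficients of the Bessel series. In dimension 1 the sphere consists of
  two points, and both sides are \<open>2 * cos r\<close>.\<close>

lemma fourier_sphere_bessel:
  fixes e :: "'a::euclidean_space"
  assumes e: "e \<in> Basis" and r: "r > 0"
  shows "(LINT \<theta>|sphere_measure. exp (- (\<i> * complex_of_real (r * (\<theta> \<bullet> e)))))
    = complex_of_real (sqrt (2 * pi) ^ DIM('a) * (r powr (- (real DIM('a) - 2) / 2) * bessel_J ((real DIM('a) - 2) / 2) r))"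
proof -
  let ?\<nu> = "(real DIM('a) - 2) / 2"
  let ?f = "\<lambda>m \<theta>. (- (\<i> * complex_of_real (r * (\<theta> \<bullet> e)))) ^ m /\<^sub>R fact m"
  let ?S = "sphere_measure :: 'a measure"
  let ?E = "\<lambda>\<theta>. exp (- (\<i> * complex_of_real (r * (\<theta> \<bullet> e))))"
  let ?x = "\<lambda>j. (- 1) ^ j * rGamma (real j + ?\<nu> + 1) / fact j * (r / 2) ^ (2 * j)"
  have bound: "norm (?f m \<theta>) \<le> r ^ m /\<^sub>R fact m" if "norm \<theta> = 1" for m \<theta>
  proof -
    have "\<bar>\<theta> \<bullet> e\<bar> \<le> norm \<theta> * norm e" by (rule Cauchy_Schwarz_ineq2)
    then have "\<bar>\<theta> \<bullet> e\<bar> \<le> 1" using that e by simp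
    then have "(r * \<bar>\<theta> \<bullet> e\<bar>) ^ m \<le> (r * 1) ^ m" using r by (intro power_mono mult_left_mono) auto
    then show ?thesis using r by (simp add: norm_mult norm_power abs_mult)
  qed
  have int: "integrable ?S (?f m)" for m
    by (rule integrable_sphere_bounded[where B="r ^ m /\<^sub>R fact m"]) (use bound in auto)
  have summ: "summable (\<lambda>m. norm (?f m \<theta>))" if "norm \<theta> = 1" for \<theta>
    using summable_norm_exp[of "- (\<i> * complex_of_real (r * (\<theta> \<bullet> e)))"] by simp
  have "summable (\<lambda>m. LINT \<theta>|?S. norm (?f m \<theta>))"
  proof (rule summable_comparison_test')
    show "summable (\<lambda>m. measure ?S (space ?S) * (r ^ m /\<^sub>R fact m))"
      using summable_exp_generic[of r] by (intro summable_mult)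
    fix m :: nat
    have "(LINT \<theta>|?S. norm (?f m \<theta>)) \<le> (LINT \<theta>|?S. r ^ m /\<^sub>R fact m)"
      by (intro integral_mono integrable_norm int) (use bound in auto)
    moreover have "0 \<le> (LINT \<theta>|?S. norm (?f m \<theta>))" by (intro Bochner_Integration.integral_nonneg) auto
    ultimately show "norm (LINT \<theta>|?S. norm (?f m \<theta>)) \<le> measure ?S (space ?S) * (r ^ m /\<^sub>R fact m)" if "m \<ge> 0"
      by simp
  qed
  then have "(\<lambda>m. LINT \<theta>|?S. ?f m \<theta>) sums (LINT \<theta>|?S. (\<Sum>m. ?f m \<theta>))"
    using summ by (intro sums_integral int AE_I2) auto
  also have "(\<lambda>\<theta>. \<Sum>m. ?f m \<theta>) = (\<lambda>\<theta>. ?E \<theta>)"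
    by (simp only: exp_def)
  finally have s: "(\<lambda>m. LINT \<theta>|?S. ?f m \<theta>) sums (LINT \<theta>|?S. ?E \<theta>)" .
  have tm: "(LINT \<theta>|?S. ?f m \<theta>) = ((- (\<i> * complex_of_real r)) ^ m /\<^sub>R fact m) * complex_of_real (LINT \<theta>|?S. (\<theta> \<bullet> e) ^ m)" for m
  proof -
    have "(LINT \<theta>|?S. ?f m \<theta>) = (LINT \<theta>|?S. ((- (\<i> * complex_of_real r)) ^ m /\<^sub>R fact m) * complex_of_real ((\<theta> \<bullet> e) ^ m))"
      by (intro Bochner_Integration.integral_cong refl) (simp add: power_mult_distrib[symmetric] mult.assoc)
    also have "\<dots> = ((- (\<i> * complex_of_real r)) ^ m /\<^sub>R fact m) * (LINT \<theta>|?S. complex_of_real ((\<theta> \<bullet> e) ^ m))"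
      by (rule integral_mult_right_zero)
    finally show ?thesis unfolding integral_complex_of_real .
  qed
  have odd: "(LINT \<theta>|?S. ?f m \<theta>) = 0" if "m \<notin> range (\<lambda>j. 2 * j)" for m
  proof -
    have "odd m" using that by auto
    then obtain j where "m = 2 * j + 1" by (rule oddE)
    then show ?thesis unfolding tm using sphere_moment_odd[OF e, of j] by simp
  qed
  have "strict_mono (\<lambda>j::nat. 2 * j)" by (simp add: strict_mono_def)
  from sums_mono_reindex[OF this, of "\<lambda>m. LINT \<theta>|?S. ?f m \<theta>"] odd s
  have "(\<lambda>j. LINT \<theta>|?S. ?f (2 * j) \<theta>) sums (LINT \<theta>|?S. ?E \<theta>)"
    by blast
  also have "(\<lambda>j. LINT \<theta>|?S. ?f (2 * j) \<theta>) = (\<lambda>j. complex_of_real (2 * sqrt pi ^ DIM('a) *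
       ?x j))"
  proof
    fix j
    have arg: "real j + real DIM('a) / 2 = real j + ?\<nu> + 1" by (simp add: diff_divide_distrib)
    have "(- (\<i> * complex_of_real r)) ^ (2 * j) = complex_of_real ((- 1) ^ j * r ^ (2 * j))"
      by (simp add: power_mult power_mult_distrib) (rule power_minus)
    note pw = this
    have "(LINT \<theta>|?S. ?f (2 * j) \<theta>) = complex_of_real (((- 1) ^ j * r ^ (2 * j)) / fact (2 * j) *
       (2 * sqrt pi ^ DIM('a) * fact (2 * j) * rGamma (real j + ?\<nu> + 1) / (4 ^ j * fact j)))"
      unfolding tm unfolding sphere_moment_even[OF e] arg pw unfolding scaleR_conv_of_real of_real_mult[symmetric] divide_inverse
      by (simp only: mult_ac)
    also have "((- 1) ^ j * r ^ (2 * j)) / fact (2 * j) *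
       (2 * sqrt pi ^ DIM('a) * fact (2 * j) * rGamma (real j + ?\<nu> + 1) / (4 ^ j * fact j))
      = 2 * sqrt pi ^ DIM('a) * ?x j"
    proof -
      have "(r / 2) ^ (2 * j) = r ^ (2 * j) / 4 ^ j" by (simp add: power_divide power_mult)
      then show ?thesis by (simp add: mult_ac)
    qed
    finally show "(LINT \<theta>|?S. ?f (2 * j) \<theta>) = complex_of_real (2 * sqrt pi ^ DIM('a) *
       ?x j)" .
  qed
  finally have s2: "(\<lambda>j. complex_of_real (2 * sqrt pi ^ DIM('a) *
       ?x j)) sums (LINT \<theta>|?S. ?E \<theta>)" .
  define I where "I = (LINT \<theta>|?S. ?E \<theta>)"
  \<comment> \<open>The terms are real, so the sum is too. Passing to real parts also yields
    convergence of the real series whose \<open>suminf\<close> defines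
    \<open>bessel_J\<close>.\<close>
  have re: "(\<lambda>j. 2 * sqrt pi ^ DIM('a) * ?x j) sums Re I"
    using sums_Re[OF s2[folded I_def]] unfolding Re_complex_of_real .
  have I: "I = complex_of_real (Re I)"
    by (rule sums_unique2[OF s2[folded I_def] sums_of_real[OF re]])
  have nz: "2 * sqrt pi ^ DIM('a) \<noteq> 0" by simp
  have "(\<lambda>j. (- 1) ^ j * rGamma (real j + ?\<nu> + 1) / fact j * (r / 2) ^ (2 * j)) sums (Re I / (2 * sqrt pi ^ DIM('a)))"
    using sums_divide[OF re, of "2 * sqrt pi ^ DIM('a)"] unfolding nonzero_mult_div_cancel_left[OF nz] .
  from sums_unique[OF this]
  have J: "bessel_J ?\<nu> r = (r / 2) powr ?\<nu> * (Re I / (2 * sqrt pi ^ DIM('a)))"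
    by (simp add: bessel_J_def)
  have "sqrt (2 * pi) ^ DIM('a) * (r powr (- (real DIM('a) - 2) / 2) * bessel_J ?\<nu> r) = Re I"
  proof -
    \<comment> \<open>The powers of 2 match because \<open>DIM('a) / 2 = \<nu> + 1\<close>: the
      series supplies a factor 2, and \<open>(r / 2) powr \<nu>\<close> the rest.\<close>
    have "sqrt 2 ^ DIM('a) = 2 powr (real DIM('a) / 2)"
      by (simp add: powr_half_sqrt[symmetric] powr_powr powr_realpow[symmetric])
    also have "real DIM('a) / 2 = ?\<nu> + 1" by (simp add: diff_divide_distrib)
    finally have s2: "sqrt 2 ^ DIM('a) = 2 powr ?\<nu> * 2" by (simp add: powr_add)
    have "sqrt (2 * pi) ^ DIM('a) = 2 powr ?\<nu> * 2 * sqrt pi ^ DIM('a)"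
      unfolding s2[symmetric] by (simp add: real_sqrt_mult power_mult_distrib)
    moreover have "(r / 2) powr ?\<nu> = r powr ?\<nu> / 2 powr ?\<nu>" using r by (simp add: powr_divide)
    moreover have "r powr (- (real DIM('a) - 2) / 2) = inverse (r powr ?\<nu>)"
      unfolding powr_minus[symmetric] by (simp add: minus_divide_left)
    ultimately show ?thesis unfolding J using r by simp
  qed
  then show ?thesis using I unfolding I_def by simp
qed

theorem fourier_L1_hankel:
  fixes e :: "'a::euclidean_space" and H :: "real \<Rightarrow> complex"
  assumes e: "e \<in> Basis" and H: "integrable lborel (\<lambda>x::'a. H (norm x))" and \<rho>: "\<rho> > 0"
  shows "fourier_L1 (\<lambda>x::'a. H (norm x)) (\<rho> *\<^sub>R e)
    = (sqrt (2 * pi) ^ DIM('a) * \<rho> powr (- (real DIM('a) - 2) / 2)) *\<^sub>R hankel ((real DIM('a) - 2) / 2) H \<rho>"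
proof -
  let ?\<nu> = "(real DIM('a) - 2) / 2" and ?S = "sphere_measure :: 'a measure"
  let ?c = "sqrt (2 * pi) ^ DIM('a) * \<rho> powr (- (real DIM('a) - 2) / 2)"
  let ?B = "\<lambda>r. r powr (?\<nu> + 1) * bessel_J ?\<nu> (r * \<rho>)"
  let ?g = "\<lambda>x::'a. wave x (\<rho> *\<^sub>R e) * H (norm x)"
  have g: "integrable lborel ?g" by (rule integrable_fourier_kernel[OF H])
  let ?T = "\<lambda>\<theta> r. indicator {0<..} r *\<^sub>R r ^ (DIM('a) - 1) *\<^sub>R ?g (r *\<^sub>R \<theta>)"
  have i: "integrable (?S \<Otimes>\<^sub>M lborel) (\<lambda>(\<theta>, r). ?T \<theta> r)"
    by (rule integrable_polar[OF g])
  have "fourier_L1 (\<lambda>x::'a. H (norm x)) (\<rho> *\<^sub>R e) = (LINT \<theta>|?S. LINT r|lborel. ?T \<theta> r)"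
    unfolding fourier_L1_def integral_polar[OF g] set_lebesgue_integral_def ..
  also have "\<dots> = (LINT r|lborel. LINT \<theta>|?S. ?T \<theta> r)"
    by (rule sphere_lborel.Fubini_integral[OF i, symmetric])
  also have "(\<lambda>r. LINT \<theta>|?S. ?T \<theta> r) = (\<lambda>r. indicator {0<..} r *\<^sub>R (?c *\<^sub>R
      (?B r *\<^sub>R H r)))"
  proof
    fix r :: real
    show "(LINT \<theta>|?S. ?T \<theta> r) = indicator {0<..} r *\<^sub>R (?c *\<^sub>R
      (?B r *\<^sub>R H r))"
    proof (cases "r > 0")
      case r: True
      have "(LINT \<theta>|?S. ?T \<theta> r) = (LINT \<theta>|?S. exp (- (\<i> * complex_of_real ((r * \<rho>) * (\<theta> \<bullet> e)))) * (complex_of_real (r ^ (DIM('a) - 1)) * H r))"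
        using r by (intro Bochner_Integration.integral_cong refl) (simp add: scaleR_conv_of_real mult_ac)
      also have "\<dots> = (LINT \<theta>|?S. exp (- (\<i> * complex_of_real ((r * \<rho>) * (\<theta> \<bullet> e))))) * (complex_of_real (r ^ (DIM('a) - 1)) * H r)"
        by (rule integral_mult_left_zero)
      also have "\<dots> = complex_of_real (sqrt (2 * pi) ^ DIM('a) * ((r * \<rho>) powr (- (real DIM('a) - 2) / 2) * bessel_J ?\<nu> (r * \<rho>))) * (complex_of_real (r ^ (DIM('a) - 1)) * H r)"
        using r \<rho> by (subst fourier_sphere_bessel[OF e]) auto
      also have "\<dots> = complex_of_real (sqrt (2 * pi) ^ DIM('a) * ((r * \<rho>) powr (- (real DIM('a) - 2) / 2) * bessel_J ?\<nu> (r * \<rho>)) * r ^ (DIM('a) - 1)) * H r"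
        by (simp only: of_real_mult mult.assoc)
      also have "sqrt (2 * pi) ^ DIM('a) * ((r * \<rho>) powr (- (real DIM('a) - 2) / 2) * bessel_J ?\<nu> (r * \<rho>)) * r ^ (DIM('a) - 1)
        = ?c * ?B r"
      proof -
        have D: "real (DIM('a) - 1) = real DIM('a) - 1" using DIM_positive[where 'a='a] by (simp add: of_nat_diff)
        \<comment> \<open>Of the factor \<open>(r * \<rho>) powr (- \<nu>)\<close> the part in
          \<open>r\<close> joins the polar weight. With \<open>2 \<nu> = DIM('a) - 2\<close> the
          exponents add up to \<open>\<nu> + 1\<close>, the weight in \<open>hankel\<close>.\<close>
        have "r powr (- (real DIM('a) - 2) / 2) * r ^ (DIM('a) - 1) = r powr (?\<nu> + 1)"
          using r by (simp add: powr_realpow[symmetric] powr_add[symmetric] D field_simps)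
        then show ?thesis using r \<rho> by (simp add: powr_mult)
      qed
      finally show ?thesis using r by (simp add: scaleR_conv_of_real)
    qed simp
  qed
  also have "(LINT r|lborel. indicator {0<..} r *\<^sub>R (?c *\<^sub>R
      (?B r *\<^sub>R H r)))
    = (LINT r:{0<..}|lborel. ?c *\<^sub>R
      (?B r *\<^sub>R H r))"
    unfolding set_lebesgue_integral_def ..
  also have "\<dots> = ?c *\<^sub>R hankel ?\<nu> H \<rho>"
    unfolding hankel_def by (rule set_integral_scaleR_right)
  finally show ?thesis .
qed

section \<open>The second identity\<close>

lemma Basis_one_dim:
  assumes "CARD('m::finite) = 1"
  shows "(Basis :: (real^'m) set) = {vec 1}"
proof -
  obtain i0 :: 'm where i0: "UNIV = {i0}" using assms by (rule card_1_singletonE)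
  then have eq: "i = i0" for i by auto
  have "axis i 1 = (vec 1 :: real^'m)" for i
    using eq by (auto simp: vec_eq_iff axis_def) (metis eq)
  then show ?thesis by (auto simp: Basis_vec_def)
qed

lemma lborel_one_dim:
  assumes "CARD('m::finite) = 1"
  shows "(lborel :: (real^'m) measure) = distr lborel borel (\<lambda>z. z *\<^sub>R vec 1)"
proof (rule lborel_eqI)
  let ?e = "vec 1 :: real^'m"
  note B = Basis_one_dim[OF assms]
  have eB: "?e \<in> Basis" unfolding B by (rule singletonI)
  have ee: "?e \<bullet> ?e = 1" by (rule inner_same_Basis[OF eB])
  fix l u :: "real^'m" assume le: "\<And>b. b \<in> Basis \<Longrightarrow> l \<bullet> b \<le> u \<bullet> b"
  have "(\<lambda>z. z *\<^sub>R ?e) -` box l u = {l \<bullet> ?e <..< u \<bullet> ?e}"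
    by (auto simp: box_def B ee)
  then show "emeasure (distr lborel borel (\<lambda>z. z *\<^sub>R ?e)) (box l u) = (\<Prod>b\<in>Basis. (u - l) \<bullet> b)"
    using le by (subst emeasure_distr) (auto simp: B inner_diff_left)
qed simp

lemma integral_one_dim:
  fixes g :: "real^'m \<Rightarrow> complex"
  assumes one: "CARD('m) = 1" and g: "integrable lborel g"
  shows "(LINT y|lborel. g y) = (LINT z:{0<..}|lborel. g (z *\<^sub>R vec 1) + g (- (z *\<^sub>R vec 1)))"
proof -
  let ?\<phi> = "\<lambda>z::real. g (z *\<^sub>R vec 1)"
  have [measurable]: "g \<in> borel_measurable borel" using g by auto
  have i: "integrable lborel ?\<phi>"
    using g by (subst (asm) lborel_one_dim[OF one], subst (asm) integrable_distr_eq) auto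
  have i': "integrable lborel (\<lambda>z. ?\<phi> (- z))"
    using i integrable_lborel_affine_iff[of "-1" ?\<phi> 0] by simp
  have s: "integrable lborel (\<lambda>z. indicator {0<..} z *\<^sub>R ?\<phi> z)" "integrable lborel (\<lambda>z. indicator {0<..} z *\<^sub>R ?\<phi> (- z))"
    "integrable lborel (\<lambda>z. indicator {0<..} (- z) *\<^sub>R ?\<phi> z)"
    by (rule Bochner_Integration.integrable_bound[OF i] Bochner_Integration.integrable_bound[OF i'], simp, simp split: split_indicator)+
  have "(LINT z:{0<..}|lborel. g (z *\<^sub>R vec 1) + g (- (z *\<^sub>R vec 1)))
      = (LINT z|lborel. indicator {0<..} z *\<^sub>R ?\<phi> z) + (LINT z|lborel. indicator {0<..} z *\<^sub>R ?\<phi> (- z))"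
    unfolding set_lebesgue_integral_def scaleR_add_right using s by simp
  also have "(LINT z|lborel. indicator {0<..} z *\<^sub>R ?\<phi> (- z)) = (LINT z|lborel. indicator {0<..} (- z) *\<^sub>R ?\<phi> z)"
    by (subst integral_lborel_affine[where c="-1" and t=0]) auto
  also have "(LINT z|lborel. indicator {0<..} z *\<^sub>R ?\<phi> z) + \<dots> = (LINT z|lborel. indicator {0<..} z *\<^sub>R ?\<phi> z + indicator {0<..} (- z) *\<^sub>R ?\<phi> z)"
    using s by simp
  also have "\<dots> = (LINT z|lborel. ?\<phi> z)"
  proof (rule integral_cong_AE)
    show "AE z in lborel. indicator {0<..} z *\<^sub>R ?\<phi> z + indicator {0<..} (- z) *\<^sub>R ?\<phi> z = ?\<phi> z"
      by (rule AE_mp[OF AE_lborel_singleton[of 0]], rule AE_I2) (auto split: split_indicator)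
  qed auto
  also have "\<dots> = (LINT y|lborel. g y)"
    by (subst lborel_one_dim[OF one], subst integral_distr) auto
  finally show ?thesis by (rule sym)
qed

text \<open>Both branches of \<open>cone_rad\<close> are polar forms of the same integral over
  \<open>real^'m\<close>, the sphere being replaced by the two unit vectors in dimension 1. From
  here on the case \<open>n = 2\<close> needs no separate treatment.\<close>

lemma cone_rad_eq:
  fixes H :: "(real^'m) \<times> real \<Rightarrow> complex"
  assumes i: "integrable lborel (\<lambda>y::real^'m. H (u + s *\<^sub>R y, norm y))"
  shows "cone_rad H (u, s) = (LINT y|lborel. H (u + s *\<^sub>R y, norm y))"
proof (cases "CARD('m) = 1")
  case True
  have n: "norm (vec 1 :: real^'m) = 1"
    by (rule norm_Basis) (simp only: Basis_one_dim[OF True] singletonI)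
  have "(LINT y|lborel. H (u + s *\<^sub>R y, norm y)) = (LINT z:{0<..}|lborel. H (u + (z * s) *\<^sub>R vec 1, z) + H (u - (z * s) *\<^sub>R vec 1, z))"
    unfolding integral_one_dim[OF True i]
    by (intro set_lebesgue_integral_cong) (auto simp: n[simplified] mult.commute)
  then show ?thesis using True by (simp add: cone_rad_def)
next
  case False
  have "(LINT y|lborel. H (u + s *\<^sub>R y, norm y)) = (LINT \<theta>|sphere_measure. (LINT z:{0<..}|lborel. z ^ (CARD('m) - 1) *\<^sub>R H (u + (z * s) *\<^sub>R \<theta>, z)))"
    unfolding integral_polar[OF i]
    by (intro Bochner_Integration.integral_cong refl set_lebesgue_integral_cong) (auto simp: mult.commute)
  then show ?thesis using False by (simp add: cone_rad_def)
qed

lemma fourier1_cong_section: "(\<And>x. g (x, s) = g' (x, t)) \<Longrightarrow> fourier1 g (\<xi>, s) = fourier1 g' (\<xi>, t)"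
  by (simp add: fourier1_def)

text \<open>The second variable is a mere parameter, and its type may differ on the two sides.
  Statements about vectors \<open>v\<close> can thus be transported to radii
  \<open>s\<close>.\<close>

lemma riesz1_cong_section: "(\<And>x. g (x, s) = g' (x, t)) \<Longrightarrow> riesz1 k g (x, s) = riesz1 k g' (x, t)"
  by (simp add: riesz1_def inv_fourier1_def fourier1_cong_section[of g s g' t])

text \<open>The fixed unit vector \<open>e\<close> embeds the radii: \<open>s \<ge> 0\<close> is
  represented by \<open>s *\<^sub>R e\<close>, where radial functions are evaluated.\<close>

locale radial_schwartz_profile = radial_schwartz f a k b
  for f :: "(real^'m) \<times> (real^'m) \<Rightarrow> complex" and a k :: real and b :: ereal +
  fixes f_rad :: "(real^'m) \<times> real \<Rightarrow> complex" and e :: "real^'m"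
  assumes f_rad: "\<And>x y. f (x, y) = f_rad (x, norm y)" and e: "e \<in> Basis"
begin

lemma norm_scale_e: "s \<ge> 0 \<Longrightarrow> norm (s *\<^sub>R e) = s"
  using e by simp

lemma f_rad_eq: "s \<ge> 0 \<Longrightarrow> f_rad (x, s) = f (x, s *\<^sub>R e)"
  by (simp only: f_rad norm_scale_e)

lemma cone_rad_f_rad:
  assumes "s \<ge> 0"
  shows "cone_rad f_rad (u, s) = cone_transform f (u, s *\<^sub>R e)"
proof -
  have "integrable lborel (\<lambda>y. f_rad (u + s *\<^sub>R y, norm y))"
    unfolding f_rad[symmetric] by (rule integrable_shear_section[OF assms])
  from cone_rad_eq[OF this] show ?thesis
    unfolding f_rad[symmetric] cone_transform_def by (simp only: norm_scale_e[OF assms] prod.case)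
qed

lemma cone_rad_lim_f_rad: "s \<ge> 0 \<Longrightarrow> cone_rad_lim a b f_rad (u, s) = cone_lim a b f (u, s *\<^sub>R e)"
  by (simp add: cone_rad_lim_def cone_lim_def cone_rad_f_rad norm_scale_e indicator_def del: norm_scaleR)

lemma riesz1_cone_rad_lim:
  "s \<ge> 0 \<Longrightarrow> riesz1 (k - real CARD('m)) (cone_rad_lim a b f_rad) (x, s) = h x (s *\<^sub>R e)"
  using riesz1_cong_section[of "cone_rad_lim a b f_rad" s "cone_lim a b f" "s *\<^sub>R e"]
  by (simp add: cone_rad_lim_f_rad riesz1_cone_lim)

lemma cone_rad_riesz1:
  assumes z: "z \<ge> 0"
  shows "cone_rad (riesz1 (k - real CARD('m)) (cone_rad_lim a b f_rad)) (x, z) = (LINT w|lborel. h (x + z *\<^sub>R w) w)"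
proof -
  have eq: "riesz1 (k - real CARD('m)) (cone_rad_lim a b f_rad) (x + z *\<^sub>R w, norm w) = h (x + z *\<^sub>R w) w" for w
    unfolding riesz1_cone_rad_lim[OF norm_ge_zero] by (rule h_norm) (simp only: norm_scale_e norm_ge_zero)
  show ?thesis
    by (subst cone_rad_eq) (simp_all only: eq integrable_h_shear[OF norm_scale_e[OF z]])
qed

lemma proj_riesz1_cone_rad:
  assumes z: "z \<ge> 0"
  shows "proj a b (riesz1 k f) (x, z *\<^sub>R e) = (2 * pi) powi (- int CARD('m)) *\<^sub>R
     cone_rad (riesz1 (k - real CARD('m)) (cone_rad_lim a b f_rad)) (x, z)"
  unfolding cone_rad_riesz1[OF z] by (rule proj_eq_integral_h[OF norm_scale_e[OF z]])

definition \<nu> :: real where "\<nu> = (real CARD('m) - 2) / 2"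

text \<open>A weighted Hankel transform is a Fourier transform of a radial function on
  \<open>real^'m\<close> up to the factor \<open>(2 * pi)\<close> to the power
  \<open>- CARD('m) / 2\<close>. Only positive arguments enter \<open>hankel\<close>, so
  \<open>H'\<close> has to agree with \<open>H\<close> there alone.\<close>

lemma hankel_eq:
  assumes H: "integrable lborel (\<lambda>y::real^'m. H (norm y))" and \<rho>: "\<rho> > 0"
    and HH': "\<And>s. s > 0 \<Longrightarrow> H' s = H s"
  shows "\<rho> powr (- \<nu>) *\<^sub>R hankel \<nu> H' \<rho> = inverse (sqrt (2 * pi) ^ CARD('m)) *\<^sub>R fourier_L1 (\<lambda>y::real^'m. H (norm y)) (\<rho> *\<^sub>R e)"
proof -
  have "hankel \<nu> H' \<rho> = hankel \<nu> H \<rho>"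
    unfolding hankel_def by (intro set_lebesgue_integral_cong) (auto simp: HH')
  moreover have "fourier_L1 (\<lambda>y::real^'m. H (norm y)) (\<rho> *\<^sub>R e) = (sqrt (2 * pi) ^ CARD('m) * \<rho> powr (- \<nu>)) *\<^sub>R hankel \<nu> H \<rho>"
    using fourier_L1_hankel[OF e H \<rho>] by (simp add: \<nu>_def minus_divide_left)
  ultimately show ?thesis by simp
qed

lemma F1_radial: "norm y = norm y' \<Longrightarrow> F1 \<xi> y = F1 \<xi> y'"
  by (simp add: F1_def f_rad)

lemma fourier1_riesz1_f_rad:
  assumes \<xi>: "\<xi> \<noteq> 0" and s: "s \<ge> 0"
  shows "fourier1 (riesz1 k f_rad) (\<xi>, s) = norm \<xi> powr (- k) *\<^sub>R F1 \<xi> (s *\<^sub>R e)"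
proof -
  let ?g = "\<lambda>\<xi>. norm \<xi> powr (- k) *\<^sub>R F1 \<xi> (s *\<^sub>R e)"
  have "riesz1 k f_rad (x, s) = inv_fourier ?g x" for x
    unfolding riesz1_f[symmetric] by (rule riesz1_cong_section) (rule f_rad_eq[OF s])
  then have "fourier1 (riesz1 k f_rad) (\<xi>, s) = fourier (inv_fourier ?g) \<xi>"
    by (simp add: fourier1_def)
  also have "\<dots> = ?g \<xi>"
  proof (rule fourier_inv_fourier[OF integrable_weighted_F1])
    have "isCont (\<lambda>\<xi>. F1 \<xi> (s *\<^sub>R e)) \<xi>"
      unfolding F1_def using continuous_on_fourier_L1[OF integrable_section, of UNIV]
        continuous_on_eq_continuous_at[OF open_UNIV] by blast
    then show "isCont ?g \<xi>" using \<xi> by (intro continuous_intros) auto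
  qed
  finally show ?thesis .
qed

lemma hankel_fourier1_riesz1:
  assumes \<rho>: "\<rho> > 0"
  shows "indicator {\<rho>. a * norm \<xi> < \<rho> \<and> ereal \<rho> < b * ereal (norm \<xi>)} \<rho> *
      (\<rho> powr (- \<nu>) *\<^sub>R hankel \<nu> (\<lambda>s. fourier1 (riesz1 k f_rad) (\<xi>, s)) \<rho>)
    = inverse (sqrt (2 * pi) ^ CARD('m)) *\<^sub>R G \<xi> (\<rho> *\<^sub>R e)"
proof -
  have K: "indicator {\<rho>. a * norm \<xi> < \<rho> \<and> ereal \<rho> < b * ereal (norm \<xi>)} \<rho> = K \<xi> (\<rho> *\<^sub>R e)"
    unfolding K_def using norm_scale_e[of \<rho>] \<rho> by (simp add: indicator_def del: norm_scaleR)
  show ?thesis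
  proof (cases "\<xi> = 0")
    case True
    \<comment> \<open>At \<open>\<xi> = 0\<close> the transform of the Riesz potential has not been
      identified; the cut-off makes its value there immaterial.\<close>
    then show ?thesis unfolding K by (simp add: K_0 G_0)
  next
    case False
    let ?H = "\<lambda>s. norm \<xi> powr (- k) *\<^sub>R F1 \<xi> (s *\<^sub>R e)"
    have H: "?H (norm y) = norm \<xi> powr (- k) *\<^sub>R F1 \<xi> y" for y
      using F1_radial[OF norm_scale_e[OF norm_ge_zero], of \<xi> y] by (simp only:)
    have "\<rho> powr (- \<nu>) *\<^sub>R hankel \<nu> (\<lambda>s. fourier1 (riesz1 k f_rad) (\<xi>, s)) \<rho>
      = inverse (sqrt (2 * pi) ^ CARD('m)) *\<^sub>R fourier_L1 (\<lambda>y. ?H (norm y)) (\<rho> *\<^sub>R e)"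
    proof (rule hankel_eq[OF _ \<rho>])
      show "integrable lborel (\<lambda>y::real^'m. ?H (norm y))"
        unfolding H by (intro integrable_scaleR_right integrable_F1)
    qed (use fourier1_riesz1_f_rad[OF False] in simp)
    also have "fourier_L1 (\<lambda>y. ?H (norm y)) (\<rho> *\<^sub>R e) = norm \<xi> powr (- k) *\<^sub>R F (\<xi>, \<rho> *\<^sub>R e)"
      unfolding H F_eq by (simp add: fourier_L1_def)
    finally show ?thesis unfolding K G_def by simp
  qed
qed

text \<open>The inner inverse transform is evaluated at each \<open>\<rho>\<close>, so integrability
  is required for every \<open>\<eta>\<close> and not only for almost every one, as Fubini would
  give.\<close>

lemma integrable_G_fst: "integrable lborel (\<lambda>\<xi>. G \<xi> \<eta>)"
proof -
  have K: "(\<lambda>\<xi>. K \<xi> \<eta>) \<in> borel_measurable borel"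
    using measurable_compose[OF measurable_Pair2' borel_measurable_K, of \<eta>] by simp
  have i: "integrable lborel (\<lambda>\<xi>. norm \<xi> powr (- k) *\<^sub>R F (\<xi>, \<eta>))"
  proof (rule integrable_powr_mult)
    fix N
    obtain C where "C > 0" "\<And>\<xi> \<eta>. norm (F (\<xi>, \<eta>)) \<le> C / ((1 + norm \<xi>) ^ N * (1 + norm \<eta>) ^ 0)"
      using F_decay by blast
    then show "\<exists>C>0. \<forall>\<xi>. norm (F (\<xi>, \<eta>)) \<le> C / (1 + norm \<xi>) ^ N" by auto
  qed (use k in simp_all)
  show ?thesis
  proof (rule Bochner_Integration.integrable_bound[OF i])
    show "(\<lambda>\<xi>. G \<xi> \<eta>) \<in> borel_measurable lborel" unfolding G_def using K by simp
    show "AE \<xi> in lborel. norm (G \<xi> \<eta>) \<le> norm (norm \<xi> powr (- k) *\<^sub>R F (\<xi>, \<eta>))"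
      unfolding G_def norm_mult using mult_right_mono[OF norm_K_le norm_ge_zero] by (intro AE_I2) (simp only: mult_1)
  qed
qed

text \<open>The inner Hankel transform carries \<open>F1 \<xi>\<close> to \<open>F\<close>, and the
  outer one inverts the transform in the second variable. What lies between them is the inverse
  transform in \<open>\<xi>\<close> of the cut-off symbol, recorded by \<open>L\<close>; it extends
  from radii to a radial function on \<open>real^'m\<close>.\<close>

lemma proj_rad_formula_riesz1:
  assumes z: "z > 0"
  shows "proj_rad_formula a b (riesz1 k f_rad) (x, z) = proj a b (riesz1 k f) (x, z *\<^sub>R e)"
proof -
  let ?c = "(2 * pi) powi (- int CARD('m))" and ?\<kappa> = "inverse (sqrt (2 * pi) ^ CARD('m))"
  define g where "g = inv_fourier1 (\<lambda>(\<xi>, \<rho>).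
               indicator {\<rho>. a * norm \<xi> < \<rho> \<and> ereal \<rho> < b * ereal (norm \<xi>)} \<rho> *
               (\<rho> powr (- \<nu>) *\<^sub>R hankel \<nu> (\<lambda>s. fourier1 (riesz1 k f_rad) (\<xi>, s)) \<rho>))"
  define L where "L \<eta> = fourier_L1 (\<lambda>\<xi>. G \<xi> \<eta>) (- x)" for \<eta>
  have Lnorm: "L (norm \<eta> *\<^sub>R e) = L \<eta>" for \<eta>
  proof -
    have "G \<xi> (norm \<eta> *\<^sub>R e) = G \<xi> \<eta>" for \<xi>
      by (rule G_radial) (simp only: norm_scale_e norm_ge_zero)
    then show ?thesis by (simp only: L_def)
  qed
  have gL: "g (x, \<rho>) = (?c * ?\<kappa>) *\<^sub>R L (\<rho> *\<^sub>R e)" if "\<rho> > 0" for \<rho>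
  proof -
    have "g (x, \<rho>) = inv_fourier (\<lambda>\<xi>. ?\<kappa> *\<^sub>R G \<xi> (\<rho> *\<^sub>R e)) x"
      unfolding g_def inv_fourier1_def by (simp only: prod.case hankel_fourier1_riesz1[OF that])
    also have "\<dots> = ?c *\<^sub>R fourier_L1 (\<lambda>\<xi>. ?\<kappa> *\<^sub>R G \<xi> (\<rho> *\<^sub>R e)) (- x)"
      by (subst inv_fourier_integrable) (auto intro: integrable_G_fst)
    also have "fourier_L1 (\<lambda>\<xi>. ?\<kappa> *\<^sub>R G \<xi> (\<rho> *\<^sub>R e)) (- x) = ?\<kappa> *\<^sub>R L (\<rho> *\<^sub>R e)"
      unfolding L_def fourier_L1_def mult_scaleR_right by (rule integral_scaleR_right)
    finally show ?thesis by simp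
  qed
  have iL: "integrable lborel L"
  proof -
    have "integrable (lborel \<Otimes>\<^sub>M lborel) (\<lambda>(\<xi>, \<eta>). wave \<xi> (- x) * G \<xi> \<eta>)"
    proof (rule Bochner_Integration.integrable_bound)
      show "integrable (lborel \<Otimes>\<^sub>M lborel) (\<lambda>(\<xi>, \<eta>). G \<xi> \<eta>)"
        using integrable_G by (simp add: lborel_prod)
      from borel_measurable_integrable[OF this]
      show "(\<lambda>(\<xi>, \<eta>). wave \<xi> (- x) * G \<xi> \<eta>) \<in> borel_measurable (lborel \<Otimes>\<^sub>M lborel)"
        unfolding case_prod_unfold by simp
    qed (simp add: norm_mult case_prod_unfold)
    from lborel_pair.integrable_snd[OF this] show ?thesis
      unfolding L_def[abs_def] fourier_L1_def .
  qed
  have "proj_rad_formula a b (riesz1 k f_rad) (x, z) = z powr (- \<nu>) *\<^sub>R hankel \<nu> (\<lambda>\<rho>. g (x, \<rho>)) z"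
    unfolding proj_rad_formula_def Let_def g_def \<nu>_def by (simp only: prod.case)
  also have "\<dots> = ?\<kappa> *\<^sub>R fourier_L1 (\<lambda>\<eta>. (?c * ?\<kappa>) *\<^sub>R L (norm \<eta> *\<^sub>R e)) (z *\<^sub>R e)"
    by (rule hankel_eq[OF _ z, where H="\<lambda>\<rho>. (?c * ?\<kappa>) *\<^sub>R L (\<rho> *\<^sub>R e)"])
       (unfold Lnorm, intro integrable_scaleR_right iL, rule gL)
  also have "fourier_L1 (\<lambda>\<eta>. (?c * ?\<kappa>) *\<^sub>R L (norm \<eta> *\<^sub>R e)) (z *\<^sub>R e) = (?c * ?\<kappa>) *\<^sub>R fourier_L1 L (z *\<^sub>R e)"
    unfolding Lnorm fourier_L1_def mult_scaleR_right by (rule integral_scaleR_right)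
  \<comment> \<open>The outer Hankel transform yields a forward Fourier transform, which for radial
    \<open>L\<close> agrees with the inverse one up to a constant.\<close>
  also have "fourier_L1 L (z *\<^sub>R e) = fourier_L1 L (- (z *\<^sub>R e))"
  proof (rule fourier_L1_radial)
    show "L \<in> borel_measurable borel" using iL by auto
    show "L (U \<eta>) = L \<eta>" if "orthogonal_transformation U" for U \<eta>
      using Lnorm[of "U \<eta>"] Lnorm[of \<eta>] orthogonal_transformation_norm[OF that, of \<eta>] by simp
  qed simp
  also have "fourier_L1 L (- (z *\<^sub>R e)) = fourier_L1 (\<lambda>(\<xi>, \<eta>). G \<xi> \<eta>) (- x, - (z *\<^sub>R e))"
    by (subst fourier_L1_pair(1)[OF integrable_G]) (simp add: L_def[abs_def])
  also have "?\<kappa> *\<^sub>R (?c * ?\<kappa>) *\<^sub>R fourier_L1 (\<lambda>(\<xi>, \<eta>). G \<xi> \<eta>) (- x, - (z *\<^sub>R e)) = proj a b (riesz1 k f) (x, z *\<^sub>R e)"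
  proof -
    \<comment> \<open>Each Hankel transform contributes one \<open>?\<kappa>\<close>; together they
      supply the normalisation of the inverse transform in the second variable.\<close>
    have "?\<kappa> * ?\<kappa> = ?c"
      unfolding inverse_mult_distrib[symmetric] power_mult_distrib[symmetric] power_int_minus power_int_of_nat by simp
    then have "?\<kappa> * (?c * ?\<kappa>) = ?c * ?c" by (metis mult.left_commute)
    also have "\<dots> = (2 * pi) powi (- int (CARD('m) + CARD('m)))"
      unfolding power_int_minus power_int_of_nat power_add by (rule inverse_mult_distrib[symmetric])
    finally show ?thesis
      unfolding proj_riesz1_f inv_fourier_integrable[OF integrable_G] scaleR_scaleR by simp
  qed
  finally show ?thesis .
qed

text \<open>At \<open>z = 0\<close> the left side is a limit from the right. The formula agrees with
  \<open>proj\<close> for \<open>z > 0\<close>, and \<open>proj\<close> is continuous as the inverse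
  transform of the integrable function \<open>G\<close>, so the limit is its value at 0.\<close>

lemma proj_rad_riesz1:
  assumes z: "z \<ge> 0"
  shows "proj_rad a b (riesz1 k f_rad) (x, z) = proj a b (riesz1 k f) (x, z *\<^sub>R e)"
proof (cases "z = 0")
  case False
  then show ?thesis using z by (simp add: proj_rad_def proj_rad_formula_riesz1)
next
  case True
  let ?P = "\<lambda>y. proj a b (riesz1 k f) (x, y)"
  have "continuous_on UNIV (fourier_L1 (\<lambda>(\<xi>, \<eta>). G \<xi> \<eta>))"
    by (rule continuous_on_fourier_L1[OF integrable_G])
  then have c: "isCont (fourier_L1 (\<lambda>(\<xi>, \<eta>). G \<xi> \<eta>)) p" for p
    using continuous_on_eq_continuous_at[OF open_UNIV] by blast
  have "((\<lambda>t. (- x, - (t *\<^sub>R e))) \<longlongrightarrow> (- x, - (0 *\<^sub>R e))) (at_right 0)"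
    by (intro tendsto_intros)
  from isCont_tendsto_compose[OF c this]
  have "((\<lambda>t. ?P (t *\<^sub>R e)) \<longlongrightarrow> ?P (0 *\<^sub>R e)) (at_right 0)"
    unfolding proj_riesz1_f inv_fourier_integrable[OF integrable_G] by (intro tendsto_intros) simp
  then have "((\<lambda>t. proj_rad_formula a b (riesz1 k f_rad) (x, t)) \<longlongrightarrow> ?P (0 *\<^sub>R e)) (at_right 0)"
    by (rule Lim_transform_eventually)
       (use eventually_at_right_less[of 0] in eventually_elim, simp add: proj_rad_formula_riesz1)
  from tendsto_Lim[OF _ this] show ?thesis
    using True by (simp add: proj_rad_def)
qed

end

theorem theorem8:
  fixes n :: nat and a k :: real and b :: ereal
    and f :: "(real^'m) \<times> (real^'m) \<Rightarrow> complex"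
    and f_rad :: "(real^'m) \<times> real \<Rightarrow> complex"
  assumes "n \<ge> 2" and "CARD('m) = n - 1"
    and "0 \<le> a" and "ereal a < b"
    and "f \<in> schwartz_radial"
    and "\<And>x y. f (x, y) = f_rad (x, norm y)"
    and "k < real n - 1"
  shows "(\<forall>x y. proj a b (riesz1 k f) (x, y) =
            (2 * pi) powi (1 - int n) *\<^sub>R
              cone_transform (riesz1 (k + 1 - real n) (cone_lim a b f)) (x, y)) \<and>
         (\<forall>x. \<forall>z\<ge>0. proj_rad a b (riesz1 k f_rad) (x, z) =
            (2 * pi) powi (1 - int n) *\<^sub>R
              cone_rad (riesz1 (k + 1 - real n) (cone_rad_lim a b f_rad)) (x, z))"
proof -
  obtain e :: "real^'m" where e: "e \<in> Basis" using nonempty_Basis by blast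
  have k: "k < real CARD('m)" using assms(1,2,7) by (simp add: of_nat_diff)
  interpret radial_schwartz_profile f a k b f_rad e
    using assms(3,5,6) e k by unfold_locales
  \<comment> \<open>The subtraction in \<open>n - 1\<close> is genuine because
    \<open>n \<ge> 2\<close>.\<close>
  have n: "1 - int n = - int CARD('m)" "k + 1 - real n = k - real CARD('m)"
    using assms(1,2) by (simp_all add: of_nat_diff)
  show ?thesis
    unfolding n using proj_riesz1_cone_rad
    by (intro conjI allI impI proj_riesz1) (simp only: proj_rad_riesz1)
qed

end
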